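(* Let $p\ge 2$ be a fixed integer, $N=2pW$, and let $H$ be a real symmetric $N\times N$ random band matrix as described in the context, with $H^{\mathbf g}$, $B$, $D^{\mathbf g}$ as defined there. There exists $\mu>0$ such that for any $c>0$ and any $K>0$, for all large enough $N$, $$\mathbb P\Big(\exists e\in\mathbb R,\ \exists\mathbf u\in\mathbb R^{N-W},\ \exists\mathbf g\in\mathbb R^N:\ \|\mathbf g\|_\infty\le N^{-c},\ \|\mathbf u\|=1,\ \|(D^{\mathbf g}-e)\mathbf u\|\le\mu,\ \sum_{1\le i\le W}|u_i|^2\le\mu^2\Big)\le N^{-K},$$ and the probability that there exist $\mathbf g\in\mathbb R^N$ with $\|\mathbf g\|_\infty\le N^{-c}$, $e\in\mathbb R$ (with $e\notin\sigma(D^{\mathbf g})$) and a unit vector $\mathbf u\in\mathbb R^W$ such that $$\Big\langle\mathbf u,\ B^*\frac{\mu^2}{(D^{\mathbf g}-e)^2}B\,\mathbf u\Big\rangle\ \ge\ \Big\langle\mathbf u,\ \Big[\Big(B^*\frac1{D^{\mathbf g}-e}B\Big)^2+1\Big]\mathbf u\Big\rangle$$ is at most $N^{-K}$.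
   Context: Band matrix model: $N=2pW$ with $p$ fixed and $W\to\infty$ through the integers. $|i-j|$ denotes the periodic distance (mod $N$) on $\{1,\dots,N\}$. $H=H^{(N)}$ is a real symmetric $N\times N$ random matrix whose entries are centered and independent up to the symmetry constraint, with $H_{ij}=0$ if $|i-j|\ge 2W$ and $s_{ij}:=\mathbb E(H_{ij}^2)=\frac{1}{4W-1}$ if $|i-j|<2W$ (so $\sum_j s_{ij}=1$ for all $i$), and for some $\delta_0>0$, $\sup_{N,i,j}\mathbb E\big(e^{\delta_0 W H_{ij}^2}\big)<\infty$. For $\mathbf g\in\mathbb R^N$ let $H^{\mathbf g}=H-\sum_{j=1}^N g_j\mathbf e_j\mathbf e_j^*$ and write it in block form $H^{\mathbf g}=\begin{pmatrix}A^{\mathbf g}&B^*\\ B&D^{\mathbf g}\end{pmatrix}$, where $A^{\mathbf g}$ is $W\times W$, $B$ is $(N-W)\times W$ and $D^{\mathbf g}$ is $(N-W)\times(N-W)$. $\sigma(\cdot)$ denotes the spectrum, $\|\cdot\|$ the Euclidean norm. *)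

theory Defs
  imports
    "HOL-Probability.Probability"
    "Jordan_Normal_Form.Spectral_Radius"
    "Jordan_Normal_Form.Gauss_Jordan_Elimination"
begin

unbundle no vec_syntax and no inner_syntax

text \<open>
  Dimensions vary with the band width, so matrices and vectors are those of
  Jordan_Normal_Form. Their indices start at 0; the periodic distance is invariant under
  this shift of the index set.
\<close>

definition periodic_dist :: "nat \<Rightarrow> nat \<Rightarrow> nat \<Rightarrow> nat" where
  "periodic_dist N i j = (let d = nat \<bar>int i - int j\<bar> in min d (N - d))"

definition l2_norm :: "real vec \<Rightarrow> real" where
  "l2_norm v = L2_set (\<lambda>i. v $ i) {..<dim_vec v}"

definition linf_norm :: "real vec \<Rightarrow> real" where
  "linf_norm v = (MAX i\<in>{..<dim_vec v}. \<bar>v $ i\<bar>)"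

text \<open>
  A random matrix is a map from a probability space to matrices. Independence up to the
  symmetry constraint means independence of the entries on and above the diagonal; it also
  contains the measurability of these entries.
\<close>

definition random_band_matrix :: "nat \<Rightarrow> nat \<Rightarrow> 'w measure \<Rightarrow> ('w \<Rightarrow> real mat) \<Rightarrow> bool" where
  "random_band_matrix N W M H \<longleftrightarrow>
     prob_space M \<and>
     (\<forall>\<omega>\<in>space M. H \<omega> \<in> carrier_mat N N \<and> (H \<omega>)\<^sup>T = H \<omega>) \<and>
     prob_space.indep_vars M (\<lambda>_. borel) (\<lambda>ij \<omega>. H \<omega> $$ ij) {(i, j). i \<le> j \<and> j < N} \<and>
     (\<forall>i<N. \<forall>j<N.
        integrable M (\<lambda>\<omega>. H \<omega> $$ (i, j)) \<and>
        prob_space.expectation M (\<lambda>\<omega>. H \<omega> $$ (i, j)) = 0 \<and>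
        (if periodic_dist N i j < 2 * W
         then integrable M (\<lambda>\<omega>. (H \<omega> $$ (i, j))\<^sup>2) \<and>
              prob_space.expectation M (\<lambda>\<omega>. (H \<omega> $$ (i, j))\<^sup>2) = 1 / (4 * real W - 1)
         else (\<forall>\<omega>\<in>space M. H \<omega> $$ (i, j) = 0)))"

text \<open>The size of the matrix of band width parameter \<open>W\<close> is \<open>N = 2pW\<close>.\<close>

definition subgaussian_entries ::
    "nat \<Rightarrow> (nat \<Rightarrow> 'w measure) \<Rightarrow> (nat \<Rightarrow> 'w \<Rightarrow> real mat) \<Rightarrow> bool" where
  "subgaussian_entries p M H \<longleftrightarrow>
     (\<exists>\<delta>>0. (SUP W\<in>{1..}. SUP i\<in>{..<2 * p * W}. SUP j\<in>{..<2 * p * W}.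
        (\<integral>\<^sup>+ \<omega>. ennreal (exp (\<delta> * real W * (H W \<omega> $$ (i, j))\<^sup>2)) \<partial>M W)) < \<infinity>)"

definition shifted :: "real mat \<Rightarrow> real vec \<Rightarrow> real mat" where
  "shifted H g = H - mat_diag (dim_vec g) (\<lambda>j. g $ j)"

text \<open>
  Lower left and lower right block, the upper left block being of size \<open>W \<times> W\<close>. For symmetric
  matrices the upper right block is the transpose of the lower left one.
\<close>

definition B_block :: "nat \<Rightarrow> real mat \<Rightarrow> real mat" where
  "B_block W X = (case split_block X W W of (A, B', B, D) \<Rightarrow> B)"

definition D_block :: "nat \<Rightarrow> real mat \<Rightarrow> real mat" where
  "D_block W X = (case split_block X W W of (A, B', B, D) \<Rightarrow> D)"

text \<open>Only meaningful for \<open>e\<close> outside the spectrum: otherwise \<open>mat_inverse\<close> returns \<open>None\<close>.\<close>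

definition resolvent :: "real mat \<Rightarrow> real \<Rightarrow> real mat" where
  "resolvent D e = the (mat_inverse (D - e \<cdot>\<^sub>m 1\<^sub>m (dim_row D)))"

end

theory Submission
  imports Defs "HOL-Real_Asymp.Real_Asymp"
begin

text \<open>
  Both events reduce to one statement. Let \<open>u\<close> be a unit vector that vanishes before block \<open>l\<close>
  (blocks have size \<open>W\<close>) and has little mass on block \<open>l\<close>; then, with overwhelming probability,
  the rows of \<open>(H - e) u\<close> from block \<open>l\<close> on are not all small, whatever \<open>u\<close> and \<open>e\<close> are. The first
  event is the case \<open>l = 1\<close>. The second is the case \<open>l = 0\<close>, applied to the normalised vector
  \<open>(D - e)\<close>-inverse \<open>B u\<close>. The perturbation \<open>g\<close> is absorbed into the error.

  There are more equations than unknowns: the rows that see the support of \<open>u\<close> outnumber the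
  support by about \<open>W / 2\<close>, because the block of rows preceding the first heavily occupied block
  sees that block too. Giving each row the entries on and to the right of the diagonal makes the
  rows independent. A row that sees \<open>\<alpha> W\<close> coordinates of size \<open>\<tau> / sqrt W\<close> is of size
  \<open>s / sqrt W\<close> with probability \<open>O(s / \<tau>)\<close> only, by averaging characteristic functions against a
  Gaussian. This beats a net of mesh \<open>s / sqrt W\<close>, which costs a factor \<open>O(1 / s)\<close> per coordinate,
  as soon as \<open>s\<close> is small compared with \<open>\<tau>\<close>. By pigeonhole, some pair of consecutive scales
  \<open>s = \<tau> (Suc k)\<close> and \<open>\<tau> k\<close> has few coordinates in between. If very few coordinates of \<open>u\<close> are
  visible at scale \<open>\<tau> 0\<close>, then the net is so small that a constant probability per row suffices.
\<close>

subsection \<open>Small ball estimates for linear forms\<close>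

text \<open>Both the size of the net and the small ball probability are exponential in
  \<open>W\<close>, so the constants decide. At mesh \<open>s = \<tau> / n\<close> a row costs
  \<open>q = 4 / (n * sqrt \<alpha>)\<close>, hence \<open>q / s\<close> does not depend on
  \<open>n\<close>: one row cancels one coordinate of the net up to a factor fixed before
  \<open>n\<close> is chosen. Equal numbers of rows and coordinates would therefore not suffice; it
  is the surplus of \<open>W / 4\<close> rows, worth \<open>q powr (W / 4)\<close>, that wins once
  \<open>n\<close> is large. Coordinates between two consecutive scales survive the rounding, so the
  net pays for them, but they are too small to help a row; they have to fit into the surplus, so at
  most \<open>W / 8\<close> of them are tolerated. Since there are \<open>2 * p * W\<close>
  coordinates, \<open>16 * p\<close> scales are enough for the pigeonhole. This number is
  independent of \<open>W\<close>, and so is the smallest scale, which determines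
  \<open>\<mu>\<close>. The operator norm bound confines \<open>e\<close> to a bounded interval and
  turns rounding of the vector into a residual of order \<open>s\<close>. Shifts of a row are
  harmless throughout: they only change a phase.\<close>

text \<open>A Gaussian is its own Fourier transform, so Fubini exchanges the two averages; the
  absolute value then removes the phase that carries \<open>a\<close>. Uniformity in the shift is
  what later allows part of a row to be frozen.\<close>

lemma gaussian_average_le_char:
  assumes "real_distribution \<nu>" and s: "s > 0"
  shows "(\<integral>x. exp (- (x + a)\<^sup>2 / (2 * s\<^sup>2)) \<partial>\<nu>)
    \<le> (\<integral>G. cmod (char \<nu> (G / s)) \<partial>std_normal_distribution)"
proof -
  interpret nu: real_distribution \<nu> by fact
  interpret N: real_distribution std_normal_distribution by (rule real_dist_normal_dist)
  interpret P: pair_prob_space \<nu> std_normal_distribution ..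
  have [measurable]: "char \<nu> \<in> borel_measurable borel"
    by (rule nu.char_measurable)
  have "complex_of_real (\<integral>x. exp (- (x + a)\<^sup>2 / (2 * s\<^sup>2)) \<partial>\<nu>)
      = (\<integral>x. char std_normal_distribution ((x + a) / s) \<partial>\<nu>)"
    unfolding char_std_normal_distribution integral_complex_of_real[symmetric]
    by (simp add: power_divide mult.commute)
  also have "\<dots> = (\<integral>x. (\<integral>G. iexp ((x + a) / s * G) \<partial>std_normal_distribution) \<partial>\<nu>)"
    unfolding char_def ..
  also have "\<dots> = (\<integral>G. (\<integral>x. iexp ((x + a) / s * G) \<partial>\<nu>) \<partial>std_normal_distribution)"
    by (rule P.Fubini_integral[symmetric], rule P.P.integrable_const_bound[where B = 1])
       (auto simp: split_def)
  also have "\<dots> = (\<integral>G. iexp (a * G / s) * char \<nu> (G / s) \<partial>std_normal_distribution)"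
  proof -
    have "iexp ((x + a) / s * G) = iexp (a * G / s) * iexp (G / s * x)" for x G
      by (simp add: exp_add[symmetric] ring_distribs add_divide_distrib ac_simps)
    then show ?thesis unfolding char_def by (simp only: integral_mult_right_zero)
  qed
  finally have eq: "complex_of_real (\<integral>x. exp (- (x + a)\<^sup>2 / (2 * s\<^sup>2)) \<partial>\<nu>)
    = (\<integral>G. iexp (a * G / s) * char \<nu> (G / s) \<partial>std_normal_distribution)" .
  have "(\<integral>x. exp (- (x + a)\<^sup>2 / (2 * s\<^sup>2)) \<partial>\<nu>)
    \<le> cmod (\<integral>G. iexp (a * G / s) * char \<nu> (G / s) \<partial>std_normal_distribution)"
    unfolding eq[symmetric] norm_of_real by (rule abs_ge_self)
  also have "\<dots> \<le> (\<integral>G. cmod (iexp (a * G / s) * char \<nu> (G / s)) \<partial>std_normal_distribution)"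
    by (rule integral_norm_bound)
  finally show ?thesis by (simp add: norm_mult)
qed

text \<open>Third-order Taylor expansion at 0: the second condition on \<open>t\<close> makes the
  remainder at most half of the quadratic term \<open>t\<^sup>2 * \<sigma>2 / 2\<close>.\<close>

lemma (in real_distribution) norm_char_le_exp:
  assumes "integrable M (\<lambda>x. x\<^sup>2)" "expectation (\<lambda>x. x) = 0"
    and var: "expectation (\<lambda>x. x\<^sup>2) = \<sigma>2"
    and third: "integrable M (\<lambda>x. \<bar>x\<bar> ^ 3)" "expectation (\<lambda>x. \<bar>x\<bar> ^ 3) \<le> B"
    and t: "t\<^sup>2 * \<sigma>2 \<le> 2" "\<bar>t\<bar> * B \<le> 3 / 2 * \<sigma>2"
  shows "cmod (char M t) \<le> exp (- (t\<^sup>2 * \<sigma>2 / 4))"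
proof -
  have int1: "integrable M (\<lambda>x. x)"
    using square_integrable_imp_integrable[OF _ assms(1)] by simp
  have v: "variance (\<lambda>x. x) = \<sigma>2" using assms(2) var by simp
  have "cmod (char M t - (1 - t\<^sup>2 * \<sigma>2 / 2))
     \<le> (t\<^sup>2 / 6) * expectation (\<lambda>x. min (6 * x\<^sup>2) (\<bar>t\<bar> * \<bar>x\<bar> ^ 3))"
    by (rule char_approx3[OF int1 assms(2) assms(1) v])
  also have "\<dots> \<le> (t\<^sup>2 / 6) * (\<bar>t\<bar> * B)"
  proof -
    have "expectation (\<lambda>x. min (6 * x\<^sup>2) (\<bar>t\<bar> * \<bar>x\<bar> ^ 3)) \<le> expectation (\<lambda>x. \<bar>t\<bar> * \<bar>x\<bar> ^ 3)"
      by (rule integral_mono) (auto intro!: integrable_min assms third)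
    also have "\<dots> \<le> \<bar>t\<bar> * B" using third by (simp add: mult_left_mono)
    finally show ?thesis by (simp add: mult_left_mono)
  qed
  also have "\<dots> \<le> (t\<^sup>2 / 6) * (3 / 2 * \<sigma>2)" by (rule mult_left_mono[OF t(2)]) simp
  also have "\<dots> = t\<^sup>2 * \<sigma>2 / 4" by simp
  finally have 1: "cmod (char M t - (1 - t\<^sup>2 * \<sigma>2 / 2)) \<le> t\<^sup>2 * \<sigma>2 / 4" .
  have "cmod (char M t) \<le> cmod (char M t - (1 - t\<^sup>2 * \<sigma>2 / 2)) + cmod (complex_of_real (1 - t\<^sup>2 * \<sigma>2 / 2))"
    by (metis diff_add_cancel norm_triangle_ineq of_real_1 of_real_diff of_real_divide of_real_mult of_real_numeral of_real_power)
  also have "cmod (complex_of_real (1 - t\<^sup>2 * \<sigma>2 / 2)) = 1 - t\<^sup>2 * \<sigma>2 / 2"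
    using t(1) unfolding norm_of_real by simp
  finally have "cmod (char M t) \<le> 1 + - (t\<^sup>2 * \<sigma>2 / 4)" using 1 by simp
  also have "\<dots> \<le> exp (- (t\<^sup>2 * \<sigma>2 / 4))" by (rule exp_ge_add_one_self)
  finally show ?thesis .
qed

lemma cube_le_exp_square: "\<bar>y\<bar> ^ 3 \<le> 3 * exp (y\<^sup>2 :: real)"
proof -
  have "\<bar>y\<bar> ^ 3 \<le> 1 + (y\<^sup>2)\<^sup>2"
  proof (cases "\<bar>y\<bar> \<le> 1")
    case True
    then have "\<bar>y\<bar> ^ 3 \<le> 1" by (simp add: power_le_one)
    then show ?thesis by (smt (verit) zero_le_power2)
  next
    case False
    then have "\<bar>y\<bar> ^ 3 \<le> \<bar>y\<bar> ^ 4" by (intro power_increasing) auto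
    then show ?thesis by simp
  qed
  also have "(y\<^sup>2)\<^sup>2 \<le> 2 * exp (y\<^sup>2)"
    using exp_lower_Taylor_quadratic[of "y\<^sup>2"] by (simp add: field_simps) (smt (verit) zero_le_power2)
  also have "1 \<le> exp (y\<^sup>2)" by simp
  finally show ?thesis by simp
qed

lemma char_PiM_linear_form:
  assumes "finite J" and P: "\<And>j. j \<in> J \<Longrightarrow> real_distribution (P j)"
  shows "char (distr (PiM J P) borel (\<lambda>y. \<Sum>j\<in>J. y j * v j)) t = (\<Prod>j\<in>J. char (P j) (t * v j))"
proof -
  \<comment> \<open>Product probability spaces require a probability measure at every index, so the
    family is filled up outside \<open>J\<close> with an arbitrary one.\<close>
  define P' where "P' j = (if j \<in> J then P j else std_normal_distribution)" for j
  have eq: "PiM J P = PiM J P'" by (rule PiM_cong) (auto simp: P'_def)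
  have R: "real_distribution (P' j)" for j using P real_dist_normal_dist by (simp add: P'_def)
  have ps: "prob_space (P' j)" for j using R real_distribution.axioms(1) by blast
  interpret product_prob_space P' J
    by (rule product_prob_spaceI) (rule ps)
  have [measurable_cong]: "sets (P' j) = sets borel" for j using R real_distribution.events_eq_borel by blast
  have 1: "indep_vars P' (\<lambda>j y. y j) J" 
  proof (cases "J = {}")
    case True
    then show ?thesis unfolding indep_vars_def indep_sets_def by auto
  next
    case False
    have "distr (PiM J P') (PiM J P') (\<lambda>y. \<lambda>j\<in>J. y j) = PiM J P'"
      by (subst distr_cong[OF refl refl, where g = "\<lambda>y. y"])
         (auto simp: space_PiM PiE_restrict distr_id2)
    also have "\<dots> = (\<Pi>\<^sub>M j\<in>J. distr (PiM J P') (P' j) (\<lambda>y. y j))"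
      by (intro PiM_cong refl) (simp add: PiM_component)
    finally show ?thesis by (subst indep_vars_iff_distr_eq_PiM'[OF False]) auto
  qed
  have 2: "indep_vars (\<lambda>_. borel) (\<lambda>j y. y j * v j) J"
    by (rule indep_vars_compose2[OF 1]) measurable
  have "char (distr (PiM J P') borel (\<lambda>y. y j * v j)) t = char (P' j) (t * v j)" if "j \<in> J" for j
  proof -
    have "char (distr (PiM J P') borel (\<lambda>y. y j * v j)) t = (\<integral>y. iexp (t * (y j * v j)) \<partial>PiM J P')"
      unfolding char_def using that by (subst integral_distr) auto
    also have "\<dots> = (\<integral>x. iexp (t * (x * v j)) \<partial>distr (PiM J P') (P' j) (\<lambda>y. y j))"
      using that by (subst integral_distr) auto
    also have "distr (PiM J P') (P' j) (\<lambda>y. y j) = P' j" using that by (rule PiM_component)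
    finally show ?thesis unfolding char_def by (simp add: ac_simps)
  qed
  then show ?thesis unfolding eq char_distr_sum[OF 2] using P by (auto intro!: prod.cong simp: P'_def)
qed

text \<open>
  The Gaussian average of the product of the characteristic functions of the summands: the
  Gaussian decay of the product is known only up to a cutoff \<open>c\<close>.
\<close>

definition cut_gauss :: "real \<Rightarrow> real \<Rightarrow> real" where
  "cut_gauss c s = (\<integral>G. (if \<bar>G\<bar> \<le> c then exp (- (G\<^sup>2 * s)) else 1) \<partial>std_normal_distribution)"

text \<open>Only the factors in \<open>V\<close> need to decay; the others are bounded by 1. The
  factor of \<open>j\<close> has the argument \<open>G * v j * sqrt W / t\<close>, and
  \<open>c * b \<le> c0 * t\<close> keeps it in the range of decay as long as \<open>G\<close> is
  below the cutoff.\<close>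

lemma PiM_linear_form_small_ball:
  assumes fin: "finite J" and P: "\<And>j. j \<in> J \<Longrightarrow> real_distribution (P j)"
    and VJ: "V \<subseteq> J" and W: "W > 0" and t: "t > 0"
    and decay: "\<And>j \<xi>. j \<in> V \<Longrightarrow> \<bar>\<xi>\<bar> \<le> c0 * sqrt W \<Longrightarrow> cmod (char (P j) \<xi>) \<le> exp (- (\<xi>\<^sup>2 / (16 * W)))"
    and b: "\<And>j. j \<in> V \<Longrightarrow> \<bar>v j\<bar> \<le> b" and c: "c * b \<le> c0 * t"
    and s0: "s \<ge> 0" and s: "16 * t\<^sup>2 * s \<le> (\<Sum>j\<in>V. (v j)\<^sup>2)"
  shows "(\<integral>\<^sup>+y. ennreal (exp (- (W * ((\<Sum>j\<in>J. y j * v j) + a)\<^sup>2 / (2 * t\<^sup>2)))) \<partial>PiM J P)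
    \<le> ennreal (cut_gauss c s)"
proof -
  let ?D = "distr (PiM J P) borel (\<lambda>y. \<Sum>j\<in>J. y j * v j)"
  have ps: "prob_space (PiM J P)"
    by (rule prob_space_PiM) (use P in \<open>auto dest: real_distribution.axioms\<close>)
  have [measurable]: "(\<lambda>y. \<Sum>j\<in>J. y j * v j) \<in> borel_measurable (PiM J P)"
  proof (intro borel_measurable_sum borel_measurable_times borel_measurable_const)
    fix j assume j: "j \<in> J"
    then have "(\<lambda>y. y j) \<in> measurable (PiM J P) (P j)" by (rule measurable_component_singleton)
    then show "(\<lambda>y. y j) \<in> borel_measurable (PiM J P)"
      using real_distribution.events_eq_borel[OF P[OF j]] by (simp cong: measurable_cong_sets)
  qed
  have rd: "real_distribution ?D"
    by (intro real_distribution.intro prob_space.prob_space_distr[OF ps]) (auto simp: real_distribution_axioms_def)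
  interpret D: real_distribution ?D by fact
  interpret N: real_distribution std_normal_distribution by (rule real_dist_normal_dist)
  define s' where "s' = t / sqrt W"
  have s': "s' > 0" using t W by (simp add: s'_def)
  have "(\<integral>\<^sup>+y. ennreal (exp (- (W * ((\<Sum>j\<in>J. y j * v j) + a)\<^sup>2 / (2 * t\<^sup>2)))) \<partial>PiM J P)
    = (\<integral>\<^sup>+x. ennreal (exp (- (x + a)\<^sup>2 / (2 * s'\<^sup>2))) \<partial>?D)"
    using W by (subst nn_integral_distr) (simp_all add: s'_def power_divide mult.commute)
  also have "\<dots> = ennreal (\<integral>x. exp (- (x + a)\<^sup>2 / (2 * s'\<^sup>2)) \<partial>?D)"
    by (rule nn_integral_eq_integral) (auto intro!: D.integrable_const_bound[where B = 1])
  also have "\<dots> \<le> ennreal (\<integral>G. cmod (char ?D (G / s')) \<partial>std_normal_distribution)"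
    by (intro ennreal_leI gaussian_average_le_char rd s')
  also have "\<dots> \<le> ennreal (cut_gauss c s)"
  proof (rule ennreal_leI, unfold cut_gauss_def, rule integral_mono)
    have [measurable]: "char ?D \<in> borel_measurable borel" by (rule D.char_measurable)
    show "integrable std_normal_distribution (\<lambda>G. cmod (char ?D (G / s')))"
      by (rule N.integrable_const_bound[where B = 1]) (auto simp: D.cmod_char_le_1)
    show "integrable std_normal_distribution (\<lambda>G. if \<bar>G\<bar> \<le> c then exp (- (G\<^sup>2 * s)) else 1)"
      by (rule N.integrable_const_bound[where B = 1]) (use s0 in auto)
    fix G
    have "cmod (char ?D (G / s')) = (\<Prod>j\<in>J. cmod (char (P j) (G / s' * v j)))"
      by (subst char_PiM_linear_form[OF fin P]) (simp_all add: prod_norm)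
    also have "\<dots> = (\<Prod>j\<in>V. cmod (char (P j) (G / s' * v j))) * (\<Prod>j\<in>J - V. cmod (char (P j) (G / s' * v j)))"
      using prod.subset_diff[OF VJ fin] by (simp add: mult.commute)
    also have "\<dots> \<le> (\<Prod>j\<in>V. if \<bar>G\<bar> \<le> c then exp (- (G\<^sup>2 * (v j)\<^sup>2 / (16 * t\<^sup>2))) else 1) * 1"
    proof (intro mult_mono prod_le_1 prod_mono prod_nonneg conjI norm_ge_zero)
      fix j assume j: "j \<in> V"
      interpret Pj: real_distribution "P j" using j VJ P by auto
      show "cmod (char (P j) (G / s' * v j)) \<le> (if \<bar>G\<bar> \<le> c then exp (- (G\<^sup>2 * (v j)\<^sup>2 / (16 * t\<^sup>2))) else 1)"
      proof (cases "\<bar>G\<bar> \<le> c")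
        case True
        have "\<bar>G\<bar> * \<bar>v j\<bar> \<le> c * b" using True b[OF j] by (intro mult_mono) auto
        then have "\<bar>G\<bar> * \<bar>v j\<bar> \<le> c0 * t" using c by simp
        then have "\<bar>G / s' * v j\<bar> \<le> c0 * sqrt W"
          using t W by (simp add: s'_def abs_mult field_simps)
        moreover have "(G / s' * v j)\<^sup>2 / (16 * W) = G\<^sup>2 * (v j)\<^sup>2 / (16 * t\<^sup>2)"
          using W t by (simp add: s'_def power_mult_distrib power_divide)
        ultimately show ?thesis using True decay[OF j] by metis
      next
        case False then show ?thesis using Pj.cmod_char_le_1 by simp
      qed
    next
      fix j assume "j \<in> J - V"
      then interpret Pj: real_distribution "P j" using P by auto
      show "cmod (char (P j) (G / s' * v j)) \<le> 1" by (rule Pj.cmod_char_le_1)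
    qed auto
    also have "\<dots> = (if \<bar>G\<bar> \<le> c then exp (- (G\<^sup>2 * ((\<Sum>j\<in>V. (v j)\<^sup>2) / (16 * t\<^sup>2)))) else 1)"
      using finite_subset[OF VJ fin]
      by (simp add: exp_sum[symmetric] sum_negf sum_distrib_left sum_divide_distrib)
    also have "\<dots> \<le> (if \<bar>G\<bar> \<le> c then exp (- (G\<^sup>2 * s)) else 1)"
    proof -
      have "s \<le> (\<Sum>j\<in>V. (v j)\<^sup>2) / (16 * t\<^sup>2)" using s t by (simp add: field_simps)
      from mult_left_mono[OF this, of "G\<^sup>2"] show ?thesis by simp
    qed
    finally show "cmod (char ?D (G / s')) \<le> (if \<bar>G\<bar> \<le> c then exp (- (G\<^sup>2 * s)) else 1)" .
  qed
  finally show ?thesis .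
qed

text \<open>For the sparse case, where the cutoff is a fixed constant: no rate, but the integrand is
  strictly below 1 on \<open>{0<..<c}\<close>, which has positive Gaussian measure.\<close>

lemma cut_gauss_less_1:
  assumes c: "c > 0" and s: "s > 0"
  shows "cut_gauss c s < 1" "0 \<le> cut_gauss c s"
proof -
  interpret N: real_distribution std_normal_distribution by (rule real_dist_normal_dist)
  let ?f = "\<lambda>G. if \<bar>G\<bar> \<le> c then exp (- (G\<^sup>2 * s)) else (1::real)"
  let ?A = "{0<..<c}"
  have int: "integrable std_normal_distribution ?f"
    by (rule N.integrable_const_bound[where B = 1]) (use s in auto)
  have "cut_gauss c s < (\<integral>G. 1 \<partial>std_normal_distribution)"
    unfolding cut_gauss_def
  proof (rule N.integral_less_AE[where A = ?A])
    show "emeasure std_normal_distribution ?A \<noteq> 0"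
    proof
      assume "emeasure std_normal_distribution ?A = 0"
      then have "?A \<in> null_sets std_normal_distribution" by auto
      then have "AE x in lborel. x \<in> ?A \<longrightarrow> std_normal_density x = 0"
        by (subst (asm) null_sets_density_iff) auto
      then have "AE x in lborel. x \<notin> ?A"
        by (rule eventually_mono) (use normal_density_pos[of 1 0] in \<open>auto simp: less_le\<close>)
      then have "?A \<in> null_sets lborel" by (subst AE_iff_null_sets) auto
      then show False using c by (auto simp: null_sets_def)
    qed
    show "AE x in std_normal_distribution. x \<in> ?A \<longrightarrow> ?f x \<noteq> 1"
      using s by (intro AE_I2) auto
    show "AE x in std_normal_distribution. ?f x \<le> 1" using s by (intro AE_I2) auto
  qed (use int in auto)
  then show "cut_gauss c s < 1" using N.prob_space by simp
  show "0 \<le> cut_gauss c s" unfolding cut_gauss_def by (rule Bochner_Integration.integral_nonneg) auto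
qed

text \<open>For the spread case, where \<open>c\<close> and \<open>s\<close> are large. The first
  term is the Gaussian integral without cutoff, the second Chebyshev's inequality for the event
  beyond the cutoff.\<close>

lemma cut_gauss_bound:
  assumes c: "c > 0" and s: "s > 0"
  shows "cut_gauss c s \<le> 1 / sqrt (2 * s) + 1 / c\<^sup>2"
proof -
  interpret N: real_distribution std_normal_distribution by (rule real_dist_normal_dist)
  define \<sigma> where "\<sigma> = 1 / sqrt (1 + 2 * s)"
  have \<sigma>: "\<sigma> > 0" "\<sigma>\<^sup>2 = 1 / (1 + 2 * s)" using s by (auto simp: \<sigma>_def power_divide)
  have eq: "std_normal_density x * exp (- (x\<^sup>2 * s)) = \<sigma> * normal_density 0 \<sigma> x" for x
  proof -
    have "x\<^sup>2 / 2 + x\<^sup>2 * s = x\<^sup>2 / (2 * \<sigma>\<^sup>2)"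
      unfolding \<sigma>(2) using s by (simp add: field_simps)
    then have "exp (- x\<^sup>2 / 2) * exp (- (x\<^sup>2 * s)) = exp (- x\<^sup>2 / (2 * \<sigma>\<^sup>2))"
      by (simp add: exp_add[symmetric])
    moreover have "sqrt (2 * pi * \<sigma>\<^sup>2) = \<sigma> * sqrt (2 * pi)" using \<sigma>(1) by (simp add: real_sqrt_mult)
    ultimately show ?thesis using \<sigma>(1) by (simp add: normal_density_def)
  qed
  have int1: "integrable std_normal_distribution (\<lambda>G. exp (- (G\<^sup>2 * s)))"
    by (rule N.integrable_const_bound[where B = 1]) (use s in auto)
  have "(\<integral>G. exp (- (G\<^sup>2 * s)) \<partial>std_normal_distribution) = (\<integral>x. \<sigma> * normal_density 0 \<sigma> x \<partial>lborel)"
    by (subst integral_density) (auto simp: eq)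
  also have "\<dots> = \<sigma>" using \<sigma>(1) by simp
  finally have 1: "(\<integral>G. exp (- (G\<^sup>2 * s)) \<partial>std_normal_distribution) = \<sigma>" .
  have 2: "integrable std_normal_distribution (\<lambda>G. G\<^sup>2)" "(\<integral>G. G\<^sup>2 \<partial>std_normal_distribution) = 1"
    using std_normal_distribution_even_moments[of 1] by simp_all
  have "cut_gauss c s \<le> (\<integral>G. exp (- (G\<^sup>2 * s)) + G\<^sup>2 / c\<^sup>2 \<partial>std_normal_distribution)"
    unfolding cut_gauss_def
  proof (rule integral_mono)
    show "integrable std_normal_distribution (\<lambda>G. if \<bar>G\<bar> \<le> c then exp (- (G\<^sup>2 * s)) else 1)"
      by (rule N.integrable_const_bound[where B = 1]) (use s in auto)
    fix G :: real
    have "1 \<le> G\<^sup>2 / c\<^sup>2" if "\<not> \<bar>G\<bar> \<le> c"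
      using that c abs_le_square_iff[of c G] by simp
    then show "(if \<bar>G\<bar> \<le> c then exp (- (G\<^sup>2 * s)) else 1) \<le> exp (- (G\<^sup>2 * s)) + G\<^sup>2 / c\<^sup>2"
      by (auto intro: add_increasing)
  qed (use int1 2 in auto)
  also have "\<dots> = \<sigma> + 1 / c\<^sup>2" using int1 2 1 by simp
  also have "\<sigma> \<le> 1 / sqrt (2 * s)" unfolding \<sigma>_def using s by (intro divide_left_mono) auto
  finally show ?thesis by simp
qed

subsection \<open>The law of the entries\<close>

text \<open>Satisfied by the entries outside the band too, which vanish; the variance, prescribed
  only inside the band, is a separate assumption of \<open>band_law\<close>.\<close>

definition entry_law :: "real \<Rightarrow> real \<Rightarrow> real \<Rightarrow> real measure \<Rightarrow> bool" where
  "entry_law \<delta> C W P \<longleftrightarrow> real_distribution P \<and> integrable P (\<lambda>x. x) \<and> (\<integral>x. x \<partial>P) = 0 \<and>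
     (\<integral>\<^sup>+x. ennreal (exp (\<delta> * W * x\<^sup>2)) \<partial>P) \<le> ennreal C"

lemma entry_lawD:
  assumes "entry_law \<delta> C W P" "C > 0"
  shows "real_distribution P" "integrable P (\<lambda>x. x)" "(\<integral>x. x \<partial>P) = 0"
    "integrable P (\<lambda>x. exp (\<delta> * W * x\<^sup>2))" "(\<integral>x. exp (\<delta> * W * x\<^sup>2) \<partial>P) \<le> C"
proof -
  show *: "real_distribution P" "integrable P (\<lambda>x. x)" "(\<integral>x. x \<partial>P) = 0"
    using assms by (auto simp: entry_law_def)
  interpret real_distribution P by fact
  have le: "(\<integral>\<^sup>+x. ennreal (exp (\<delta> * W * x\<^sup>2)) \<partial>P) \<le> ennreal C"
    using assms by (auto simp: entry_law_def)
  show int: "integrable P (\<lambda>x. exp (\<delta> * W * x\<^sup>2))"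
    by (rule integrableI_nonneg) (use le in \<open>auto simp: less_top[symmetric] top_unique\<close>)
  have "ennreal (\<integral>x. exp (\<delta> * W * x\<^sup>2) \<partial>P) \<le> ennreal C"
    using le by (subst nn_integral_eq_integral[symmetric]) (use int in auto)
  then show "(\<integral>x. exp (\<delta> * W * x\<^sup>2) \<partial>P) \<le> C" using assms(2) by simp
qed

text \<open>The exponential moment bounds the third moment by
  \<open>3 * C / sqrt (\<delta> * W) ^ 3\<close>. The cutoff is chosen so that
  \<open>\<bar>\<xi>\<bar>\<close> times this is at most \<open>3 / (8 * W)\<close>, hence at most
  3/2 of the variance. The 16 is the 4 of \<open>norm_char_le_exp\<close> times the 4 in the
  variance.\<close>

lemma entry_law_char_decay:
  assumes P: "entry_law \<delta> C W P" and C: "C > 0" and \<delta>: "\<delta> > 0" and W: "W \<ge> 1"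
    and sq: "integrable P (\<lambda>x. x\<^sup>2)" "(\<integral>x. x\<^sup>2 \<partial>P) = 1 / (4 * W - 1)"
    and \<xi>: "\<bar>\<xi>\<bar> \<le> min 1 (\<delta> * sqrt \<delta> / (8 * C)) * sqrt W"
  shows "cmod (char P \<xi>) \<le> exp (- (\<xi>\<^sup>2 / (16 * W)))"
proof -
  note P' = entry_lawD[OF P C]
  interpret real_distribution P by (rule P')
  define r where "r = sqrt (\<delta> * W)"
  have r: "r > 0" "r\<^sup>2 = \<delta> * W" using \<delta> W by (auto simp: r_def)
  have cube: "\<bar>x\<bar> ^ 3 \<le> 3 / r ^ 3 * exp (\<delta> * W * x\<^sup>2)" for x
    using cube_le_exp_square[of "r * x"] r by (simp add: power_mult_distrib abs_mult field_simps)
  have int3: "integrable P (\<lambda>x. \<bar>x\<bar> ^ 3)"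
    by (rule Bochner_Integration.integrable_bound[where f = "\<lambda>x. 3 / r ^ 3 * exp (\<delta> * W * x\<^sup>2)"])
       (use P'(4) cube r in auto)
  have "expectation (\<lambda>x. \<bar>x\<bar> ^ 3) \<le> expectation (\<lambda>x. 3 / r ^ 3 * exp (\<delta> * W * x\<^sup>2))"
    by (rule integral_mono) (use int3 P'(4) cube in auto)
  also have "\<dots> \<le> 3 / r ^ 3 * C" using P'(5) r by (simp add: divide_right_mono)
  finally have e3: "expectation (\<lambda>x. \<bar>x\<bar> ^ 3) \<le> 3 / r ^ 3 * C" .
  have sW: "sqrt W * sqrt W = W" "sqrt W > 0" using W by auto
  have \<xi>1: "\<bar>\<xi>\<bar> \<le> 1 * sqrt W"
    by (rule order_trans[OF \<xi>], rule mult_right_mono) (use sW in auto)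
  have \<xi>2: "\<bar>\<xi>\<bar> \<le> \<delta> * sqrt \<delta> / (8 * C) * sqrt W"
    by (rule order_trans[OF \<xi>], rule mult_right_mono) (use sW in auto)
  have "\<bar>\<xi>\<bar>\<^sup>2 \<le> (sqrt W)\<^sup>2" using \<xi>1 by (intro power_mono) auto
  then have x2: "\<xi>\<^sup>2 \<le> W" using W by simp
  have "r ^ 3 = r\<^sup>2 * r" by (simp add: power3_eq_cube power2_eq_square)
  then have r3: "r ^ 3 = \<delta> * sqrt \<delta> * (W * sqrt W)"
    unfolding r(2) by (simp add: r_def real_sqrt_mult)
  have "cmod (char P \<xi>) \<le> exp (- (\<xi>\<^sup>2 * (1 / (4 * W - 1)) / 4))"
  proof (rule norm_char_le_exp[OF sq(1) P'(3) sq(2) int3 e3])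
    show "\<xi>\<^sup>2 * (1 / (4 * W - 1)) \<le> 2" using x2 W by (simp add: field_simps)
    have "\<bar>\<xi>\<bar> * (3 / r ^ 3 * C) \<le> (\<delta> * sqrt \<delta> / (8 * C) * sqrt W) * (3 / r ^ 3 * C)"
      using r C \<xi>2 by (intro mult_right_mono) auto
    also have "\<dots> = 3 / (8 * W)" unfolding r3 using C \<delta> sW by (simp add: field_simps)
    also have "\<dots> \<le> 3 / 2 * (1 / (4 * W - 1))" using W by (simp add: field_simps)
    finally show "\<bar>\<xi>\<bar> * (3 / r ^ 3 * C) \<le> 3 / 2 * (1 / (4 * W - 1))" .
  qed
  also have "\<dots> \<le> exp (- (\<xi>\<^sup>2 / (16 * W)))"
  proof -
    have "1 / (16 * W) \<le> 1 / (4 * W - 1) / 4" using W by (simp add: field_simps)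
    from mult_left_mono[OF this, of "\<xi>\<^sup>2"] show ?thesis by simp
  qed
  finally show ?thesis .
qed

text \<open>For a centred variable the linear term integrates to zero, which leaves a bound by a
  square-exponential moment without a multiplicative constant.\<close>

lemma exp_le_add_exp_square: "exp y \<le> y + exp (y\<^sup>2 :: real)"
proof -
  have sq: "1 + y\<^sup>2 \<le> exp (y\<^sup>2)" by (rule exp_ge_add_one_self)
  consider "y \<ge> 1" | "0 \<le> y" "y \<le> 1" | "y \<le> -1" | "-1 \<le> y" "y \<le> 0" by linarith
  then show ?thesis
  proof cases
    case 1
    then have "y \<le> y\<^sup>2" by (simp add: power2_eq_square)
    then have "exp y \<le> exp (y\<^sup>2)" by simp
    then show ?thesis using 1 by linarith
  next
    case 2
    then show ?thesis using exp_bound[of y] sq by linarith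
  next
    case 3
    then have "-y \<le> y\<^sup>2" using mult_mono[of 1 "-y" "-y" "-y"] by (simp add: power2_eq_square)
    moreover have "exp y \<le> 1" using 3 by simp
    ultimately show ?thesis using sq by linarith
  next
    case 4
    have "1 + (- y) + (- y)\<^sup>2 / 2 \<le> exp (- y)" using 4 by (intro exp_lower_Taylor_quadratic) auto
    then have "exp y * (1 - y + y\<^sup>2 / 2) \<le> exp y * exp (- y)" by (intro mult_left_mono) auto
    also have "\<dots> = 1" by (simp add: exp_add[symmetric])
    finally have a: "exp y * (1 - y + y\<^sup>2 / 2) \<le> 1" .
    have "(1 + y + y\<^sup>2) * (1 - y + y\<^sup>2 / 2) = 1 + y\<^sup>2 / 2 * (1 - y + y\<^sup>2)"
      by (simp add: power2_eq_square field_simps)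
    moreover have "0 \<le> y\<^sup>2 / 2 * (1 - y + y\<^sup>2)" using 4 by (intro mult_nonneg_nonneg) auto
    ultimately have "exp y * (1 - y + y\<^sup>2 / 2) \<le> (1 + y + y\<^sup>2) * (1 - y + y\<^sup>2 / 2)" using a by linarith
    moreover have "0 < 1 - y + y\<^sup>2 / 2" using 4 by (simp add: add_pos_nonneg)
    ultimately have "exp y \<le> 1 + y + y\<^sup>2" by (simp only: mult_le_cancel_right_pos)
    then show ?thesis using sq by linarith
  qed
qed

text \<open>Put \<open>\<theta> = l\<^sup>2 / (\<delta> * W)\<close>, so that
  \<open>(l * x)\<^sup>2 = \<theta> * (\<delta> * W * x\<^sup>2)\<close>. For
  \<open>\<theta> \<le> 1\<close>, convexity of the exponential interpolates between 0 and
  \<open>\<delta> * W * x\<^sup>2\<close>; for larger \<open>\<theta>\<close>, \<open>l * x\<close>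
  is split into \<open>\<theta>\<close> and \<open>\<delta> * W * x\<^sup>2\<close>, and the
  constant \<open>C\<close> is absorbed into \<open>exp (C * \<theta>)\<close>.\<close>

lemma entry_law_mgf:
  assumes P: "entry_law \<delta> C W P" and C: "C > 0" and \<delta>: "\<delta> > 0" and W: "W > 0"
  shows "(\<integral>\<^sup>+x. ennreal (exp (l * x)) \<partial>P) \<le> ennreal (exp ((1 + C) * l\<^sup>2 / (\<delta> * W)))"
proof -
  note P' = entry_lawD[OF P C]
  interpret real_distribution P by (rule P')
  define \<theta> where "\<theta> = l\<^sup>2 / (\<delta> * W)"
  have \<theta>: "\<theta> \<ge> 0" using \<delta> W by (simp add: \<theta>_def)
  have key: "(\<integral>\<^sup>+x. ennreal (exp (l * x)) \<partial>P) \<le> ennreal (expectation f)"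
    if "integrable P f" "\<And>x. exp (l * x) \<le> f x" for f
  proof -
    have "(\<integral>\<^sup>+x. ennreal (exp (l * x)) \<partial>P) \<le> (\<integral>\<^sup>+x. ennreal (f x) \<partial>P)"
      by (intro nn_integral_mono ennreal_leI that)
    also have "\<dots> = ennreal (expectation f)"
      by (rule nn_integral_eq_integral[OF that(1)]) (intro AE_I2 order_trans[OF _ that(2)], simp)
    finally show ?thesis .
  qed
  have "(\<integral>\<^sup>+x. ennreal (exp (l * x)) \<partial>P) \<le> ennreal (exp ((1 + C) * \<theta>))"
  proof (cases "\<theta> \<le> 1")
    case True
    let ?f = "\<lambda>x. l * x + (1 - \<theta> + \<theta> * exp (\<delta> * W * x\<^sup>2))"
    have 1: "exp (l * x) \<le> ?f x" for x
    proof -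
      have "exp ((1 - \<theta>) * 0 + \<theta> * (\<delta> * W * x\<^sup>2)) \<le> (1 - \<theta>) * exp 0 + \<theta> * exp (\<delta> * W * x\<^sup>2)"
        using convex_onD[OF exp_convex, of \<theta> 0 "\<delta> * W * x\<^sup>2"] \<theta> True by simp
      moreover have "\<theta> * (\<delta> * W * x\<^sup>2) = (l * x)\<^sup>2" using \<delta> W by (simp add: \<theta>_def power_mult_distrib)
      ultimately show ?thesis using exp_le_add_exp_square[of "l * x"] by simp
    qed
    have int: "integrable P ?f" using P' by auto
    have "expectation ?f = 1 - \<theta> + \<theta> * expectation (\<lambda>x. exp (\<delta> * W * x\<^sup>2))"
      using P' prob_space by (simp add: Bochner_Integration.integral_add)
    also have "\<dots> \<le> 1 + (1 + C) * \<theta>" using mult_left_mono[OF P'(5) \<theta>] \<theta> by (simp add: algebra_simps)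
    also have "\<dots> \<le> exp ((1 + C) * \<theta>)" by (rule exp_ge_add_one_self)
    finally show ?thesis using key[OF int 1] by (meson ennreal_leI order_trans)
  next
    case False
    have 1: "exp (l * x) \<le> exp \<theta> * exp (\<delta> * W * x\<^sup>2)" for x
    proof -
      have "l * x \<le> \<theta> + \<delta> * W * x\<^sup>2"
      proof -
        define r where "r = sqrt (\<delta> * W)"
        have r: "r > 0" "r\<^sup>2 = \<delta> * W" using \<delta> W by (auto simp: r_def)
        have "l * x = (l / r) * (r * x)" using r by simp
        also have "2 * ((l / r) * (r * x)) \<le> (l / r)\<^sup>2 + (r * x)\<^sup>2" 
          using sum_squares_bound[of "l / r" "r * x"] by (simp only: mult.assoc)
        then have "(l / r) * (r * x) \<le> (l / r)\<^sup>2 + (r * x)\<^sup>2"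
          by (smt (verit) zero_le_power2)
        finally show ?thesis using r by (simp add: \<theta>_def power_divide power_mult_distrib)
      qed
      then show ?thesis by (simp add: exp_add[symmetric])
    qed
    have "C \<le> exp (C * \<theta>)"
    proof -
      have "C \<le> C * \<theta>" using False C by simp
      also have "\<dots> \<le> exp (C * \<theta>)" using exp_ge_add_one_self[of "C * \<theta>"] by linarith
      finally show ?thesis .
    qed
    then have "expectation (\<lambda>x. exp \<theta> * exp (\<delta> * W * x\<^sup>2)) \<le> exp \<theta> * exp (C * \<theta>)"
      using P'(5) by simp
    also have "\<dots> = exp ((1 + C) * \<theta>)" by (simp add: exp_add[symmetric] algebra_simps)
    finally show ?thesis using key[OF integrable_mult_right[OF P'(4)] 1] by (meson ennreal_leI order_trans)
  qed
  then show ?thesis by (simp add: \<theta>_def)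
qed

subsection \<open>Independent rows of a symmetric matrix\<close>

text \<open>
  A symmetric matrix is given by its entries \<open>h (i, j)\<close> with \<open>i \<le> j\<close>; row \<open>i\<close> owns the entries
  \<open>(i, j)\<close> with \<open>j \<ge> i\<close>.
\<close>

definition upper_rows :: "nat \<Rightarrow> nat \<Rightarrow> (nat \<times> nat) set" where
  "upper_rows N m = {(i, j). i < m \<and> i \<le> j \<and> j < N}"

definition sym_row :: "nat \<Rightarrow> (nat \<times> nat \<Rightarrow> real) \<Rightarrow> (nat \<Rightarrow> real) \<Rightarrow> nat \<Rightarrow> real" where
  "sym_row N h v i = (\<Sum>j<N. h (min i j, max i j) * v j)"

lemma finite_upper_rows [simp]: "finite (upper_rows N m)"
  by (rule finite_subset[of _ "{..<m} \<times> {..<N}"]) (auto simp: upper_rows_def)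

lemma upper_rows_Suc: "upper_rows N (Suc m) = upper_rows N m \<union> Pair m ` {m..<N}"
  "upper_rows N m \<inter> Pair m ` {m..<N} = {}"
  by (auto simp: upper_rows_def less_Suc_eq)

text \<open>
  Integrate over the entries of the last row first: the factors of the earlier rows do not
  depend on them.
\<close>

lemma nn_integral_upper_rows_prod_le:
  fixes F :: "nat \<Rightarrow> (nat \<times> nat \<Rightarrow> real) \<Rightarrow> ennreal" and q :: "nat \<Rightarrow> ennreal"
  assumes P: "\<And>x. prob_space (P x)"
    and meas: "\<And>i m. i < m \<Longrightarrow> m \<le> N \<Longrightarrow> F i \<in> borel_measurable (PiM (upper_rows N m) P)"
    and loc: "\<And>i h h'. (\<And>x. x \<in> upper_rows N (Suc i) \<Longrightarrow> h x = h' x) \<Longrightarrow> F i h = F i h'"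
    and bound: "\<And>i x. i < N \<Longrightarrow>
      (\<integral>\<^sup>+y. F i (merge (upper_rows N i) (Pair i ` {i..<N}) (x, y)) \<partial>PiM (Pair i ` {i..<N}) P) \<le> q i"
    and "m \<le> N"
  shows "(\<integral>\<^sup>+h. (\<Prod>i<m. F i h) \<partial>PiM (upper_rows N m) P) \<le> (\<Prod>i<m. q i)"
  using \<open>m \<le> N\<close>
proof (induction m)
  case 0
  interpret prob_space "PiM (upper_rows N 0) P" by (rule prob_space_PiM) (rule P)
  show ?case using emeasure_space_1 by simp
next
  case (Suc m)
  interpret product_sigma_finite P
    by (rule product_sigma_finite.intro) (simp add: P prob_space_imp_sigma_finite)
  let ?I = "upper_rows N m" and ?J = "Pair m ` {m..<N}"
  have disj: "?I \<inter> ?J = {}" and un: "upper_rows N (Suc m) = ?I \<union> ?J" by (rule upper_rows_Suc)+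
  have [measurable]: "F m \<in> borel_measurable (PiM (?I \<union> ?J) P)"
    using meas[of m "Suc m"] Suc.prems un by simp
  have "(\<integral>\<^sup>+h. (\<Prod>i<Suc m. F i h) \<partial>PiM (upper_rows N (Suc m)) P)
    = (\<integral>\<^sup>+x. (\<integral>\<^sup>+y. (\<Prod>i<Suc m. F i (merge ?I ?J (x, y))) \<partial>PiM ?J P) \<partial>PiM ?I P)"
    unfolding un
  proof (rule product_nn_integral_fold[OF disj])
    show "(\<lambda>h. \<Prod>i<Suc m. F i h) \<in> borel_measurable (PiM (?I \<union> ?J) P)"
      using meas[of _ "Suc m"] Suc.prems un by (intro borel_measurable_prod_ennreal) auto
  qed auto
  also have "\<dots> = (\<integral>\<^sup>+x. (\<integral>\<^sup>+y. (\<Prod>i<m. F i x) * F m (merge ?I ?J (x, y)) \<partial>PiM ?J P) \<partial>PiM ?I P)"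
  proof (intro nn_integral_cong)
    fix x y
    have "F i (merge ?I ?J (x, y)) = F i x" if "i < m" for i
      by (rule loc) (use that in \<open>auto simp: merge_def upper_rows_def\<close>)
    then show "(\<Prod>i<Suc m. F i (merge ?I ?J (x, y))) = (\<Prod>i<m. F i x) * F m (merge ?I ?J (x, y))"
      by simp
  qed
  also have "\<dots> = (\<integral>\<^sup>+x. (\<Prod>i<m. F i x) * (\<integral>\<^sup>+y. F m (merge ?I ?J (x, y)) \<partial>PiM ?J P) \<partial>PiM ?I P)"
  proof (intro nn_integral_cong nn_integral_cmult)
    fix x assume "x \<in> space (PiM ?I P)"
    then show "(\<lambda>y. F m (merge ?I ?J (x, y))) \<in> borel_measurable (PiM ?J P)" by measurable
  qed
  also have "\<dots> \<le> (\<integral>\<^sup>+x. (\<Prod>i<m. F i x) * q m \<partial>PiM ?I P)"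
    by (intro nn_integral_mono mult_left_mono bound) (use Suc.prems in auto)
  also have "\<dots> = (\<integral>\<^sup>+x. (\<Prod>i<m. F i x) \<partial>PiM ?I P) * q m"
    by (intro nn_integral_multc borel_measurable_prod_ennreal meas) (use Suc.prems in auto)
  also have "\<dots> \<le> (\<Prod>i<m. q i) * q m" using Suc by (intro mult_right_mono) auto
  finally show ?case by simp
qed

text \<open>The law of the entries without the matrix. The variance is prescribed on the part of the
  band to the right of the diagonal that does not wrap around; these are the entries from which a
  row draws its randomness.\<close>

locale band_law =
  fixes \<delta> C :: real and p W :: nat and P :: "nat \<times> nat \<Rightarrow> real measure" and N :: nat
  defines "N \<equiv> 2 * p * W"
  assumes \<delta>: "\<delta> > 0" and C: "C > 0" and W: "W \<ge> 1" and p: "p \<ge> 1"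
    and law: "\<And>x. entry_law \<delta> C W (P x)"
    and var: "\<And>i j. i \<le> j \<Longrightarrow> j < N \<Longrightarrow> j < i + 2 * W \<Longrightarrow>
      integrable (P (i, j)) (\<lambda>x. x\<^sup>2) \<and> (\<integral>x. x\<^sup>2 \<partial>P (i, j)) = 1 / (4 * real W - 1)"
begin

text \<open>The range, in units of \<open>sqrt W\<close>, in which
  \<open>entry_law_char_decay\<close> applies.\<close>

definition "c0 = min 1 (\<delta> * sqrt \<delta> / (8 * C))"

definition "\<Omega> = PiM (upper_rows N N) P"

lemma real_distribution_P: "real_distribution (P x)" using law by (auto simp: entry_law_def)

lemma prob_space_P: "prob_space (P x)" using real_distribution_P real_distribution.axioms(1) by blast

lemma sets_P [measurable_cong]: "sets (P x) = sets borel"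
  using real_distribution_P real_distribution.events_eq_borel by blast

lemma measurable_component: "x \<in> K \<Longrightarrow> (\<lambda>h. h x) \<in> borel_measurable (PiM K P)"
  using measurable_component_singleton[of x K P] by (simp cong: measurable_cong_sets add: sets_P)

lemma measurable_sym_row:
  assumes "i < m" "m \<le> N" 
  shows "(\<lambda>h. \<Sum>j<N. h (min i j, max i j) * v j) \<in> borel_measurable (PiM (upper_rows N m) P)"
  using assms by (intro borel_measurable_sum borel_measurable_times measurable_component borel_measurable_const)
    (auto simp: upper_rows_def min_def max_def)

lemma sym_row_measurable [measurable]: "i < N \<Longrightarrow> (\<lambda>h. sym_row N h v i) \<in> borel_measurable \<Omega>"
  unfolding sym_row_def \<Omega>_def by (rule measurable_sym_row) auto

text \<open>Once the earlier rows are fixed, the entries of row \<open>i\<close> left of the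
  diagonal only shift its linear form, and the shift does not matter. This is why \<open>V\<close>
  must lie in \<open>{i..<N}\<close>.\<close>

lemma rows_exp_bound:
  assumes R: "R \<subseteq> {..<N}" and t: "t > 0" and s0: "s \<ge> 0"
    and c: "c * b \<le> c0 * t"
    and rows: "\<And>i. i \<in> R \<Longrightarrow> \<exists>V\<subseteq>{i..<N}. (\<forall>j\<in>V. j < i + 2 * W \<and> \<bar>v j\<bar> \<le> b) \<and> 16 * t\<^sup>2 * s \<le> (\<Sum>j\<in>V. (v j)\<^sup>2)"
  shows "(\<integral>\<^sup>+h. (\<Prod>i\<in>R. ennreal (exp (- (W * (sym_row N h v i + a i)\<^sup>2 / (2 * t\<^sup>2))))) \<partial>\<Omega>)
    \<le> ennreal (cut_gauss c s) ^ card R"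
proof -
  define F where "F i h = (if i \<in> R then ennreal (exp (- (W * (sym_row N h v i + a i)\<^sup>2 / (2 * t\<^sup>2)))) else 1)"
    for i h
  define q where "q i = (if i \<in> R then ennreal (cut_gauss c s) else 1)" for i
  have "(\<integral>\<^sup>+h. (\<Prod>i<N. F i h) \<partial>\<Omega>) \<le> (\<Prod>i<N. q i)"
    unfolding \<Omega>_def
  proof (rule nn_integral_upper_rows_prod_le[OF prob_space_P])
    fix i m assume "i < m" "m \<le> N"
    from measurable_sym_row[OF this] have [measurable]: "(\<lambda>h. sym_row N h v i) \<in> borel_measurable (PiM (upper_rows N m) P)"
      by (simp add: sym_row_def)
    show "F i \<in> borel_measurable (PiM (upper_rows N m) P)"
      unfolding F_def by measurable
  next
    fix i and h h' :: "nat \<times> nat \<Rightarrow> real" assume eq: "\<And>x. x \<in> upper_rows N (Suc i) \<Longrightarrow> h x = h' x"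
    have "sym_row N h v i = sym_row N h' v i" if "i < N"
      unfolding sym_row_def using that by (intro sum.cong refl arg_cong2[where f = times] eq) (auto simp: upper_rows_def)
    then show "F i h = F i h'" using R by (auto simp: F_def)
  next
    fix i and x :: "nat \<times> nat \<Rightarrow> real" assume i: "i < N"
    let ?J = "Pair i ` {i..<N}" let ?m = "\<lambda>y. merge (upper_rows N i) ?J (x, y)"
    interpret J: prob_space "PiM ?J P" by (rule prob_space_PiM) (rule prob_space_P)
    show "(\<integral>\<^sup>+y. F i (?m y) \<partial>PiM ?J P) \<le> q i"
    proof (cases "i \<in> R")
      case False
      then show ?thesis using J.emeasure_space_1 by (simp add: F_def q_def)
    next
      case True
      from rows[OF this] obtain V where V: "V \<subseteq> {i..<N}" "\<forall>j\<in>V. j < i + 2 * W \<and> \<bar>v j\<bar> \<le> b"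
        "16 * t\<^sup>2 * s \<le> (\<Sum>j\<in>V. (v j)\<^sup>2)" by (elim exE conjE)
      define a' where "a' = (\<Sum>j=0..<i. x (j, i) * v j) + a i"
      have "sym_row N (?m y) v i + a i = (\<Sum>z\<in>?J. y z * v (snd z)) + a'" for y
      proof -
        have "sym_row N (?m y) v i = (\<Sum>j=0..<i. ?m y (min i j, max i j) * v j) + (\<Sum>j=i..<N. ?m y (min i j, max i j) * v j)"
          unfolding sym_row_def lessThan_atLeast0
          by (rule sum.atLeastLessThan_concat[symmetric]) (use i in auto)
        also have "(\<Sum>j=0..<i. ?m y (min i j, max i j) * v j) = (\<Sum>j=0..<i. x (j, i) * v j)"
          using i by (intro sum.cong) (auto simp: merge_def upper_rows_def)
        also have "(\<Sum>j=i..<N. ?m y (min i j, max i j) * v j) = (\<Sum>j=i..<N. y (i, j) * v j)"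
          using i by (intro sum.cong) (auto simp: merge_def upper_rows_def)
        also have "\<dots> = (\<Sum>z\<in>?J. y z * v (snd z))"
          by (subst sum.reindex) (auto intro: inj_onI)
        finally show ?thesis by (simp add: a'_def)
      qed
      then have "(\<integral>\<^sup>+y. F i (?m y) \<partial>PiM ?J P)
        = (\<integral>\<^sup>+y. ennreal (exp (- (W * ((\<Sum>z\<in>?J. y z * v (snd z)) + a')\<^sup>2 / (2 * t\<^sup>2)))) \<partial>PiM ?J P)"
        using True by (simp add: F_def)
      also have "\<dots> \<le> ennreal (cut_gauss c s)"
      proof (rule PiM_linear_form_small_ball[where V = "Pair i ` V" and b = b and ?c0.0 = c0])
        fix z \<xi> assume z: "z \<in> Pair i ` V" and \<xi>: "\<bar>\<xi>\<bar> \<le> c0 * sqrt (real W)"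
        then obtain j where j: "z = (i, j)" "j \<in> V" by auto
        with V have "i \<le> j" "j < N" "j < i + 2 * W" by auto
        from var[OF this] show "cmod (char (P z) \<xi>) \<le> exp (- (\<xi>\<^sup>2 / (16 * real W)))"
          using \<xi> W by (intro entry_law_char_decay[OF law C \<delta>]) (auto simp: j c0_def)
      next
        show "16 * t\<^sup>2 * s \<le> (\<Sum>z\<in>Pair i ` V. (v (snd z))\<^sup>2)"
          using V by (subst sum.reindex) (auto intro: inj_onI)
      qed (use real_distribution_P V W t c s0 in auto)
      finally show ?thesis using True by (simp add: q_def)
    qed
  qed simp
  moreover have "(\<Prod>i<N. F i h) = (\<Prod>i\<in>R. ennreal (exp (- (W * (sym_row N h v i + a i)\<^sup>2 / (2 * t\<^sup>2)))))" for h
    unfolding F_def using R by (subst prod.inter_restrict[symmetric]) (auto intro!: prod.cong)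
  moreover have "(\<Prod>i<N. q i) = ennreal (cut_gauss c s) ^ card R"
    unfolding q_def using R by (subst prod.inter_restrict[symmetric]) (auto simp: Int_absorb1)
  ultimately show ?thesis by simp
qed

text \<open>A small sum of squares makes the product of Gaussian weights at least
  \<open>exp (- W * r / (2 * t\<^sup>2))\<close>, so Markov's inequality applies; no row has to be
  small individually.\<close>

lemma rows_small_ball:
  fixes r q :: real
  assumes R: "R \<subseteq> {..<N}" and t: "t > 0" and s0: "s \<ge> 0"
    and c: "c * b \<le> c0 * t"
    and rows: "\<And>i. i \<in> R \<Longrightarrow> \<exists>V\<subseteq>{i..<N}. (\<forall>j\<in>V. j < i + 2 * W \<and> \<bar>v j\<bar> \<le> b) \<and> 16 * t\<^sup>2 * s \<le> (\<Sum>j\<in>V. (v j)\<^sup>2)"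
    and q: "cut_gauss c s \<le> q"
  shows "emeasure \<Omega> {h \<in> space \<Omega>. (\<Sum>i\<in>R. (sym_row N h v i + a i)\<^sup>2) \<le> r}
    \<le> ennreal (exp (W * r / (2 * t\<^sup>2)) * q ^ card R)"
proof -
  have finR: "finite R" using R finite_subset by blast
  have meas [measurable]: "\<And>i. i \<in> R \<Longrightarrow> (\<lambda>h. sym_row N h v i) \<in> borel_measurable \<Omega>"
    using R by auto
  have q0: "0 \<le> cut_gauss c s" unfolding cut_gauss_def by (rule Bochner_Integration.integral_nonneg) auto
  let ?E = "\<lambda>h. (\<Prod>i\<in>R. ennreal (exp (- (W * (sym_row N h v i + a i)\<^sup>2 / (2 * t\<^sup>2)))))"
  let ?K = "ennreal (exp (W * r / (2 * t\<^sup>2)))"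
  have E: "?E h = ennreal (exp (- (W * (\<Sum>i\<in>R. (sym_row N h v i + a i)\<^sup>2) / (2 * t\<^sup>2))))" for h
    using finR by (simp add: prod_ennreal exp_sum[symmetric] sum_negf sum_distrib_left sum_divide_distrib)
  have "emeasure \<Omega> {h \<in> space \<Omega>. (\<Sum>i\<in>R. (sym_row N h v i + a i)\<^sup>2) \<le> r}
    \<le> emeasure \<Omega> {h \<in> space \<Omega>. 1 \<le> ?K * ?E h}"
  proof (rule emeasure_mono)
    show "{h \<in> space \<Omega>. 1 \<le> ?K * ?E h} \<in> sets \<Omega>" by measurable
    show "{h \<in> space \<Omega>. (\<Sum>i\<in>R. (sym_row N h v i + a i)\<^sup>2) \<le> r} \<subseteq> {h \<in> space \<Omega>. 1 \<le> ?K * ?E h}"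
    proof safe
      fix h assume "(\<Sum>i\<in>R. (sym_row N h v i + a i)\<^sup>2) \<le> r"
      then have "W * (\<Sum>i\<in>R. (sym_row N h v i + a i)\<^sup>2) / (2 * t\<^sup>2) \<le> W * r / (2 * t\<^sup>2)"
        using W t by (intro divide_right_mono mult_left_mono) auto
      then show "1 \<le> ?K * ?E h" unfolding E
        by (simp add: ennreal_mult[symmetric] exp_add[symmetric])
    qed
  qed
  also have "\<dots> \<le> ?K * (\<integral>\<^sup>+h. ?E h * indicator (space \<Omega>) h \<partial>\<Omega>)"
    by (rule nn_integral_Markov_inequality) measurable
  also have "(\<integral>\<^sup>+h. ?E h * indicator (space \<Omega>) h \<partial>\<Omega>) = (\<integral>\<^sup>+h. ?E h \<partial>\<Omega>)"
    by (intro nn_integral_cong) auto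
  also have "?K * \<dots> \<le> ?K * ennreal (cut_gauss c s) ^ card R"
    by (intro mult_left_mono rows_exp_bound[OF R t s0 c rows]) auto
  also have "\<dots> \<le> ?K * ennreal q ^ card R"
    by (intro mult_left_mono power_mono ennreal_leI q) auto
  also have "\<dots> = ennreal (exp (W * r / (2 * t\<^sup>2)) * q ^ card R)"
    using q q0 by (simp add: ennreal_power ennreal_mult)
  finally show ?thesis .
qed

end

subsection \<open>Nets and the operator norm\<close>

text \<open>Rounding towards zero does not increase norms, and a coordinate stays nonzero exactly
  when it reaches one mesh unit. Rounding to the nearest integer would give neither.\<close>

definition trunc :: "real \<Rightarrow> int" where
  "trunc x = (if x \<ge> 0 then \<lfloor>x\<rfloor> else \<lceil>x\<rceil>)"

lemma trunc_bounds:
  "\<bar>x - trunc x\<bar> \<le> 1" "\<bar>real_of_int (trunc x)\<bar> \<le> \<bar>x\<bar>"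
  by (auto simp: trunc_def) linarith+

lemma nat_le_abs_trunc_iff: "int n \<le> \<bar>trunc x\<bar> \<longleftrightarrow> real n \<le> \<bar>x\<bar>"
proof (cases "x \<ge> 0")
  case True
  then have "\<bar>trunc x\<bar> = \<lfloor>x\<rfloor>" by (simp add: trunc_def)
  then show ?thesis using True by (simp add: le_floor_iff)
next
  case False
  then have "\<bar>trunc x\<bar> = \<lfloor>- x\<rfloor>" by (simp add: trunc_def floor_minus)
  then show ?thesis using False by (simp add: le_floor_iff)
qed

text \<open>An l1 ball, because the exponential of an l1 norm factorises over coordinates;
  extensional functions make it finite.\<close>

definition int_ball :: "nat \<Rightarrow> real \<Rightarrow> (nat \<Rightarrow> int) set" where
  "int_ball N A = {z \<in> {..<N} \<rightarrow>\<^sub>E UNIV. (\<Sum>j<N. \<bar>real_of_int (z j)\<bar>) \<le> A}"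

definition supp :: "nat \<Rightarrow> (nat \<Rightarrow> int) \<Rightarrow> nat set" where
  "supp N z = {j \<in> {..<N}. z j \<noteq> 0}"

lemma int_ball_subset_box:
  assumes "A \<le> real m"
  shows "int_ball N A \<subseteq> {..<N} \<rightarrow>\<^sub>E {- int m..int m}"
proof
  fix z assume z: "z \<in> int_ball N A"
  have "z j \<in> {- int m..int m}" if "j < N" for j
  proof -
    have "\<bar>real_of_int (z j)\<bar> \<le> (\<Sum>j<N. \<bar>real_of_int (z j)\<bar>)"
      using that by (intro member_le_sum) auto
    also have "\<dots> \<le> real m" using z assms by (auto simp: int_ball_def)
    finally show ?thesis by auto
  qed
  then show "z \<in> {..<N} \<rightarrow>\<^sub>E {- int m..int m}"
    using z by (auto simp: int_ball_def PiE_def Pi_def)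
qed

lemma finite_int_ball [simp]: "finite (int_ball N A)"
proof -
  obtain m :: nat where "A \<le> real m" using real_arch_simple by blast
  from int_ball_subset_box[OF this] show ?thesis by (rule finite_subset) (auto intro: finite_PiE)
qed

text \<open>A telescoping bound in place of the geometric series:
  \<open>\<kappa> \<le> exp \<kappa> - 1\<close> bounds each new pair of terms by
  \<open>2 * x / \<kappa>\<close> times the decrease of
  \<open>exp (- \<kappa> * real m)\<close>.\<close>

lemma sum_geometric_weights_le:
  assumes \<kappa>: "\<kappa> > 0" and x: "x \<ge> 0"
  shows "(\<Sum>k\<in>{- int m..int m}. (if k = 0 then 1 else x) * exp (- \<kappa> * \<bar>real_of_int k\<bar>)) \<le> 1 + 2 * x / \<kappa>"
proof -
  have "(\<Sum>k\<in>{- int m..int m}. (if k = 0 then 1 else x) * exp (- \<kappa> * \<bar>real_of_int k\<bar>))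
    \<le> 1 + 2 * x / \<kappa> * (1 - exp (- \<kappa> * real m))"
  proof (induction m)
    case (Suc m)
    have set: "{- int (Suc m)..int (Suc m)} = insert (int (Suc m)) (insert (- int (Suc m)) {- int m..int m})"
      by auto
    have "\<kappa> * exp (- \<kappa> * real (Suc m)) \<le> (exp \<kappa> - 1) * exp (- \<kappa> * real (Suc m))"
      using exp_ge_add_one_self[of \<kappa>] by (intro mult_right_mono) (linarith, simp)
    also have "\<dots> = exp (- \<kappa> * real m) - exp (- \<kappa> * real (Suc m))"
      by (simp add: left_diff_distrib exp_add[symmetric] algebra_simps)
    finally have "2 * x / \<kappa> * (\<kappa> * exp (- \<kappa> * real (Suc m)))
      \<le> 2 * x / \<kappa> * (exp (- \<kappa> * real m) - exp (- \<kappa> * real (Suc m)))"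
      using \<kappa> x by (intro mult_left_mono) auto
    then have "2 * x * exp (- \<kappa> * real (Suc m))
      \<le> 2 * x / \<kappa> * (exp (- \<kappa> * real m) - exp (- \<kappa> * real (Suc m)))" using \<kappa> by simp
    then show ?case using Suc.IH unfolding set by (simp add: algebra_simps)
  qed simp
  also have "\<dots> \<le> 1 + 2 * x / \<kappa> * 1" using \<kappa> x by (intro add_left_mono mult_left_mono) auto
  finally show ?thesis by simp
qed

text \<open>
  A bound for the size of a net in which every coordinate of the support carries a probability \<open>x\<close>.
  The exponential weight \<open>\<kappa>\<close> matches the mesh: with \<open>A\<close> of order \<open>W / s\<close> and \<open>\<kappa> = s\<close> the first
  factor is exponential in \<open>W\<close>, uniformly in \<open>s\<close>.
\<close>

lemma sum_int_ball_supp_le: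
  assumes \<kappa>: "\<kappa> > 0" and x: "x \<ge> 0"
  shows "(\<Sum>z\<in>int_ball N A. x ^ card (supp N z)) \<le> exp (\<kappa> * A) * (1 + 2 * x / \<kappa>) ^ N"
proof -
  obtain m :: nat where m: "A \<le> real m" using real_arch_simple by blast
  let ?w = "\<lambda>k::int. (if k = 0 then 1 else x) * exp (- \<kappa> * \<bar>real_of_int k\<bar>)"
  have w0: "?w k \<ge> 0" for k using x by simp
  have "(\<Sum>z\<in>int_ball N A. x ^ card (supp N z)) \<le> (\<Sum>z\<in>int_ball N A. exp (\<kappa> * A) * (\<Prod>j<N. ?w (z j)))"
  proof (rule sum_mono)
    fix z assume z: "z \<in> int_ball N A"
    have "x ^ card (supp N z) = (\<Prod>j<N. if z j = 0 then 1 else x)"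
      by (simp add: supp_def prod.If_cases Int_def)
    \<comment> \<open>Membership in the ball trades the constraint for a product of weights; the sum
      may then be extended to a box, where it factorises.\<close>
    moreover have "1 \<le> exp (\<kappa> * A) * (\<Prod>j<N. exp (- \<kappa> * \<bar>real_of_int (z j)\<bar>))"
    proof -
      have "(\<Prod>j<N. exp (- \<kappa> * \<bar>real_of_int (z j)\<bar>)) = exp (- \<kappa> * (\<Sum>j<N. \<bar>real_of_int (z j)\<bar>))"
        by (simp add: exp_sum[symmetric] sum_distrib_left sum_negf)
      moreover have "\<kappa> * (\<Sum>j<N. \<bar>real_of_int (z j)\<bar>) \<le> \<kappa> * A"
        using z \<kappa> by (intro mult_left_mono) (auto simp: int_ball_def)
      ultimately show ?thesis by (simp add: exp_add[symmetric])
    qed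
    moreover have "0 \<le> (\<Prod>j<N. if z j = 0 then 1 else x)" using x by (simp add: prod_nonneg)
    ultimately have "x ^ card (supp N z) \<le> (\<Prod>j<N. if z j = 0 then 1 else x) *
        (exp (\<kappa> * A) * (\<Prod>j<N. exp (- \<kappa> * \<bar>real_of_int (z j)\<bar>)))"
      by (metis mult_left_mono mult_1_right)
    also have "\<dots> = exp (\<kappa> * A) * (\<Prod>j<N. ?w (z j))" by (simp add: prod.distrib ac_simps)
    finally show "x ^ card (supp N z) \<le> exp (\<kappa> * A) * (\<Prod>j<N. ?w (z j))" .
  qed
  also have "\<dots> = exp (\<kappa> * A) * (\<Sum>z\<in>int_ball N A. \<Prod>j<N. ?w (z j))" by (simp add: sum_distrib_left)
  also have "\<dots> \<le> exp (\<kappa> * A) * (\<Sum>z\<in>{..<N} \<rightarrow>\<^sub>E {- int m..int m}. \<Prod>j<N. ?w (z j))"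
    by (intro mult_left_mono sum_mono2 int_ball_subset_box m prod_nonneg ballI w0) (auto intro: finite_PiE)
  also have "(\<Sum>z\<in>{..<N} \<rightarrow>\<^sub>E {- int m..int m}. \<Prod>j<N. ?w (z j)) = (\<Prod>j<N. \<Sum>k\<in>{- int m..int m}. ?w k)"
    by (subst prod_sum_PiE) auto
  also have "\<dots> = (\<Sum>k\<in>{- int m..int m}. ?w k) ^ N" by simp
  also have "exp (\<kappa> * A) * \<dots> \<le> exp (\<kappa> * A) * (1 + 2 * x / \<kappa>) ^ N"
    by (intro mult_left_mono power_mono sum_geometric_weights_le \<kappa> x sum_nonneg w0) auto
  finally show ?thesis .
qed

section \<open>Rounding of vectors to a grid of mesh \<open>s / sqrt W\<close>\<close>

definition grid :: "nat \<Rightarrow> real \<Rightarrow> (nat \<Rightarrow> int) \<Rightarrow> nat \<Rightarrow> real" where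
  "grid W s z j = s * real_of_int (z j) / sqrt (real W)"

definition grid_coord :: "nat \<Rightarrow> nat \<Rightarrow> real \<Rightarrow> (nat \<Rightarrow> real) \<Rightarrow> nat \<Rightarrow> int" where
  "grid_coord N W s u = (\<lambda>j\<in>{..<N}. trunc (sqrt (real W) * u j / s))"

lemma grid_coord_approx:
  assumes W: "W \<ge> 1" and s: "s > 0" and j: "j < N"
  shows "\<bar>u j - grid W s (grid_coord N W s u) j\<bar> \<le> s / sqrt (real W)"
    "\<bar>grid W s (grid_coord N W s u) j\<bar> \<le> \<bar>u j\<bar>"
proof -
  define x where "x = sqrt (real W) * u j / s"
  have W0: "sqrt (real W) > 0" using W by simp
  have u: "u j = x * (s / sqrt (real W))" using W0 s by (simp add: x_def)
  have g: "grid W s (grid_coord N W s u) j = trunc x * (s / sqrt (real W))"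
    using j by (simp add: grid_def grid_coord_def x_def mult.commute)
  have c: "0 \<le> s / sqrt (real W)" using s W0 by simp
  have "\<bar>u j - grid W s (grid_coord N W s u) j\<bar> = \<bar>x - trunc x\<bar> * (s / sqrt (real W))"
    unfolding g by (subst u) (simp only: left_diff_distrib[symmetric] abs_mult abs_of_nonneg[OF c])
  also have "\<dots> \<le> 1 * (s / sqrt (real W))" by (intro mult_right_mono trunc_bounds c)
  finally show "\<bar>u j - grid W s (grid_coord N W s u) j\<bar> \<le> s / sqrt (real W)" by simp
  have "\<bar>real_of_int (trunc x)\<bar> * (s / sqrt (real W)) \<le> \<bar>x\<bar> * (s / sqrt (real W))"
    by (intro mult_right_mono trunc_bounds c)
  then show "\<bar>grid W s (grid_coord N W s u) j\<bar> \<le> \<bar>u j\<bar>"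
    unfolding g by (subst u) (simp only: abs_mult abs_of_nonneg[OF c])
qed

lemma abs_le_L2_set: "\<lbrakk>finite K; j \<in> K\<rbrakk> \<Longrightarrow> \<bar>f j\<bar> \<le> L2_set f K"
  using member_le_L2_set[of K j "\<lambda>i. \<bar>f i\<bar>"] by (simp add: L2_set_def)

lemma L2_set_bound: "\<lbrakk>\<And>j. j \<in> K \<Longrightarrow> \<bar>f j\<bar> \<le> b; b \<ge> 0\<rbrakk> \<Longrightarrow> L2_set f K \<le> sqrt (card K) * b"
proof -
  assume a: "\<And>j. j \<in> K \<Longrightarrow> \<bar>f j\<bar> \<le> b" and b: "b \<ge> 0"
  have "(\<Sum>j\<in>K. (f j)\<^sup>2) \<le> (\<Sum>j\<in>K. b\<^sup>2)"
    using a b by (intro sum_mono) (auto simp: abs_le_square_iff[symmetric])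
  then have "L2_set f K \<le> sqrt (card K * b\<^sup>2)" unfolding L2_set_def by simp
  then show ?thesis using b by (simp add: real_sqrt_mult)
qed

lemma grid_coord_approx_L2:
  assumes N: "N = 2 * p * W" and W: "W \<ge> 1" and s: "s > 0"
  shows "L2_set (\<lambda>j. u j - grid W s (grid_coord N W s u) j) {..<N} \<le> s * sqrt (2 * p)"
    "L2_set (grid W s (grid_coord N W s u)) {..<N} \<le> L2_set u {..<N}"
proof -
  have "L2_set (\<lambda>j. u j - grid W s (grid_coord N W s u) j) {..<N} \<le> sqrt (card {..<N}) * (s / sqrt (real W))"
    by (rule L2_set_bound) (use grid_coord_approx[OF W s] s in auto)
  also have "\<dots> = s * sqrt (2 * p)" using W by (simp add: N real_sqrt_mult)
  finally show "L2_set (\<lambda>j. u j - grid W s (grid_coord N W s u) j) {..<N} \<le> s * sqrt (2 * p)" .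
  show "L2_set (grid W s (grid_coord N W s u)) {..<N} \<le> L2_set u {..<N}"
    unfolding L2_set_def using grid_coord_approx(2)[OF W s]
    by (intro real_sqrt_le_mono sum_mono) (auto simp: abs_le_square_iff[symmetric])
qed

text \<open>By Cauchy-Schwarz the l1 norm of \<open>u\<close> is at most
  \<open>sqrt (2 * p * W)\<close>; division by the mesh gives the radius.\<close>

lemma grid_coord_in_int_ball:
  assumes N: "N = 2 * p * W" and W: "W \<ge> 1" and s: "s > 0" and u: "L2_set u {..<N} \<le> 1"
  shows "grid_coord N W s u \<in> int_ball N (sqrt (2 * p) * W / s)"
proof -
  have "(\<Sum>j<N. \<bar>real_of_int (grid_coord N W s u j)\<bar>) \<le> (\<Sum>j<N. \<bar>u j\<bar> * (sqrt (real W) / s))"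
  proof (rule sum_mono)
    fix j assume "j \<in> {..<N}"
    then show "\<bar>real_of_int (grid_coord N W s u j)\<bar> \<le> \<bar>u j\<bar> * (sqrt (real W) / s)"
      using trunc_bounds(2)[of "sqrt (real W) * u j / s"] s by (simp add: grid_coord_def abs_mult mult.commute)
  qed
  also have "\<dots> = (\<Sum>j<N. \<bar>u j\<bar> * \<bar>1\<bar>) * (sqrt (real W) / s)"
    by (simp only: sum_distrib_right abs_one mult_1_right)
  also have "\<dots> \<le> (L2_set u {..<N} * L2_set (\<lambda>_. 1) {..<N}) * (sqrt (real W) / s)"
    using s by (intro mult_right_mono L2_set_mult_ineq) auto
  also have "\<dots> \<le> (1 * sqrt N) * (sqrt (real W) / s)"
    using s u by (intro mult_right_mono mult_mono) (auto simp: L2_set_constant)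
  also have "\<dots> = sqrt (2 * p) * W / s" by (simp add: N real_sqrt_mult)
  finally show ?thesis by (simp add: int_ball_def grid_coord_def)
qed

section \<open>Bilinear forms of a symmetric matrix and their suprema\<close>

text \<open>Folds the lower triangle onto the upper one, where the entries are independent.\<close>

lemma sum_square_upper:
  "(\<Sum>i<N. \<Sum>j<N. f i j) = (\<Sum>(i, j)\<in>upper_rows N N. f i j + (if i = j then 0 else f j i :: real))"
proof -
  let ?U = "upper_rows N N" and ?S = "{(i, j). i < j \<and> j < N}"
  have fin: "finite ?S" by (rule finite_subset[of _ "{..<N} \<times> {..<N}"]) auto
  have "(\<Sum>i<N. \<Sum>j<N. f i j) = (\<Sum>(i, j)\<in>{..<N} \<times> {..<N}. f i j)" by (simp add: sum.cartesian_product)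
  also have "{..<N} \<times> {..<N} = ?U \<union> prod.swap ` ?S" by (auto simp: upper_rows_def image_iff)
  also have "(\<Sum>(i, j)\<in>?U \<union> prod.swap ` ?S. f i j) = (\<Sum>(i, j)\<in>?U. f i j) + (\<Sum>(i, j)\<in>prod.swap ` ?S. f i j)"
    by (rule sum.union_disjoint) (use fin in auto, auto simp: upper_rows_def)
  also have "(\<Sum>(i, j)\<in>prod.swap ` ?S. f i j) = (\<Sum>(i, j)\<in>?S. f j i)"
    by (subst sum.reindex) (auto simp: case_prod_unfold)
  also have "\<dots> = (\<Sum>(i, j)\<in>?U. if i = j then 0 else f j i)"
    
  proof (rule sum.mono_neutral_cong_left[OF finite_upper_rows])
    show "?S \<subseteq> ?U" by (auto simp: upper_rows_def)
    show "\<forall>z\<in>?U - ?S. (case z of (i, j) \<Rightarrow> if i = j then 0 else f j i) = 0"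
    proof
      fix z assume z: "z \<in> ?U - ?S"
      obtain i j where ij: "z = (i, j)" by force
      then have "i = j" using z by (simp add: upper_rows_def) linarith
      then show "(case z of (i, j) \<Rightarrow> if i = j then 0 else f j i) = 0" using ij by simp
    qed
    fix z assume z: "z \<in> ?S"
    obtain i j where ij: "z = (i, j)" by force
    then have "i \<noteq> j" using z by simp
    then show "(case z of (i, j) \<Rightarrow> f j i) = (case z of (i, j) \<Rightarrow> if i = j then 0 else f j i)" using ij by simp
  qed
  finally show ?thesis unfolding case_prod_unfold sum.distrib .
qed

text \<open>If \<open>c\<close> bounds \<open>Q\<close> on the unit ball, so does
  \<open>T + c / 2\<close>, since each of the two rounding errors is a quarter of a vector in the
  ball. The crude bound \<open>c0\<close> makes the set of bounds nonempty, so its infimum exists,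
  is itself a bound, and is at most \<open>T\<close> plus half of itself.\<close>

lemma bilinear_approx:
  fixes Q :: "(nat \<Rightarrow> real) \<Rightarrow> (nat \<Rightarrow> real) \<Rightarrow> real"
  assumes add1: "\<And>u u' w. Q (\<lambda>j. u j + u' j) w = Q u w + Q u' w"
    and add2: "\<And>u w w'. Q u (\<lambda>j. w j + w' j) = Q u w + Q u w'"
    and scale1: "\<And>c u w. Q (\<lambda>j. c * u j) w = c * Q u w"
    and scale2: "\<And>c u w. Q u (\<lambda>j. c * w j) = c * Q u w"
    and bdd: "\<And>u w. L2_set u K \<le> 1 \<Longrightarrow> L2_set w K \<le> 1 \<Longrightarrow> Q u w \<le> c0"
    and net: "\<And>u w. L2_set u K \<le> 1 \<Longrightarrow> L2_set w K \<le> 1 \<Longrightarrow> \<exists>u' w'. L2_set u' K \<le> 1 \<and> L2_set w' K \<le> 1 \<and>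
      L2_set (\<lambda>j. u j - u' j) K \<le> 1 / 4 \<and> L2_set (\<lambda>j. w j - w' j) K \<le> 1 / 4 \<and> Q u' w' \<le> T"
    and u: "L2_set u K \<le> 1" and w: "L2_set w K \<le> 1"
  shows "Q u w \<le> 2 * T"
proof -
  define S where "S = {c. \<forall>u w. L2_set u K \<le> 1 \<longrightarrow> L2_set w K \<le> 1 \<longrightarrow> Q u w \<le> c}"
  have c0: "c0 \<in> S" using bdd by (auto simp: S_def)
  have lower: "Q u w \<le> c" if "c \<in> S" for c using that u w by (auto simp: S_def)
  have step: "T + c / 2 \<in> S" if c: "c \<in> S" for c
    unfolding S_def
  proof safe
    fix u w assume uw: "L2_set u K \<le> 1" "L2_set w K \<le> 1"
    from net[OF this] obtain u' w' where *: "L2_set u' K \<le> 1" "L2_set w' K \<le> 1"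
      "L2_set (\<lambda>j. u j - u' j) K \<le> 1 / 4" "L2_set (\<lambda>j. w j - w' j) K \<le> 1 / 4" "Q u' w' \<le> T" by blast
    have four: "L2_set (\<lambda>j. 4 * r j) K \<le> 1" if "L2_set r K \<le> 1 / 4" for r
      using that by (subst L2_set_right_distrib[symmetric]) auto
    have "Q (\<lambda>j. 4 * (u j - u' j)) w \<le> c" "Q u' (\<lambda>j. 4 * (w j - w' j)) \<le> c"
      using c uw * four[OF *(3)] four[OF *(4)] by (auto simp: S_def)
    then have "Q (\<lambda>j. u j - u' j) w \<le> c / 4" "Q u' (\<lambda>j. w j - w' j) \<le> c / 4"
      unfolding scale1 scale2 by auto
    moreover have "Q u w = Q u' w' + Q u' (\<lambda>j. w j - w' j) + Q (\<lambda>j. u j - u' j) w"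
      using add1[of u' "\<lambda>j. u j - u' j" w] add2[of u' w' "\<lambda>j. w j - w' j"] by simp
    ultimately show "Q u w \<le> T + c / 2" using *(5) by simp
  qed
  have bb: "bdd_below S" by (rule bdd_belowI[of _ "Q u w"]) (rule lower)
  have InfS: "Inf S \<in> S"
    unfolding S_def
  proof safe
    fix u' w' assume "L2_set u' K \<le> 1" "L2_set w' K \<le> 1"
    then show "Q u' w' \<le> Inf {c. \<forall>u w. L2_set u K \<le> 1 \<longrightarrow> L2_set w K \<le> 1 \<longrightarrow> Q u w \<le> c}"
      using c0 by (intro cInf_greatest) (auto simp: S_def)
  qed
  have "Inf S \<le> T + Inf S / 2" by (rule cInf_lower[OF step[OF InfS] bb])
  then have "Inf S \<le> 2 * T" by simp
  then show ?thesis using lower[OF InfS] by simp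
qed

context band_law
begin

definition bilin :: "(nat \<times> nat \<Rightarrow> real) \<Rightarrow> (nat \<Rightarrow> real) \<Rightarrow> (nat \<Rightarrow> real) \<Rightarrow> real" where
  "bilin h x y = (\<Sum>i<N. x i * sym_row N h y i)"

text \<open>Chernoff's bound with parameter \<open>W\<close>. Each independent entry carries the
  coefficients of two mirror positions; their squares add up to at most 2, which is the 2 in the
  exponent.\<close>

lemma bilin_tail:
  assumes x: "L2_set x {..<N} \<le> 1" and y: "L2_set y {..<N} \<le> 1"
  shows "emeasure \<Omega> {h \<in> space \<Omega>. T \<le> bilin h x y} \<le> ennreal (exp (W * (2 * (1 + C) / \<delta> - T)))"
proof -
  let ?U = "upper_rows N N"
  define c where "c = (\<lambda>(i, j). x i * y j + (if i = j then 0 else x j * y i))"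
  have c2: "(\<Sum>z\<in>?U. (c z)\<^sup>2) \<le> 2"
  proof -
    have "(\<Sum>z\<in>?U. (c z)\<^sup>2) \<le> (\<Sum>(i, j)\<in>?U. 2 * ((x i)\<^sup>2 * (y j)\<^sup>2) + (if i = j then 0 else 2 * ((x j)\<^sup>2 * (y i)\<^sup>2)))"
    proof (rule sum_mono, clarify)
      fix i j
      have "(a + b)\<^sup>2 \<le> 2 * a\<^sup>2 + 2 * b\<^sup>2" for a b :: real
        using sum_squares_bound[of a b] by (simp add: power2_sum)
      from this[of "x i * y j" "x j * y i"]
      show "(c (i, j))\<^sup>2 \<le> 2 * ((x i)\<^sup>2 * (y j)\<^sup>2) + (if i = j then 0 else 2 * ((x j)\<^sup>2 * (y i)\<^sup>2))"
        by (auto simp: c_def power_mult_distrib)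
    qed
    also have "\<dots> = (\<Sum>i<N. \<Sum>j<N. 2 * ((x i)\<^sup>2 * (y j)\<^sup>2))" by (rule sum_square_upper[symmetric])
    also have "\<dots> = 2 * ((\<Sum>i<N. (x i)\<^sup>2) * (\<Sum>j<N. (y j)\<^sup>2))"
      by (subst sum_product) (simp add: sum_distrib_left)
    also have "\<dots> \<le> 2 * (1 * 1)"
      using x y by (intro mult_left_mono mult_mono) (auto simp: L2_set_def sum_nonneg)
    finally show ?thesis by simp
  qed
  have form: "bilin h x y = (\<Sum>z\<in>?U. h z * c z)" for h
  proof -
    have "bilin h x y = (\<Sum>i<N. \<Sum>j<N. x i * (h (min i j, max i j) * y j))"
      by (simp add: bilin_def sym_row_def sum_distrib_left)
    also have "\<dots> = (\<Sum>(i, j)\<in>?U. x i * (h (min i j, max i j) * y j) + (if i = j then 0 else x j * (h (min j i, max j i) * y i)))"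
      by (rule sum_square_upper)
    also have "\<dots> = (\<Sum>z\<in>?U. h z * c z)"
      by (rule sum.cong) (auto simp: upper_rows_def c_def algebra_simps min_def max_def)
    finally show ?thesis .
  qed
  interpret product_sigma_finite P
    by (rule product_sigma_finite.intro) (simp add: prob_space_P prob_space_imp_sigma_finite)
  have [measurable]: "\<And>z. z \<in> ?U \<Longrightarrow> (\<lambda>h. h z) \<in> borel_measurable \<Omega>"
    unfolding \<Omega>_def by (rule measurable_component)
  have [measurable]: "(\<lambda>h. bilin h x y) \<in> borel_measurable \<Omega>"
    unfolding form by measurable
  let ?E = "\<lambda>h. ennreal (exp (W * bilin h x y))"
  have "emeasure \<Omega> {h \<in> space \<Omega>. T \<le> bilin h x y} \<le> emeasure \<Omega> {h \<in> space \<Omega>. 1 \<le> ennreal (exp (- W * T)) * ?E h}"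
  proof (rule emeasure_mono)
    show "{h \<in> space \<Omega>. T \<le> bilin h x y} \<subseteq> {h \<in> space \<Omega>. 1 \<le> ennreal (exp (- W * T)) * ?E h}"
      by (auto simp: ennreal_mult[symmetric] exp_add[symmetric] mult_left_mono)
  qed measurable
  also have "\<dots> \<le> ennreal (exp (- W * T)) * (\<integral>\<^sup>+h. ?E h * indicator (space \<Omega>) h \<partial>\<Omega>)"
    by (rule nn_integral_Markov_inequality) measurable
  finally have markov: "emeasure \<Omega> {h \<in> space \<Omega>. T \<le> bilin h x y}
    \<le> ennreal (exp (- W * T)) * (\<integral>\<^sup>+h. ?E h * indicator (space \<Omega>) h \<partial>\<Omega>)" .
  have "(\<integral>\<^sup>+h. ?E h * indicator (space \<Omega>) h \<partial>\<Omega>) = (\<integral>\<^sup>+h. ?E h \<partial>\<Omega>)"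
    by (intro nn_integral_cong) auto
  also have "\<dots> = (\<integral>\<^sup>+h. (\<Prod>z\<in>?U. ennreal (exp (W * c z * h z))) \<partial>\<Omega>)"
    by (intro nn_integral_cong) (simp add: form prod_ennreal exp_sum[symmetric] sum_distrib_left ac_simps)
  also have "\<dots> = (\<Prod>z\<in>?U. \<integral>\<^sup>+a. ennreal (exp (W * c z * a)) \<partial>P z)"
    unfolding \<Omega>_def
  proof (rule product_nn_integral_prod)
    fix z
    have "(\<lambda>a. ennreal (exp (W * c z * a))) \<in> borel_measurable borel" by measurable
    then show "(\<lambda>a. ennreal (exp (W * c z * a))) \<in> borel_measurable (P z)"
      by (simp cong: measurable_cong_sets add: sets_P)
  qed simp
  also have "\<dots> \<le> (\<Prod>z\<in>?U. ennreal (exp ((1 + C) * (W * c z)\<^sup>2 / (\<delta> * W))))"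
  proof (rule prod_mono_ennreal)
    fix z show "(\<integral>\<^sup>+a. ennreal (exp (W * c z * a)) \<partial>P z) \<le> ennreal (exp ((1 + C) * (W * c z)\<^sup>2 / (\<delta> * W)))"
      by (intro entry_law_mgf law C \<delta>) (use W in auto)
  qed
  also have "\<dots> = ennreal (exp (\<Sum>z\<in>?U. (1 + C) * (W * c z)\<^sup>2 / (\<delta> * W)))"
    by (simp add: prod_ennreal exp_sum)
  also have "(\<Sum>z\<in>?U. (1 + C) * (W * c z)\<^sup>2 / (\<delta> * W)) = W * (1 + C) / \<delta> * (\<Sum>z\<in>?U. (c z)\<^sup>2)"
    unfolding sum_distrib_left
    by (rule sum.cong) (use W \<delta> in \<open>simp_all add: power2_eq_square field_simps\<close>)
  finally have "emeasure \<Omega> {h \<in> space \<Omega>. T \<le> bilin h x y}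
    \<le> ennreal (exp (- W * T)) * ennreal (exp (W * (1 + C) / \<delta> * (\<Sum>z\<in>?U. (c z)\<^sup>2)))"
    using markov by (meson mult_left_mono order_trans zero_le)
  also have "\<dots>
    \<le> ennreal (exp (- W * T)) * ennreal (exp (W * (1 + C) / \<delta> * 2))"
    using W C \<delta> c2 by (intro mult_left_mono ennreal_leI exp_le_cancel_iff[THEN iffD2] mult_left_mono) auto
  also have "\<dots> = ennreal (exp (W * (2 * (1 + C) / \<delta> - T)))"
    by (simp add: ennreal_mult[symmetric] exp_add[symmetric] algebra_simps)
  finally show ?thesis .
qed

end

subsection \<open>Union bounds over sparse and spread vectors\<close>

text \<open>
  All but few points of \<open>J\<close> are rows that see many points of \<open>J\<close>. In addition, the block
  preceding the first crowded block after block \<open>l\<close> consists of such rows and contains few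
  points of \<open>J\<close>.
\<close>

lemma many_rows_see_spread_set:
  fixes J :: "nat set" and W p l :: nat and \<alpha> \<beta> :: real
  assumes W: "W \<ge> 1" and l: "l < 2 * p" and J: "J \<subseteq> {l * W..<2 * p * W}"
    and \<alpha>: "0 < \<alpha>" "2 * p * \<alpha> \<le> \<beta>" and \<beta>: "\<beta> \<le> 1 / 8"
    and first: "card (J \<inter> {l * W..<(l + 1) * W}) \<le> \<beta> * W"
    and J2: "card J \<ge> 2 * \<beta> * W"
  shows "card {i \<in> {l * W..<2 * p * W}. card (J \<inter> {i..<i + 2 * W}) \<ge> \<alpha> * W} \<ge> card J + real W / 2"
proof -
  define R where "R = {i \<in> {l * W..<2 * p * W}. card (J \<inter> {i..<i + 2 * W}) \<ge> \<alpha> * W}"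
  define B where "B k = {k * W..<(k + 1) * W}" for k
  have finJ: "finite J" using J finite_subset by blast
  have cover: "K \<subseteq> (\<Union>k\<in>{l..<2 * p}. K \<inter> B k)" if K: "K \<subseteq> {l * W..<2 * p * W}" for K
  proof
    fix j assume j: "j \<in> K"
    with K have j': "l * W \<le> j" "j < 2 * p * W" by auto
    have "j div W < 2 * p" using j'(2) W by (simp add: less_mult_imp_div_less)
    moreover have "l \<le> j div W" using j'(1) W div_le_mono[of "l * W" j W] by simp
    moreover have "j \<in> B (j div W)" using W dividend_less_div_times[of W j] by (simp add: B_def)
    ultimately show "j \<in> (\<Union>k\<in>{l..<2 * p}. K \<inter> B k)" using j by auto
  qed
  have card_le: "real (card K) \<le> (\<Sum>k\<in>{l..<2 * p}. real (card (K \<inter> B k)))" if K: "K \<subseteq> {l * W..<2 * p * W}" for K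
  proof -
    have finK: "finite K" using K finite_subset by blast
    have "card K \<le> card (\<Union>k\<in>{l..<2 * p}. K \<inter> B k)" by (rule card_mono[OF _ cover[OF K]]) (use finK in auto)
    also have "\<dots> \<le> (\<Sum>k\<in>{l..<2 * p}. card (K \<inter> B k))" by (rule card_UN_le) simp
    finally show ?thesis unfolding of_nat_sum[symmetric] of_nat_le_iff .
  qed
  have W0: "real W > 0" using W by simp
  \<comment> \<open>Otherwise \<open>J\<close> has fewer than
    \<open>\<beta> * W + 2 * p * \<alpha> * W\<close> points, which is at most
    \<open>2 * \<beta> * W\<close>.\<close>
  have "\<exists>k. l < k \<and> k < 2 * p \<and> card (J \<inter> B k) \<ge> \<alpha> * W"
  proof (rule ccontr)
    assume neg: "\<not> ?thesis"
    have "real (card J) \<le> (\<Sum>k\<in>{l..<2 * p}. real (card (J \<inter> B k)))" by (rule card_le[OF J])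
    also have "\<dots> = real (card (J \<inter> B l)) + (\<Sum>k\<in>{Suc l..<2 * p}. real (card (J \<inter> B k)))"
      using l by (simp add: sum.atLeast_Suc_lessThan)
    also have "\<dots> \<le> \<beta> * W + (\<Sum>k\<in>{Suc l..<2 * p}. \<alpha> * W)"
      using neg first by (intro add_mono sum_mono) (auto simp: B_def not_le less_imp_le)
    also have "(\<Sum>k\<in>{Suc l..<2 * p}. \<alpha> * W) = real (2 * p - Suc l) * (\<alpha> * W)" by simp
    also have "\<dots> < (2 * p) * (\<alpha> * W)" using \<alpha> W0 l by (intro mult_strict_right_mono) auto
    also have "\<dots> \<le> \<beta> * W" using mult_right_mono[OF \<alpha>(2), of "real W"] by simp
    finally show False using J2 by simp
  qed
  define k where "k = (LEAST k. l < k \<and> k < 2 * p \<and> card (J \<inter> B k) \<ge> \<alpha> * W)"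
  have k: "l < k" "k < 2 * p" "card (J \<inter> B k) \<ge> \<alpha> * W"
    using LeastI_ex[OF \<open>\<exists>k. l < k \<and> k < 2 * p \<and> card (J \<inter> B k) \<ge> \<alpha> * W\<close>] unfolding k_def by auto
  have \<alpha>\<beta>: "\<alpha> \<le> \<beta>" 
  proof -
    have "1 * \<alpha> \<le> real (2 * p) * \<alpha>" using l \<alpha>(1) by (intro mult_right_mono) auto
    then show ?thesis using \<alpha>(2) by simp
  qed
  have prev: "card (J \<inter> B (k - 1)) \<le> \<beta> * W"
  proof (cases "k - 1 = l")
    case True then show ?thesis using first by (simp add: B_def)
  next
    case False
    then have "l < k - 1" "k - 1 < k" using k by auto
    then have "card (J \<inter> B (k - 1)) < \<alpha> * W"
      using not_less_Least[of "k - 1" "\<lambda>k. l < k \<and> k < 2 * p \<and> card (J \<inter> B k) \<ge> \<alpha> * W"] k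
      unfolding k_def[symmetric] by auto
    also have "\<dots> \<le> \<beta> * W" using \<alpha>\<beta> by (intro mult_right_mono) auto
    finally show ?thesis by simp
  qed
  \<comment> \<open>From any row of block \<open>k - 1\<close> a window of length
    \<open>2 * W\<close> reaches to the end of block \<open>k\<close>, so it contains all of that
    block.\<close>
  have sub: "B (k - 1) \<subseteq> R"
  proof
    fix i assume i: "i \<in> B (k - 1)"
    obtain k' where k': "k = Suc k'" "l \<le> k'" using k(1) by (cases k) auto
    have i': "k' * W \<le> i" "i < k' * W + W" using i k' by (auto simp: B_def)
    have "J \<inter> B k \<subseteq> J \<inter> {i..<i + 2 * W}" using i' k' by (auto simp: B_def)
    then have "card (J \<inter> B k) \<le> card (J \<inter> {i..<i + 2 * W})" using finJ by (intro card_mono) auto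
    moreover have "l * W \<le> i" using i' k'(2) by (meson le_trans mult_le_mono1)
    moreover have "i < 2 * p * W"
    proof -
      have "(k' + 1) * W \<le> 2 * p * W" using k k' by (intro mult_le_mono1) auto
      then show ?thesis using i' by simp
    qed
    ultimately show "i \<in> R" using k(3) by (auto simp: R_def)
  qed
  have bad: "card (J - R) \<le> \<beta> * W"
  proof -
    have "real (card (J - R)) \<le> (\<Sum>k\<in>{l..<2 * p}. real (card ((J - R) \<inter> B k)))" using J by (intro card_le) auto
    also have "\<dots> \<le> (\<Sum>k\<in>{l..<2 * p}. \<alpha> * W)"
    proof (rule sum_mono)
      fix k
      let ?K = "(J - R) \<inter> B k"
      show "real (card ?K) \<le> \<alpha> * W"
      proof (cases "?K = {}")
        case False
        \<comment> \<open>The leftmost bad point of a block has all other bad points of this block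
          in its window; since it is bad, they are few.\<close>
        define i where "i = Min ?K"
        have "finite ?K" using finJ by simp
        then have i: "i \<in> ?K" "\<And>j. j \<in> ?K \<Longrightarrow> i \<le> j"
          unfolding i_def using False by (rule Min_in, intro Min_le)
        have "?K \<subseteq> J \<inter> {i..<i + 2 * W}" using i by (fastforce simp: B_def)
        then have "card ?K \<le> card (J \<inter> {i..<i + 2 * W})" using finJ by (intro card_mono) auto
        moreover have "card (J \<inter> {i..<i + 2 * W}) < \<alpha> * W" using i(1) J by (auto simp: R_def)
        ultimately show ?thesis by linarith
      qed (use \<alpha> in simp)
    qed
    also have "\<dots> \<le> 2 * p * (\<alpha> * W)" using \<alpha> by (simp add: mult_right_mono)
    also have "\<dots> \<le> \<beta> * W" using mult_right_mono[OF \<alpha>(2), of "real W"] by simp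
    finally show ?thesis .
  qed
  have finR: "finite R" by (simp add: R_def)
  \<comment> \<open>The gain: two disjoint sets of rows, of size at least
    \<open>card J - \<beta> * W\<close> and \<open>W - \<beta> * W\<close>.\<close>
  have "card (J \<inter> R) + card (B (k - 1) - J) = card ((J \<inter> R) \<union> (B (k - 1) - J))"
    using finJ by (intro card_Un_disjoint[symmetric]) (auto simp: B_def)
  also have "\<dots> \<le> card R" using sub finR by (intro card_mono) auto
  finally have 1: "real (card (J \<inter> R)) + real (card (B (k - 1) - J)) \<le> card R" by linarith
  have "card J = card (J \<inter> R) + card (J - R)"
    using finJ by (metis card_Int_Diff)
  moreover have "W = card (B (k - 1) \<inter> J) + card (B (k - 1) - J)"
    using card_Int_Diff[of "B (k - 1)" J] by (simp add: B_def)
  then have "real W = real (card (J \<inter> B (k - 1))) + real (card (B (k - 1) - J))"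
    by (simp add: Int_commute flip: of_nat_add)
  moreover have "\<beta> * W \<le> 1 / 8 * W" using \<beta> by (intro mult_right_mono) auto
  ultimately have "card J + real W / 2 \<le> card R" using 1 bad prev by linarith
  then show ?thesis unfolding R_def .
qed

context band_law
begin

text \<open>In half of \<open>K0\<close>, the summand \<open>24 * p\<close> pays for the pairs from
  two nets of at most \<open>exp (12 * p * W)\<close> points each, and the 1 leaves
  \<open>exp (- W)\<close>. The factor 2 is the loss in \<open>bilinear_approx\<close>.\<close>

lemma opnorm_event:
  defines "K0 \<equiv> 2 * (2 * (1 + C) / \<delta> + 24 * p + 1)"
  shows "\<exists>Bad\<in>sets \<Omega>. emeasure \<Omega> Bad \<le> ennreal (exp (- real W)) \<and>
    (\<forall>h\<in>space \<Omega> - Bad. \<forall>w. L2_set (sym_row N h w) {..<N} \<le> K0 * L2_set w {..<N})"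
proof -
  define T where "T = 2 * (1 + C) / \<delta> + 24 * p + 1"
  \<comment> \<open>The mesh at which rounding costs 1/4 in norm.\<close>
  define s where "s = 1 / (4 * sqrt (2 * p))"
  have sp: "sqrt (2 * p) > 0" using p by simp
  have s: "s > 0" using sp by (simp add: s_def)
  have A: "sqrt (2 * p) * W / s = 8 * p * W" using p by (simp add: s_def)
  define Z where "Z = {z \<in> int_ball N (8 * p * W). L2_set (grid W s z) {..<N} \<le> 1}"
  have finZ: "finite Z" by (simp add: Z_def)
  define E where "E = (\<lambda>(z, z'). {h \<in> space \<Omega>. T \<le> bilin h (grid W s z) (grid W s z')})"
  have "real (card Z) \<le> (\<Sum>z\<in>int_ball N (8 * p * W). 1 ^ card (supp N z))"
    by (simp add: Z_def card_mono)
  also have "\<dots> \<le> exp (1 * real (8 * p * W)) * (1 + 2 * 1 / 1) ^ N" by (rule sum_int_ball_supp_le) auto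
  also have "\<dots> \<le> exp (8 * p * W) * exp 2 ^ N"
    using exp_ge_add_one_self[of 2] by (intro mult_mono power_mono) auto
  also have "\<dots> = exp (12 * p * W)" by (simp add: exp_of_nat_mult[symmetric] exp_add[symmetric] N_def)
  finally have cZ: "real (card Z) \<le> exp (12 * p * W)" .
  have meas: "E zz \<in> sets \<Omega>" for zz
    unfolding E_def case_prod_unfold bilin_def by measurable
  let ?Bad = "\<Union>zz\<in>Z \<times> Z. E zz"
  have "emeasure \<Omega> ?Bad \<le> (\<Sum>zz\<in>Z \<times> Z. emeasure \<Omega> (E zz))"
    using finZ meas by (intro emeasure_subadditive_finite) auto
  also have "\<dots> \<le> (\<Sum>zz\<in>Z \<times> Z. ennreal (exp (W * (2 * (1 + C) / \<delta> - T))))"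
  proof (rule sum_mono, clarify)
    fix z z' assume "z \<in> Z" "z' \<in> Z"
    then show "emeasure \<Omega> (E (z, z')) \<le> ennreal (exp (W * (2 * (1 + C) / \<delta> - T)))"
      unfolding E_def case_prod_conv by (intro bilin_tail) (auto simp: Z_def)
  qed
  also have "\<dots> = ennreal (real (card Z) * real (card Z) * exp (W * (2 * (1 + C) / \<delta> - T)))"
    by (simp add: card_cartesian_product ennreal_of_nat_eq_real_of_nat ennreal_mult)
  also have "\<dots> \<le> ennreal (exp (12 * p * W) * exp (12 * p * W) * exp (W * (2 * (1 + C) / \<delta> - T)))"
    by (intro ennreal_leI mult_mono cZ) auto
  also have "exp (12 * p * W) * exp (12 * p * W) * exp (W * (2 * (1 + C) / \<delta> - T)) = exp (- real W)"
    by (simp add: exp_add[symmetric] T_def algebra_simps)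
  finally have 1: "emeasure \<Omega> ?Bad \<le> ennreal (exp (- real W))" .
  have K0: "K0 = 2 * T" by (simp add: K0_def T_def)
  have 2: "L2_set (sym_row N h w) {..<N} \<le> K0 * L2_set w {..<N}" if h: "h \<in> space \<Omega> - ?Bad" for h w
  proof -
    have lin: "sym_row N h (\<lambda>j. w j + w' j) i = sym_row N h w i + sym_row N h w' i"
      "sym_row N h (\<lambda>j. c * w j) i = c * sym_row N h w i" for w w' c i
      by (simp_all add: sym_row_def algebra_simps sum.distrib sum_distrib_left)
    have unit: "bilin h u w \<le> 2 * T" if "L2_set u {..<N} \<le> 1" "L2_set w {..<N} \<le> 1" for u w
    proof (rule bilinear_approx[where K = "{..<N}" and Q = "bilin h"])
      fix u w assume uw: "L2_set u {..<N} \<le> 1" "L2_set w {..<N} \<le> 1"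
      show "bilin h u w \<le> (\<Sum>i<N. \<Sum>j<N. \<bar>h (min i j, max i j)\<bar>)"
        unfolding bilin_def sym_row_def sum_distrib_left
      proof (intro sum_mono)
        fix i j assume "i \<in> {..<N}" "j \<in> {..<N}"
        then have "\<bar>u i\<bar> \<le> 1" "\<bar>w j\<bar> \<le> 1"
          using uw abs_le_L2_set[of "{..<N}"] order_trans by blast+
        then have "\<bar>u i\<bar> * \<bar>h (min i j, max i j)\<bar> * \<bar>w j\<bar> \<le> 1 * \<bar>h (min i j, max i j)\<bar> * 1"
          by (intro mult_mono) auto
        moreover have "u i * (h (min i j, max i j) * w j) \<le> \<bar>u i * (h (min i j, max i j) * w j)\<bar>" by simp
        ultimately show "u i * (h (min i j, max i j) * w j) \<le> \<bar>h (min i j, max i j)\<bar>"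
          by (simp add: abs_mult)
      qed
      let ?z = "grid_coord N W s u" and ?z' = "grid_coord N W s w"
      have N_eq: "N = 2 * p * W" by (simp add: N_def)
      have "?z \<in> Z" "?z' \<in> Z"
        using uw grid_coord_in_int_ball[OF N_eq W s] grid_coord_approx_L2(2)[OF N_eq W s] order_trans
        unfolding Z_def A by blast+
      then have "bilin h (grid W s ?z) (grid W s ?z') \<le> T" using h by (force simp: E_def)
      have quarter: "s * sqrt (2 * p) = 1 / 4" using sp by (simp add: s_def)
      show "\<exists>u' w'. L2_set u' {..<N} \<le> 1 \<and> L2_set w' {..<N} \<le> 1 \<and>
        L2_set (\<lambda>j. u j - u' j) {..<N} \<le> 1 / 4 \<and> L2_set (\<lambda>j. w j - w' j) {..<N} \<le> 1 / 4 \<and> bilin h u' w' \<le> T"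
      proof (rule exI[of _ "grid W s ?z"], rule exI[of _ "grid W s ?z'"], intro conjI)
        show "L2_set (grid W s ?z) {..<N} \<le> 1" "L2_set (grid W s ?z') {..<N} \<le> 1"
          using grid_coord_approx_L2(2)[OF N_eq W s] uw by (blast intro: order_trans)+
        show "L2_set (\<lambda>j. u j - grid W s ?z j) {..<N} \<le> 1 / 4" "L2_set (\<lambda>j. w j - grid W s ?z' j) {..<N} \<le> 1 / 4"
          using grid_coord_approx_L2(1)[OF N_eq W s] quarter by metis+
        show "bilin h (grid W s ?z) (grid W s ?z') \<le> T" by fact
      qed
    qed (use that in \<open>simp_all add: bilin_def lin algebra_simps sum.distrib sum_distrib_left\<close>)
    let ?r = "sym_row N h w" and ?n = "\<lambda>f. L2_set f {..<N}"
    show ?thesis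
    proof (cases "?n ?r = 0 \<or> ?n w = 0")
      case True
      then show ?thesis
      proof
        assume "?n w = 0"
        then have "\<forall>j<N. w j = 0" by (simp add: L2_set_eq_0_iff)
        then have "?r = (\<lambda>_. 0)" by (auto simp: sym_row_def)
        then show ?thesis using \<open>?n w = 0\<close> by (simp add: L2_set_def)
      next
        assume "?n ?r = 0"
        then show ?thesis using C \<delta> by (simp add: K0_def)
      qed
    next
      case False
      then have pos: "?n ?r > 0" "?n w > 0" by (smt (verit) L2_set_nonneg)+
      have nrm: "?n (\<lambda>j. 1 / ?n f * f j) \<le> 1" for f
        by (subst L2_set_right_distrib[symmetric]) auto
      \<comment> \<open>Testing the form against the normalised image of \<open>w\<close> recovers
        the norm of that image.\<close>
      have "bilin h (\<lambda>j. 1 / ?n ?r * ?r j) (\<lambda>j. 1 / ?n w * w j) \<le> 2 * T"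
        by (intro unit nrm)
      also have "bilin h (\<lambda>j. 1 / ?n ?r * ?r j) (\<lambda>j. 1 / ?n w * w j) = (\<Sum>i<N. (?r i)\<^sup>2) / (?n ?r * ?n w)"
        unfolding bilin_def lin by (simp add: sum_divide_distrib power2_eq_square)
      also have "(\<Sum>i<N. (?r i)\<^sup>2) = ?n ?r * ?n ?r" by (simp add: L2_set_def sum_nonneg)
      finally show ?thesis using pos by (simp add: K0 field_simps)
    qed
  qed
  show ?thesis
  proof (rule bexI[of _ ?Bad], intro conjI ballI allI)
    show "?Bad \<in> sets \<Omega>" using meas finZ by auto
  qed (use 1 2 in auto)
qed

end

context band_law
begin

definition near_kernel :: "nat \<Rightarrow> (nat \<Rightarrow> real) \<Rightarrow> real \<Rightarrow> real \<Rightarrow> (nat \<times> nat \<Rightarrow> real) set" where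
  "near_kernel a v e r = {h \<in> space \<Omega>. (\<Sum>i\<in>{a..<N}. (sym_row N h v i - e * v i)\<^sup>2) \<le> r\<^sup>2}"

lemma near_kernel_sets [measurable]: "near_kernel a v e r \<in> sets \<Omega>"
  unfolding near_kernel_def by measurable

text \<open>For a fixed net point, \<open>e * v i\<close> is one more deterministic shift of row
  \<open>i\<close>.\<close>

lemma near_kernel_prob:
  fixes r q :: real
  assumes R: "R \<subseteq> {a..<N}" and t: "t > 0" and s0: "s \<ge> 0"
    and c: "c * b \<le> c0 * t"
    and rows: "\<And>i. i \<in> R \<Longrightarrow> \<exists>V\<subseteq>{i..<N}. (\<forall>j\<in>V. j < i + 2 * W \<and> \<bar>v j\<bar> \<le> b) \<and> 16 * t\<^sup>2 * s \<le> (\<Sum>j\<in>V. (v j)\<^sup>2)"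
    and q: "cut_gauss c s \<le> q"
  shows "emeasure \<Omega> (near_kernel a v e r) \<le> ennreal (exp (W * r\<^sup>2 / (2 * t\<^sup>2)) * q ^ card R)"
proof -
  have R': "R \<subseteq> {..<N}" using R by auto
  have "near_kernel a v e r \<subseteq> {h \<in> space \<Omega>. (\<Sum>i\<in>R. (sym_row N h v i + - (e * v i))\<^sup>2) \<le> r\<^sup>2}"
  proof
    fix h assume h: "h \<in> near_kernel a v e r"
    have "(\<Sum>i\<in>R. (sym_row N h v i + - (e * v i))\<^sup>2) \<le> (\<Sum>i\<in>{a..<N}. (sym_row N h v i - e * v i)\<^sup>2)"
      using R by (simp add: sum_mono2)
    then show "h \<in> {h \<in> space \<Omega>. (\<Sum>i\<in>R. (sym_row N h v i + - (e * v i))\<^sup>2) \<le> r\<^sup>2}"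
      using h by (simp add: near_kernel_def)
  qed
  moreover have "{h \<in> space \<Omega>. (\<Sum>i\<in>R. (sym_row N h v i + - (e * v i))\<^sup>2) \<le> r\<^sup>2} \<in> sets \<Omega>"
  proof -
    have [measurable]: "\<And>i. i \<in> R \<Longrightarrow> (\<lambda>h. sym_row N h v i) \<in> borel_measurable \<Omega>" using R' by auto
    show ?thesis by measurable
  qed
  ultimately show ?thesis
    using rows_small_ball[OF R' t s0 c rows q, of "\<lambda>i. - (e * v i)"] emeasure_mono order_trans by blast
qed

text \<open>The parameter \<open>e\<close> is discretised as well, to multiples of \<open>s\<close>;
  their number \<open>2 * m + 1\<close> will not depend on \<open>W\<close>.\<close>

definition net_event :: "nat \<Rightarrow> real \<Rightarrow> real \<Rightarrow> nat \<Rightarrow> (nat \<Rightarrow> int) set \<Rightarrow> (nat \<times> nat \<Rightarrow> real) set" where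
  "net_event a s r m Z = (\<Union>k\<in>{- int m..int m}. \<Union>z\<in>Z. near_kernel a (grid W s z) (s * real_of_int k) r)"

lemma net_event_prob:
  fixes r s x y A \<kappa> :: real
  assumes Z: "finite Z" and x: "0 < x"
    and y: "\<And>z k. z \<in> Z \<Longrightarrow> emeasure \<Omega> (near_kernel a (grid W s z) (s * real_of_int k) r) \<le> ennreal (y * x ^ card (supp N z))"
    and y0: "y \<ge> 0" and ZA: "Z \<subseteq> int_ball N A" and \<kappa>: "\<kappa> > 0"
  shows "net_event a s r m Z \<in> sets \<Omega>"
    "emeasure \<Omega> (net_event a s r m Z) \<le> ennreal ((2 * real m + 1) * (y * (exp (\<kappa> * A) * (1 + 2 * x / \<kappa>) ^ N)))"
proof -
  let ?E = "\<lambda>kz. near_kernel a (grid W s (snd kz)) (s * real_of_int (fst kz)) r"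
  have eq: "net_event a s r m Z = (\<Union>kz\<in>{- int m..int m} \<times> Z. ?E kz)"
  proof -
    have "(\<Union>k\<in>A. \<Union>z\<in>Z. f k z) = (\<Union>kz\<in>A \<times> Z. f (fst kz) (snd kz))"
      for A :: "int set" and f :: "int \<Rightarrow> (nat \<Rightarrow> int) \<Rightarrow> (nat \<times> nat \<Rightarrow> real) set"
    proof (intro equalityI subsetI)
      fix h assume "h \<in> (\<Union>k\<in>A. \<Union>z\<in>Z. f k z)"
      then obtain k z where "k \<in> A" "z \<in> Z" "h \<in> f k z" by (elim UN_E)
      then show "h \<in> (\<Union>kz\<in>A \<times> Z. f (fst kz) (snd kz))" by (intro UN_I[of "(k, z)"]) auto
    next
      fix h assume "h \<in> (\<Union>kz\<in>A \<times> Z. f (fst kz) (snd kz))"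
      then obtain kz where "kz \<in> A \<times> Z" "h \<in> f (fst kz) (snd kz)" by (elim UN_E)
      then show "h \<in> (\<Union>k\<in>A. \<Union>z\<in>Z. f k z)" by (intro UN_I[of "fst kz"] UN_I[of "snd kz"]) auto
    qed
    then show ?thesis unfolding net_event_def .
  qed
  show "net_event a s r m Z \<in> sets \<Omega>" unfolding eq using Z by auto
  have "emeasure \<Omega> (net_event a s r m Z) \<le> (\<Sum>kz\<in>{- int m..int m} \<times> Z. emeasure \<Omega> (?E kz))"
    unfolding eq using Z by (intro emeasure_subadditive_finite) auto
  also have "\<dots> \<le> (\<Sum>kz\<in>{- int m..int m} \<times> Z. ennreal (y * x ^ card (supp N (snd kz))))"
    by (intro sum_mono y) auto
  also have "\<dots> = ennreal (\<Sum>kz\<in>{- int m..int m} \<times> Z. y * x ^ card (supp N (snd kz)))"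
    using y0 x by (intro sum_ennreal) auto
  also have "(\<Sum>kz\<in>{- int m..int m} \<times> Z. y * x ^ card (supp N (snd kz)))
    = (\<Sum>k\<in>{- int m..int m}. \<Sum>z\<in>Z. y * x ^ card (supp N z))"
    by (simp only: sum.cartesian_product case_prod_unfold)
  also have "\<dots> = (2 * real m + 1) * (y * (\<Sum>z\<in>Z. x ^ card (supp N z)))" by (simp add: sum_distrib_left add.commute)
  also have "ennreal \<dots> \<le> ennreal ((2 * real m + 1) * (y * (exp (\<kappa> * A) * (1 + 2 * x / \<kappa>) ^ N)))"
  proof (intro ennreal_leI mult_left_mono)
    have "(\<Sum>z\<in>Z. x ^ card (supp N z)) \<le> (\<Sum>z\<in>int_ball N A. x ^ card (supp N z))"
      using x by (intro sum_mono2 ZA) auto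
    also have "\<dots> \<le> exp (\<kappa> * A) * (1 + 2 * x / \<kappa>) ^ N" using \<kappa> x by (intro sum_int_ball_supp_le) auto
    finally show "(\<Sum>z\<in>Z. x ^ card (supp N z)) \<le> exp (\<kappa> * A) * (1 + 2 * x / \<kappa>) ^ N" .
  qed (use y0 in auto)
  finally show "emeasure \<Omega> (net_event a s r m Z) \<le> ennreal ((2 * real m + 1) * (y * (exp (\<kappa> * A) * (1 + 2 * x / \<kappa>) ^ N)))" .
qed

text \<open>The bound 1 on the coordinates allows a fixed cutoff at scale \<open>t = 1\<close>. The
  heavy block holds its share of a quarter of the mass, divided among \<open>2 * p\<close>
  blocks.\<close>

definition sparse_net :: "nat \<Rightarrow> real \<Rightarrow> real \<Rightarrow> (nat \<Rightarrow> int) set" where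
  "sparse_net l s \<epsilon> = {z \<in> int_ball N (sqrt (2 * p) * W / s). real (card (supp N z)) \<le> (\<epsilon>::real) * real W \<and>
     (\<forall>j<N. \<bar>grid W s z j\<bar> \<le> 1) \<and>
     (\<exists>k. l < k \<and> k < 2 * p \<and> (\<Sum>j\<in>{k * W..<(k + 1) * W}. (grid W s z j)\<^sup>2) \<ge> 1 / (8 * p))}"

text \<open>The \<open>W\<close> rows of the block before the heavy one see all of it, and each
  costs a constant \<open>q < 1\<close> in the application; \<open>16 / (128 * p)\<close> is the
  mass of the heavy block. Since supports are small,
  \<open>1 \<le> x powr (- \<epsilon> * W) * x ^ card (supp N z)\<close>, which turns the plain
  count of the net into the weighted one with \<open>x\<close> free.\<close>

lemma sparse_net_prob:
  fixes r s x q \<epsilon> \<kappa> :: real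
  assumes s: "s > 0" and \<epsilon>: "\<epsilon> \<ge> 0" and x: "0 < x" "x \<le> 1" and \<kappa>: "\<kappa> > 0"
    and q: "cut_gauss c0 (1 / (128 * p)) \<le> q" "0 < q"
  shows "net_event (l * W) s r m (sparse_net l s \<epsilon>) \<in> sets \<Omega>"
    "emeasure \<Omega> (net_event (l * W) s r m (sparse_net l s \<epsilon>)) \<le>
      ennreal ((2 * real m + 1) * (exp (r\<^sup>2 / 2) * q * x powr (- \<epsilon>) * (exp (\<kappa> * sqrt (2 * p) / s) * (1 + 2 * x / \<kappa>) ^ (2 * p))) ^ W)"
proof -
  have single: "emeasure \<Omega> (near_kernel (l * W) (grid W s z) e r)
      \<le> ennreal (exp (W * r\<^sup>2 / 2) * q ^ W * x powr (- \<epsilon> * W) * x ^ card (supp N z))"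
    if z: "z \<in> sparse_net l s \<epsilon>" for z e
  proof -
    let ?v = "grid W s z"
    obtain k where k: "l < k" "k < 2 * p" "(\<Sum>j\<in>{k * W..<(k + 1) * W}. (?v j)\<^sup>2) \<ge> 1 / (8 * p)"
      using z by (auto simp: sparse_net_def)
    obtain k' where k': "k = Suc k'" "l \<le> k'" using k(1) by (cases k) auto
    let ?R = "{k' * W..<k * W}"
    have kN: "(k + 1) * W \<le> N" using k(2) unfolding N_def by (intro mult_le_mono1) auto
    have lk: "l * W \<le> k' * W" using k' by (intro mult_le_mono1)
    have "emeasure \<Omega> (near_kernel (l * W) ?v e r) \<le> ennreal (exp (W * r\<^sup>2 / (2 * 1\<^sup>2)) * q ^ card ?R)"
    proof (rule near_kernel_prob[where t = 1 and b = 1 and c = c0 and s = "1 / real (128 * p)"])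
      show "?R \<subseteq> {l * W..<N}" using lk kN by auto
      fix i assume i: "i \<in> ?R"
      have i': "k' * W \<le> i" "i < k' * W + W" using i k' by auto
      show "\<exists>V\<subseteq>{i..<N}. (\<forall>j\<in>V. j < i + 2 * W \<and> \<bar>?v j\<bar> \<le> 1) \<and> 16 * 1\<^sup>2 * (1 / (128 * p)) \<le> (\<Sum>j\<in>V. (?v j)\<^sup>2)"
      proof (intro exI[of _ "{k * W..<(k + 1) * W}"] conjI ballI)
        show "{k * W..<(k + 1) * W} \<subseteq> {i..<N}" using i kN by auto
        fix j assume j: "j \<in> {k * W..<(k + 1) * W}"
        show "j < i + 2 * W" using j i' k' by auto
        show "\<bar>?v j\<bar> \<le> 1" using j kN z by (auto simp: sparse_net_def)
      next
        show "16 * 1\<^sup>2 * (1 / (128 * p)) \<le> (\<Sum>j\<in>{k * W..<(k + 1) * W}. (?v j)\<^sup>2)" using k(3) by simp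
      qed
    qed (use q in auto)
    also have "card ?R = W" using k' by simp
    also have "exp (W * r\<^sup>2 / (2 * 1\<^sup>2)) * q ^ W \<le> exp (W * r\<^sup>2 / 2) * q ^ W * (x powr (- \<epsilon> * W) * x ^ card (supp N z))"
    proof -
      have "x powr (\<epsilon> * W) \<le> x powr (card (supp N z))"
        using z x by (intro powr_mono') (auto simp: sparse_net_def)
      then have "x powr (\<epsilon> * W) \<le> x ^ card (supp N z)" using x by (simp add: powr_realpow)
      then have "1 \<le> x powr (- \<epsilon> * W) * x ^ card (supp N z)"
        using x by (simp add: powr_minus field_simps)
      then show ?thesis using mult_left_mono[of 1 _ "exp (W * r\<^sup>2 / 2) * q ^ W"] q by simp
    qed
    finally show ?thesis by (simp add: ac_simps ennreal_leI)
  qed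
  have fin: "finite (sparse_net l s \<epsilon>)"
    by (rule finite_subset[of _ "int_ball N (sqrt (2 * p) * W / s)"]) (auto simp: sparse_net_def)
  have sub: "sparse_net l s \<epsilon> \<subseteq> int_ball N (sqrt (2 * p) * W / s)" by (auto simp: sparse_net_def)
  have y0: "0 \<le> exp (W * r\<^sup>2 / 2) * q ^ W * x powr (- \<epsilon> * W)" using q by simp
  note net = net_event_prob[OF fin x(1) single y0 sub \<kappa>, where m = m]
  show "net_event (l * W) s r m (sparse_net l s \<epsilon>) \<in> sets \<Omega>" by (rule net(1))
  have 1: "exp (W * r\<^sup>2 / 2) = exp (r\<^sup>2 / 2) ^ W" "x powr (- \<epsilon> * W) = (x powr (- \<epsilon>)) ^ W"
    "exp (\<kappa> * (sqrt (2 * p) * W / s)) = exp (\<kappa> * sqrt (2 * p) / s) ^ W"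
    using x by (simp_all add: exp_of_nat_mult[symmetric] powr_powr powr_realpow[symmetric] ac_simps)
  have 2: "(1 + 2 * x / \<kappa>) ^ N = ((1 + 2 * x / \<kappa>) ^ (2 * p)) ^ W" by (simp only: N_def power_mult)
  show "emeasure \<Omega> (net_event (l * W) s r m (sparse_net l s \<epsilon>)) \<le>
      ennreal ((2 * real m + 1) * (exp (r\<^sup>2 / 2) * q * x powr (- \<epsilon>) * (exp (\<kappa> * sqrt (2 * p) / s) * (1 + 2 * x / \<kappa>) ^ (2 * p))) ^ W)"
    using net(2) unfolding 1 2 power_mult_distrib by blast
qed

text \<open>
  The coordinates used for the small ball estimate. Those exceeding \<open>L / sqrt W\<close> are left out,
  since the characteristic functions are controlled only near the origin.
\<close>

definition visible :: "nat \<Rightarrow> real \<Rightarrow> nat \<Rightarrow> real \<Rightarrow> (nat \<Rightarrow> int) \<Rightarrow> nat set" where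
  "visible l s n L z = {j \<in> {l * W..<N}. int n \<le> \<bar>z j\<bar> \<and> s * \<bar>real_of_int (z j)\<bar> \<le> L}"

text \<open>The last two conditions feed \<open>many_rows_see_spread_set\<close>. The first one
  compares what the net costs (the support) with what the rows see (the visible coordinates) and
  spends half of the surplus \<open>W / 2\<close>.\<close>

definition spread_net :: "nat \<Rightarrow> real \<Rightarrow> nat \<Rightarrow> real \<Rightarrow> real \<Rightarrow> (nat \<Rightarrow> int) set" where
  "spread_net l s n L \<beta> = {z \<in> int_ball N (sqrt (2 * p) * W / s).
     real (card (supp N z)) \<le> card (visible l s n L z) + real W / 4 \<and>
     real (card (visible l s n L z \<inter> {l * W..<(l + 1) * W})) \<le> (\<beta>::real) * W \<and>
     real (card (visible l s n L z)) \<ge> 2 * (\<beta>::real) * real W}"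

text \<open>A row seeing \<open>\<alpha> * W\<close> coordinates of size
  \<open>n * s / sqrt W\<close> has Gaussian parameter \<open>\<alpha> * n\<^sup>2 / 16\<close>. Of
  the 4 in \<open>q\<close>, the integral takes \<open>sqrt 8 \<le> 3\<close> and the cutoff the
  remaining 1, for large \<open>W\<close>. One factor \<open>q\<close> is assigned to each point of
  the support, and \<open>q powr (W / 4)\<close> is left over.\<close>

lemma spread_net_prob:
  fixes r s q L \<alpha> \<beta> C1 :: real
  assumes s: "s > 0" and l: "l < 2 * p" and \<beta>: "0 < \<beta>" "\<beta> \<le> 1 / 8" and n: "n \<ge> 1" and L: "L > 0"
    and \<alpha>: "\<alpha> = \<beta> / (2 * p)" and q: "q = 4 / (n * sqrt \<alpha>)" "q \<le> 1"
    and Wlarge: "W \<ge> L\<^sup>2 * (n * sqrt \<alpha>) / (c0\<^sup>2 * s\<^sup>2)"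
    and r: "r = C1 * s"
  shows "net_event (l * W) s r m (spread_net l s n L \<beta>) \<in> sets \<Omega>"
    "emeasure \<Omega> (net_event (l * W) s r m (spread_net l s n L \<beta>)) \<le>
      ennreal ((2 * real m + 1) * (exp (C1\<^sup>2 / 2) * q powr (1 / 4) * (exp (sqrt (2 * p)) * (1 + 2 * q / s) ^ (2 * p))) ^ W)"
proof -
  have \<alpha>0: "\<alpha> > 0" using \<alpha> \<beta> p by simp
  have q0: "q > 0" using q \<alpha>0 n by simp
  have W0: "real W > 0" using W by simp
  have c0: "c0 > 0" using C \<delta> by (simp add: c0_def)
  \<comment> \<open>The largest cutoff permitted by coordinates up to \<open>L / sqrt W\<close>; it
    grows with \<open>W\<close>, so its error disappears.\<close>
  define c where "c = c0 * s * sqrt W / L"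
  have c: "c > 0" using c0 s W0 L by (simp add: c_def)
  have gauss: "cut_gauss c (\<alpha> * n\<^sup>2 / 16) \<le> q"
  proof -
    have sn: "sqrt \<alpha> > 0" "real n > 0" using \<alpha>0 n by auto
    have "cut_gauss c (\<alpha> * n\<^sup>2 / 16) \<le> 1 / sqrt (2 * (\<alpha> * n\<^sup>2 / 16)) + 1 / c\<^sup>2"
      using \<alpha>0 n by (intro cut_gauss_bound c) auto
    also have "sqrt (2 * (\<alpha> * n\<^sup>2 / 16)) = sqrt \<alpha> * n / sqrt 8"
      using n by (simp add: real_sqrt_mult real_sqrt_divide)
    also have "1 / (sqrt \<alpha> * n / sqrt 8) \<le> 3 / (n * sqrt \<alpha>)"
      using sn real_sqrt_le_mono[of 8 9] by (simp add: field_simps)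
    also have "1 / c\<^sup>2 \<le> 1 / (n * sqrt \<alpha>)"
    proof -
      have "c\<^sup>2 = c0\<^sup>2 * s\<^sup>2 * W / L\<^sup>2" by (simp add: c_def power_mult_distrib power_divide)
      moreover have "L\<^sup>2 * (n * sqrt \<alpha>) \<le> W * (c0\<^sup>2 * s\<^sup>2)" using Wlarge c0 s by (simp add: pos_divide_le_eq)
      ultimately have "n * sqrt \<alpha> \<le> c\<^sup>2" using L by (simp add: pos_le_divide_eq ac_simps)
      then show ?thesis using sn c by (intro divide_left_mono) auto
    qed
    finally show ?thesis by (simp add: q add_divide_distrib[symmetric])
  qed
  have single: "emeasure \<Omega> (near_kernel (l * W) (grid W s z) e r)
      \<le> ennreal (exp (W * C1\<^sup>2 / 2) * q powr (W / 4) * q ^ card (supp N z))"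
    if z: "z \<in> spread_net l s n L \<beta>" for z e
  proof -
    let ?v = "grid W s z"
    define J where "J = visible l s n L z"
    define R where "R = {i \<in> {l * W..<2 * p * W}. card (J \<inter> {i..<i + 2 * W}) \<ge> \<alpha> * W}"
    have J: "J \<subseteq> {l * W..<2 * p * W}" by (auto simp: J_def visible_def N_def)
    have cR: "card R \<ge> card J + real W / 2"
      unfolding R_def by (rule many_rows_see_spread_set[OF W l J \<alpha>0 _ \<beta>(2)])
        (use z p \<alpha> in \<open>auto simp: J_def spread_net_def\<close>)
    have "emeasure \<Omega> (near_kernel (l * W) ?v e r) \<le> ennreal (exp (W * r\<^sup>2 / (2 * s\<^sup>2)) * q ^ card R)"
    proof (rule near_kernel_prob[where b = "L / sqrt W" and c = c and s = "\<alpha> * n\<^sup>2 / 16"])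
      show "R \<subseteq> {l * W..<N}" by (auto simp: R_def N_def)
      show "c * (L / sqrt W) \<le> c0 * s" using W0 L by (simp add: c_def)
      fix i assume i: "i \<in> R"
      show "\<exists>V\<subseteq>{i..<N}. (\<forall>j\<in>V. j < i + 2 * W \<and> \<bar>?v j\<bar> \<le> L / sqrt W) \<and> 16 * s\<^sup>2 * (\<alpha> * n\<^sup>2 / 16) \<le> (\<Sum>j\<in>V. (?v j)\<^sup>2)"
      proof (intro exI[of _ "J \<inter> {i..<i + 2 * W}"] conjI ballI)
        show "J \<inter> {i..<i + 2 * W} \<subseteq> {i..<N}" using J by (auto simp: N_def)
        fix j assume j: "j \<in> J \<inter> {i..<i + 2 * W}"
        show "j < i + 2 * W" using j by auto
        show "\<bar>?v j\<bar> \<le> L / sqrt W"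
          using j s W0 by (auto simp: J_def visible_def grid_def abs_mult divide_right_mono)
      next
        have "16 * s\<^sup>2 * (\<alpha> * n\<^sup>2 / 16) = (\<alpha> * W) * ((s * n)\<^sup>2 / W)"
          using W0 by (simp add: power_mult_distrib)
        also have "\<dots> \<le> card (J \<inter> {i..<i + 2 * W}) * ((s * n)\<^sup>2 / W)"
          using i by (intro mult_right_mono) (auto simp: R_def)
        also have "\<dots> = (\<Sum>j\<in>J \<inter> {i..<i + 2 * W}. (s * n)\<^sup>2 / W)" by simp
        also have "\<dots> \<le> (\<Sum>j\<in>J \<inter> {i..<i + 2 * W}. (?v j)\<^sup>2)"
        proof (rule sum_mono)
          fix j assume "j \<in> J \<inter> {i..<i + 2 * W}"
          then have "int n \<le> \<bar>z j\<bar>" by (auto simp: J_def visible_def)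
          then have "real n \<le> \<bar>real_of_int (z j)\<bar>" by linarith
          then have "(real n)\<^sup>2 \<le> (real_of_int (z j))\<^sup>2" by (simp add: abs_le_square_iff[symmetric])
          from mult_left_mono[OF this, of "s\<^sup>2"]
          have "(s * n)\<^sup>2 \<le> (s * z j)\<^sup>2" by (simp add: power_mult_distrib)
          then show "(s * n)\<^sup>2 / W \<le> (?v j)\<^sup>2"
            using W0 by (simp add: grid_def power_divide divide_right_mono)
        qed
        finally show "16 * s\<^sup>2 * (\<alpha> * n\<^sup>2 / 16) \<le> (\<Sum>j\<in>J \<inter> {i..<i + 2 * W}. (?v j)\<^sup>2)" .
      qed
    qed (use s \<alpha>0 gauss in auto)
    also have "exp (W * r\<^sup>2 / (2 * s\<^sup>2)) = exp (W * C1\<^sup>2 / 2)" using s by (simp add: r power_mult_distrib)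
    also have "exp (W * C1\<^sup>2 / 2) * q ^ card R \<le> exp (W * C1\<^sup>2 / 2) * (q powr (W / 4) * q ^ card (supp N z))"
    proof (rule mult_left_mono)
      have "q ^ card R = q powr (card R)" using q0 by (simp add: powr_realpow)
      also have "\<dots> \<le> q powr (W / 4 + card (supp N z))"
        using q0 q(2) cR z by (intro powr_mono') (auto simp: spread_net_def J_def)
      also have "\<dots> = q powr (W / 4) * q ^ card (supp N z)" using q0 by (simp add: powr_add powr_realpow)
      finally show "q ^ card R \<le> q powr (W / 4) * q ^ card (supp N z)" .
    qed simp
    finally show ?thesis by (simp add: mult.assoc ennreal_leI)
  qed
  have fin: "finite (spread_net l s n L \<beta>)"
    by (rule finite_subset[of _ "int_ball N (sqrt (2 * p) * W / s)"]) (auto simp: spread_net_def)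
  have sub: "spread_net l s n L \<beta> \<subseteq> int_ball N (sqrt (2 * p) * W / s)" by (auto simp: spread_net_def)
  have y0: "0 \<le> exp (W * C1\<^sup>2 / 2) * q powr (W / 4)" by simp
  \<comment> \<open>Here \<open>q\<close> is the weight \<open>x\<close> of a coordinate and
    \<open>s\<close> is the exponential weight \<open>\<kappa>\<close>, whence
    \<open>2 * q / s\<close> below.\<close>
  note net = net_event_prob[OF fin q0 single y0 sub s, where m = m]
  show "net_event (l * W) s r m (spread_net l s n L \<beta>) \<in> sets \<Omega>" by (rule net(1))
  have 1: "exp (W * C1\<^sup>2 / 2) = exp (C1\<^sup>2 / 2) ^ W" "q powr (W / 4) = (q powr (1 / 4)) ^ W"
    "exp (s * (sqrt (2 * p) * W / s)) = exp (sqrt (2 * p)) ^ W"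
    using q0 s by (simp_all add: exp_of_nat_mult[symmetric] powr_powr powr_realpow[symmetric] ac_simps)
  have 2: "(1 + 2 * q / s) ^ N = ((1 + 2 * q / s) ^ (2 * p)) ^ W" by (simp only: N_def power_mult)
  show "emeasure \<Omega> (net_event (l * W) s r m (spread_net l s n L \<beta>)) \<le>
      ennreal ((2 * real m + 1) * (exp (C1\<^sup>2 / 2) * q powr (1 / 4) * (exp (sqrt (2 * p)) * (1 + 2 * q / s) ^ (2 * p))) ^ W)"
    using net(2) unfolding 1 2 power_mult_distrib by blast
qed

end

subsection \<open>Absence of approximate eigenvectors\<close>

lemma card_le_of_large_entries:
  fixes u :: "nat \<Rightarrow> real" and b c w :: real
  assumes fin: "finite K" and c: "c > 0" and large: "\<And>j. j \<in> K \<Longrightarrow> c \<le> sqrt w * \<bar>u j\<bar>"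
    and u: "(\<Sum>j\<in>K. (u j)\<^sup>2) \<le> b" and w: "w > 0"
  shows "real (card K) \<le> b * w / c\<^sup>2"
proof -
  have "real (card K) * c\<^sup>2 = (\<Sum>j\<in>K. c\<^sup>2)" by simp
  also have "\<dots> \<le> (\<Sum>j\<in>K. w * (u j)\<^sup>2)"
  proof (rule sum_mono)
    fix j assume "j \<in> K"
    from power_mono[OF large[OF this], of 2] show "c\<^sup>2 \<le> w * (u j)\<^sup>2"
      using c w by (simp add: power_mult_distrib)
  qed
  also have "\<dots> \<le> w * b" using u w by (simp add: sum_distrib_left[symmetric])
  finally show ?thesis using c by (simp add: pos_le_divide_eq mult.commute)
qed

lemma supp_grid_coord:
  assumes s: "s > 0"
  shows "supp N (grid_coord N W s u) = {j \<in> {..<N}. s \<le> sqrt (real W) * \<bar>u j\<bar>}"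
    and "j < N \<Longrightarrow> int n \<le> \<bar>grid_coord N W s u j\<bar> \<longleftrightarrow> n * s \<le> sqrt (real W) * \<bar>u j\<bar>"
proof -
  have *: "int n \<le> \<bar>grid_coord N W s u j\<bar> \<longleftrightarrow> n * s \<le> sqrt (real W) * \<bar>u j\<bar>" if "j < N" for j n
    using that s by (simp add: grid_coord_def nat_le_abs_trunc_iff abs_mult pos_le_divide_eq)
  show "supp N (grid_coord N W s u) = {j \<in> {..<N}. s \<le> sqrt (real W) * \<bar>u j\<bar>}"
  proof -
    have "z \<noteq> 0 \<longleftrightarrow> int 1 \<le> \<bar>z\<bar>" for z :: int by auto
    then show ?thesis unfolding supp_def using *[of _ 1] by auto
  qed
  show "j < N \<Longrightarrow> int n \<le> \<bar>grid_coord N W s u j\<bar> \<longleftrightarrow> n * s \<le> sqrt (real W) * \<bar>u j\<bar>" by (rule *)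
qed

context band_law
begin

lemma N_eq: "N = 2 * p * W" by (simp add: N_def)

text \<open>The radius collects, in units of \<open>s\<close>: 1 for the residual,
  \<open>K0 * sqrt (2 * p)\<close> for the matrix applied to the rounding error,
  \<open>(K0 + 1) * sqrt (2 * p)\<close> for \<open>e\<close> times that error, and 1 for rounding
  \<open>e\<close>. The operator norm forces \<open>\<bar>e\<bar> \<le> K0 + 1\<close>, so finitely
  many multiples of \<open>s\<close> suffice.\<close>

lemma near_kernel_of_approx_eigenvector:
  fixes u :: "nat \<Rightarrow> real" and K0 e \<mu> s :: real
  assumes h: "h \<in> space \<Omega>" and K0: "K0 \<ge> 0" 
    and op: "\<And>w. L2_set (sym_row N h w) {..<N} \<le> K0 * L2_set w {..<N}"
    and u1: "L2_set u {..<N} = 1" and ua: "\<And>j. j < a \<Longrightarrow> u j = 0"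
    and res: "L2_set (\<lambda>i. sym_row N h u i - e * u i) {a..<N} \<le> \<mu>"
    and s: "s > 0" and \<mu>: "\<mu> \<le> s" "\<mu> \<le> 1"
    and m: "real m \<ge> (K0 + 1) / s"
  shows "\<exists>k\<in>{- int m..int m}. h \<in> near_kernel a (grid W s (grid_coord N W s u)) (s * real_of_int k)
    ((2 + (2 * K0 + 1) * sqrt (2 * p)) * s)"
proof -
  let ?na = "\<lambda>f. L2_set f {a..<N}" and ?n = "\<lambda>f. L2_set f {..<N}"
  define v where "v = grid W s (grid_coord N W s u)"
  define k where "k = trunc (e / s)"
  have sub: "?na f \<le> ?n f" for f :: "nat \<Rightarrow> real"
    unfolding L2_set_def by (intro real_sqrt_le_mono sum_mono2) auto
  have scale: "?na (\<lambda>i. c * f i) = \<bar>c\<bar> * ?na f" for c and f :: "nat \<Rightarrow> real"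
    by (subst L2_set_right_distrib) (auto simp: L2_set_def power_mult_distrib)
  have neg: "?na (\<lambda>i. - f i) = ?na f" for f :: "nat \<Rightarrow> real" by (simp add: L2_set_def)
  have tri: "?na (\<lambda>i. f i + g i) \<le> ?na f + ?na g" for f g :: "nat \<Rightarrow> real" by (rule L2_set_triangle_ineq)
  have ua1: "?na u = 1"
  proof -
    have "(\<Sum>i\<in>{a..<N}. (u i)\<^sup>2) = (\<Sum>i<N. (u i)\<^sup>2)"
      by (rule sum.mono_neutral_left) (use ua in \<open>auto simp: not_le\<close>)
    then show ?thesis using u1 by (simp add: L2_set_def)
  qed
  have e: "\<bar>e\<bar> \<le> K0 + 1"
  proof -
    have "\<bar>e\<bar> = ?na (\<lambda>i. e * u i)" using ua1 by (simp add: scale)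
    also have "(\<lambda>i. e * u i) = (\<lambda>i. sym_row N h u i + - (sym_row N h u i - e * u i))" by simp
    also have "?na \<dots> \<le> ?na (sym_row N h u) + ?na (\<lambda>i. - (sym_row N h u i - e * u i))" by (rule tri)
    also have "\<dots> \<le> K0 + \<mu>" using sub[of "sym_row N h u"] op[of u] res u1 unfolding neg by simp
    finally show ?thesis using \<mu> by simp
  qed
  have "\<bar>real_of_int k\<bar> \<le> \<bar>e / s\<bar>" unfolding k_def by (rule trunc_bounds)
  also have "\<dots> = \<bar>e\<bar> / s" using s by (simp only: abs_divide abs_of_pos)
  also have "\<dots> \<le> (K0 + 1) / s" using e s by (intro divide_right_mono) auto
  also have "\<dots> \<le> m" by (rule m)
  finally have k: "k \<in> {- int m..int m}" by auto
  have ek: "\<bar>e - s * k\<bar> \<le> s"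
  proof -
    have "e - s * k = s * (e / s - k)" using s by (simp add: algebra_simps)
    then have "\<bar>e - s * k\<bar> = s * \<bar>e / s - k\<bar>" using s by (simp add: abs_mult)
    also have "\<dots> \<le> s * 1" unfolding k_def by (intro mult_left_mono trunc_bounds) (use s in auto)
    finally show ?thesis by simp
  qed
  note approx = grid_coord_approx_L2[OF N_eq W s, of u]
  have d: "?n (\<lambda>j. v j - u j) \<le> s * sqrt (2 * p)"
    using approx(1) unfolding v_def by (simp add: L2_set_def power2_commute)
  have "sym_row N h v i - s * k * v i
    = (sym_row N h u i - e * u i) + (sym_row N h (\<lambda>j. v j - u j) i + (- e * (v i - u i) + (e - s * k) * v i))" for i
    by (simp add: sym_row_def algebra_simps sum_subtractf)
  then have "?na (\<lambda>i. sym_row N h v i - s * k * v i)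
    = ?na (\<lambda>i. (sym_row N h u i - e * u i) + (sym_row N h (\<lambda>j. v j - u j) i + (- e * (v i - u i) + (e - s * k) * v i)))"
    by presburger
  also have "\<dots> \<le> ?na (\<lambda>i. sym_row N h u i - e * u i) + (?na (sym_row N h (\<lambda>j. v j - u j)) +
     (?na (\<lambda>i. - e * (v i - u i)) + ?na (\<lambda>i. (e - s * k) * v i)))"
    by (intro order_trans[OF tri] add_left_mono) (rule order_refl)
  also have "\<dots> \<le> s + (K0 * (s * sqrt (2 * p)) + ((K0 + 1) * (s * sqrt (2 * p)) + s * 1))"
  proof (intro add_mono)
    show "?na (\<lambda>i. sym_row N h u i - e * u i) \<le> s" using res \<mu> by linarith
    have "?na (sym_row N h (\<lambda>j. v j - u j)) \<le> K0 * ?n (\<lambda>j. v j - u j)" using sub op order_trans by blast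
    also have "\<dots> \<le> K0 * (s * sqrt (2 * p))" by (intro mult_left_mono d K0)
    finally show "?na (sym_row N h (\<lambda>j. v j - u j)) \<le> K0 * (s * sqrt (2 * p))" .
    show "?na (\<lambda>i. - e * (v i - u i)) \<le> (K0 + 1) * (s * sqrt (2 * p))"
      unfolding scale using e d sub[of "\<lambda>j. v j - u j"] K0 by (intro mult_mono) auto
    show "?na (\<lambda>i. (e - s * k) * v i) \<le> s * 1"
      unfolding scale using ek sub[of v] approx(2) u1 s by (intro mult_mono) (auto simp: v_def)
  qed
  also have "\<dots> = (2 + (2 * K0 + 1) * sqrt (2 * p)) * s" by (simp add: algebra_simps)
  finally have "?na (\<lambda>i. sym_row N h v i - s * k * v i) \<le> (2 + (2 * K0 + 1) * sqrt (2 * p)) * s" .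
  then have "(?na (\<lambda>i. sym_row N h v i - s * k * v i))\<^sup>2 \<le> ((2 + (2 * K0 + 1) * sqrt (2 * p)) * s)\<^sup>2"
    by (intro power_mono) auto
  then have "(\<Sum>i\<in>{a..<N}. (sym_row N h v i - s * k * v i)\<^sup>2) \<le> ((2 + (2 * K0 + 1) * sqrt (2 * p)) * s)\<^sup>2"
    by (simp add: L2_set_def sum_nonneg)
  then show ?thesis using h k unfolding near_kernel_def v_def by blast
qed

text \<open>Beyond block \<open>l\<close> the norm of \<open>u\<close> is at least 3/4; rounding
  costs 1/4, so mass 1/4 remains, shared by fewer than \<open>2 * p\<close> blocks.\<close>

lemma grid_coord_sparse:
  fixes u :: "nat \<Rightarrow> real" and s \<epsilon> :: real
  assumes u1: "L2_set u {..<N} = 1" and ua: "\<And>j. j < l * W \<Longrightarrow> u j = 0"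
    and first: "(\<Sum>j\<in>{l * W..<(l + 1) * W}. (u j)\<^sup>2) \<le> 1 / 16" and l: "l + 1 < 2 * p"
    and s: "s > 0" "s * sqrt (2 * p) \<le> 1 / 4"
    and few: "real (card {j \<in> {..<N}. s \<le> sqrt (real W) * \<bar>u j\<bar>}) \<le> \<epsilon> * W"
  shows "grid_coord N W s u \<in> sparse_net l s \<epsilon>"
proof -
  define v where "v = grid W s (grid_coord N W s u)"
  note approx = grid_coord_approx_L2[OF N_eq W s(1), of u, folded v_def]
  let ?K = "{(l + 1) * W..<N}"
  have le: "(l + 1) * W \<le> N" unfolding N_eq using l by (intro mult_le_mono1) auto
  have "1 = (\<Sum>j<N. (u j)\<^sup>2)" using u1 by (simp add: L2_set_def)
  also have "\<dots> = (\<Sum>j\<in>{l * W..<N}. (u j)\<^sup>2)"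
    by (rule sum.mono_neutral_right) (use ua in \<open>auto simp: not_le\<close>)
  also have "\<dots> = (\<Sum>j\<in>{l * W..<(l + 1) * W}. (u j)\<^sup>2) + (\<Sum>j\<in>?K. (u j)\<^sup>2)"
    by (rule sum.atLeastLessThan_concat[symmetric]) (use le in auto)
  finally have "(3 / 4)\<^sup>2 \<le> (\<Sum>j\<in>?K. (u j)\<^sup>2)" using first by (simp add: power2_eq_square)
  then have "3 / 4 \<le> L2_set u ?K" unfolding L2_set_def by (rule real_le_rsqrt)
  also have "\<dots> = L2_set (\<lambda>j. (u j - v j) + v j) ?K" by simp
  also have "\<dots> \<le> L2_set (\<lambda>j. u j - v j) ?K + L2_set v ?K" by (rule L2_set_triangle_ineq)
  also have "L2_set (\<lambda>j. u j - v j) ?K \<le> L2_set (\<lambda>j. u j - v j) {..<N}"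
    unfolding L2_set_def by (intro real_sqrt_le_mono sum_mono2) auto
  finally have "1 / 2 \<le> L2_set v ?K" using approx(1) s(2) by linarith
  then have "(1 / 2)\<^sup>2 \<le> (L2_set v ?K)\<^sup>2" by (intro power_mono) auto
  then have quarter: "1 / 4 \<le> (\<Sum>j\<in>?K. (v j)\<^sup>2)" by (simp add: L2_set_def sum_nonneg power2_eq_square)
  have blocks: "(\<Sum>j\<in>{(l + 1) * W..<n * W}. (v j)\<^sup>2) = (\<Sum>k\<in>{l + 1..<n}. \<Sum>j\<in>{k * W..<(k + 1) * W}. (v j)\<^sup>2)"
    if "l + 1 \<le> n" for n
    using that
  proof (induction n rule: dec_induct)
    case (step n)
    have "(\<Sum>j\<in>{(l + 1) * W..<Suc n * W}. (v j)\<^sup>2) = (\<Sum>j\<in>{(l + 1) * W..<n * W}. (v j)\<^sup>2) + (\<Sum>j\<in>{n * W..<Suc n * W}. (v j)\<^sup>2)"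
      by (rule sum.atLeastLessThan_concat[symmetric]) (use step mult_le_mono1[of "l + 1" n W] in auto)
    then show ?case using step by simp
  qed simp
  have "\<exists>k. l < k \<and> k < 2 * p \<and> (\<Sum>j\<in>{k * W..<(k + 1) * W}. (v j)\<^sup>2) \<ge> 1 / (8 * p)"
  proof (rule ccontr)
    assume neg: "\<not> ?thesis"
    have "1 / 4 \<le> (\<Sum>k\<in>{l + 1..<2 * p}. \<Sum>j\<in>{k * W..<(k + 1) * W}. (v j)\<^sup>2)"
      using quarter blocks[of "2 * p"] l by (simp add: N_eq)
    also have "\<dots> \<le> (\<Sum>k\<in>{l + 1..<2 * p}. 1 / (8 * p))"
      using neg by (intro sum_mono) (auto simp: not_le less_imp_le)
    also have "\<dots> = real (2 * p - (l + 1)) * (1 / (8 * p))" by simp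
    also have "\<dots> < (2 * p) * (1 / (8 * p))" using l p by (intro mult_strict_right_mono) auto
    also have "\<dots> = 1 / 4" using p by simp
    finally show False by simp
  qed
  moreover have "\<bar>v j\<bar> \<le> 1" if "j < N" for j
    using abs_le_L2_set[of "{..<N}" j v] approx(2) u1 that by simp
  moreover have "grid_coord N W s u \<in> int_ball N (sqrt (2 * p) * W / s)"
    by (rule grid_coord_in_int_ball[OF N_eq W s(1)]) (use u1 in simp)
  moreover have "real (card (supp N (grid_coord N W s u))) \<le> \<epsilon> * W"
    unfolding supp_grid_coord(1)[OF s(1)] by (rule few)
  ultimately show ?thesis unfolding sparse_net_def v_def by blast
qed

text \<open>With this \<open>L\<close> at most \<open>2 * \<beta> * W\<close> coordinates exceed
  \<open>L / sqrt W\<close>. Without them, \<open>2 * \<beta> * W\<close> of the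
  \<open>4 * \<beta> * W\<close> large coordinates remain visible, and the invisible part of the
  support is at most \<open>2 * \<beta> * W + W / 8 \<le> W / 4\<close>. On block \<open>l\<close>
  the mass leaves room for only \<open>\<beta> * W\<close> coordinates of size
  \<open>n * s / sqrt W\<close>.\<close>

lemma grid_coord_spread:
  fixes u :: "nat \<Rightarrow> real" and s \<beta> L :: real
  assumes u1: "L2_set u {..<N} = 1" and ua: "\<And>j. j < l * W \<Longrightarrow> u j = 0"
    and first: "(\<Sum>j\<in>{l * W..<(l + 1) * W}. (u j)\<^sup>2) \<le> \<beta> * (n * s)\<^sup>2"
    and s: "s > 0" and n: "n \<ge> 1" and \<beta>: "0 < \<beta>" "\<beta> \<le> 1 / 16"
    and many: "real (card {j \<in> {..<N}. n * s \<le> sqrt (real W) * \<bar>u j\<bar>}) \<ge> 4 * \<beta> * W"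
    and gap: "real (card {j \<in> {..<N}. s \<le> sqrt (real W) * \<bar>u j\<bar> \<and> sqrt (real W) * \<bar>u j\<bar> < n * s}) \<le> real W / 8"
    and L: "L = 1 / sqrt (2 * \<beta>)"
  shows "grid_coord N W s u \<in> spread_net l s n L \<beta>"
proof -
  let ?z = "grid_coord N W s u"
  define J where "J = visible l s n L ?z"
  define Q where "Q = {j \<in> {..<N}. L < sqrt (real W) * \<bar>u j\<bar>}"
  define T where "T = {j \<in> {..<N}. n * s \<le> sqrt (real W) * \<bar>u j\<bar>}"
  define G where "G = {j \<in> {..<N}. s \<le> sqrt (real W) * \<bar>u j\<bar> \<and> sqrt (real W) * \<bar>u j\<bar> < n * s}"
  have W0: "real W > 0" using W by simp
  have ns: "real n * s > 0" using n s by simp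
  have L0: "L > 0" "L\<^sup>2 = 1 / (2 * \<beta>)" using \<beta> by (auto simp: L power_divide)
  have pos: "l * W \<le> j" if "c \<le> sqrt (real W) * \<bar>u j\<bar>" "c > 0" for c j
    using ua[of j] that by (cases "j < l * W") auto
  have sum1: "(\<Sum>j\<in>K. (u j)\<^sup>2) \<le> 1" if "K \<subseteq> {..<N}" for K
  proof -
    have "(\<Sum>j\<in>K. (u j)\<^sup>2) \<le> (\<Sum>j<N. (u j)\<^sup>2)" using that by (intro sum_mono2) auto
    then show ?thesis using u1 by (simp add: L2_set_def)
  qed
  have cQ: "real (card Q) \<le> 2 * \<beta> * W"
  proof -
    have "real (card Q) \<le> 1 * real W / L\<^sup>2"
      by (rule card_le_of_large_entries[where u = u]) (use L0 W0 in \<open>auto simp: Q_def intro!: sum1\<close>)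
    then show ?thesis using \<beta> L0 by (simp add: mult.commute)
  qed
  have zL: "s * \<bar>real_of_int (?z j)\<bar> \<le> sqrt (real W) * \<bar>u j\<bar>" if "j < N" for j
  proof -
    have "\<bar>real_of_int (?z j)\<bar> \<le> \<bar>sqrt (real W) * u j / s\<bar>"
      using that trunc_bounds(2)[of "sqrt (real W) * u j / s"] by (simp add: grid_coord_def)
    then show ?thesis using s by (simp add: abs_mult pos_le_divide_eq mult.commute)
  qed
  have TQ: "T - Q \<subseteq> J"
  proof
    fix j assume j: "j \<in> T - Q"
    then have "j < N" "n * s \<le> sqrt (real W) * \<bar>u j\<bar>" "sqrt (real W) * \<bar>u j\<bar> \<le> L"
      by (auto simp: T_def Q_def)
    moreover from this have "l * W \<le> j" using pos ns by blast
    ultimately show "j \<in> J" unfolding J_def visible_def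
      using supp_grid_coord(2)[OF s] zL[of j] by auto
  qed
  have JT: "J \<subseteq> T" unfolding J_def visible_def T_def using supp_grid_coord(2)[OF s] by auto
  have fin: "finite J" "finite T" "finite Q" "finite G" by (auto simp: J_def visible_def T_def Q_def G_def)
  have "card T \<le> card (J \<union> Q)" using TQ fin by (intro card_mono) auto
  also have "\<dots> \<le> card J + card Q" by (rule card_Un_le)
  finally have cT: "real (card T) \<le> card J + card Q" by linarith
  have "supp N ?z \<subseteq> T \<union> G" unfolding supp_grid_coord(1)[OF s] T_def G_def by auto
  then have "card (supp N ?z) \<le> card (T \<union> G)" using fin by (intro card_mono) auto
  also have "\<dots> \<le> card T + card G" by (rule card_Un_le)
  finally have cS: "real (card (supp N ?z)) \<le> card T + card G" by linarith
  have "2 * \<beta> * W \<le> 1 / 8 * W" using \<beta> by (intro mult_right_mono) auto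
  then have 1: "real (card (supp N ?z)) \<le> card J + real W / 4"
    using cS cT cQ gap unfolding G_def[symmetric] by linarith
  have 2: "real (card J) \<ge> 2 * \<beta> * W" using cT cQ many unfolding T_def[symmetric] by linarith
  have 3: "real (card (J \<inter> {l * W..<(l + 1) * W})) \<le> \<beta> * W"
  proof -
    have "real (card (J \<inter> {l * W..<(l + 1) * W})) \<le> \<beta> * (n * s)\<^sup>2 * W / (n * s)\<^sup>2"
    proof (rule card_le_of_large_entries[where u = u])
      have "(\<Sum>j\<in>J \<inter> {l * W..<(l + 1) * W}. (u j)\<^sup>2) \<le> (\<Sum>j\<in>{l * W..<(l + 1) * W}. (u j)\<^sup>2)"
        by (intro sum_mono2) auto
      then show "(\<Sum>j\<in>J \<inter> {l * W..<(l + 1) * W}. (u j)\<^sup>2) \<le> \<beta> * (n * s)\<^sup>2" using first by linarith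
    qed (use fin JT ns W0 in \<open>auto simp: T_def\<close>)
    then show ?thesis using ns by (auto split: if_splits)
  qed
  have "?z \<in> int_ball N (sqrt (2 * p) * W / s)"
    by (rule grid_coord_in_int_ball[OF N_eq W s]) (use u1 in simp)
  then show ?thesis unfolding spread_net_def J_def[symmetric] using 1 2 3 by (simp add: J_def)
qed

end

section \<open>Choice of the scales and combination of the nets\<close>

lemma exists_small_parameter:
  fixes f :: "real \<Rightarrow> real"
  assumes "isCont f 0" "f 0 < c" "b > 0"
  shows "\<exists>x. 0 < x \<and> x \<le> b \<and> f x < c"
proof -
  have "eventually (\<lambda>x. f x < c) (at_right 0)"
    using order_tendstoD(2)[OF isContD[OF assms(1)] assms(2)] unfolding eventually_at_split by blast
  moreover have "eventually (\<lambda>x. x \<in> {0<..<b}) (at_right 0)"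
    using assms(3) by (intro eventually_at_rightI[of 0 b]) auto
  ultimately have "eventually (\<lambda>x. f x < c \<and> x \<in> {0<..<b}) (at_right 0)" by eventually_elim auto
  then obtain x where "f x < c \<and> x \<in> {0<..<b}"
    using eventually_happens'[OF trivial_limit_at_right_real] by blast
  then show ?thesis by (intro exI[of _ x]) auto
qed

text \<open>With \<open>s = \<tau> / n\<close> the base of the power \<open>d\<close> equals
  \<open>1 + 8 / (sqrt \<alpha> * \<tau>)\<close> whatever \<open>n\<close> is, so the factor
  \<open>powr (1 / 4)\<close> drives the whole to 0.\<close>

lemma exists_spread_scale:
  fixes \<alpha> \<tau> a b :: real and d :: nat
  assumes \<alpha>: "\<alpha> > 0" and \<tau>: "\<tau> > 0"
  shows "\<exists>n\<ge>1. 4 / (real n * sqrt \<alpha>) \<le> 1 \<and>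
    a * (4 / (real n * sqrt \<alpha>)) powr (1 / 4) * (b * (1 + 2 * (4 / (real n * sqrt \<alpha>)) / (\<tau> / real n)) ^ d) \<le> 1 / 2"
proof -
  let ?q = "\<lambda>n::nat. 4 / (real n * sqrt \<alpha>)"
  let ?B = "b * (1 + 8 / (sqrt \<alpha> * \<tau>)) ^ d"
  have s\<alpha>: "sqrt \<alpha> > 0" using \<alpha> by simp
  have "filterlim (\<lambda>n. sqrt \<alpha> * real n) at_top sequentially"
    by (rule filterlim_tendsto_pos_mult_at_top[OF tendsto_const s\<alpha> filterlim_real_sequentially])
  then have q: "?q \<longlonglongrightarrow> 0"
    by (intro tendsto_divide_0[OF tendsto_const] filterlim_at_top_imp_at_infinity) (simp add: mult.commute)
  then have "(\<lambda>n. ?q n powr (1 / 4)) \<longlonglongrightarrow> 0 powr (1 / 4)"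
    by (intro tendsto_powr2) (use s\<alpha> in auto)
  then have "(\<lambda>n. a * ?q n powr (1 / 4) * ?B) \<longlonglongrightarrow> a * 0 * ?B"
    by (intro tendsto_intros) simp
  then have "eventually (\<lambda>n. a * ?q n powr (1 / 4) * ?B < 1 / 2) sequentially"
    by (rule order_tendstoD) simp
  moreover have "eventually (\<lambda>n. ?q n < 1) sequentially" by (rule order_tendstoD[OF q]) simp
  ultimately have "eventually (\<lambda>n. a * ?q n powr (1 / 4) * ?B < 1 / 2 \<and> ?q n < 1 \<and> n \<ge> 1) sequentially"
    using eventually_ge_at_top[of 1] by eventually_elim auto
  then obtain n where n: "a * ?q n powr (1 / 4) * ?B < 1 / 2" "?q n < 1" "n \<ge> 1"
    using eventually_happens'[OF sequentially_bot] by blast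
  have "2 * ?q n / (\<tau> / real n) = 8 / (sqrt \<alpha> * \<tau>)" using n(3) s\<alpha> \<tau> by (simp add: field_simps)
  then show ?thesis using n by (intro exI[of _ n]) auto
qed

context band_law
begin

text \<open>The pigeonhole selects a scale that depends on \<open>u\<close>. As the scales decrease,
  \<open>\<mu> \<le> sqrt \<beta> * \<tau> (16 * p)\<close> makes the residual and the mass on block
  \<open>l\<close> small enough for each of them.\<close>

lemma no_approx_eigenvector:
  fixes \<eta> \<epsilon> \<beta> L \<mu> K0 C1 :: real and \<tau> :: "nat \<Rightarrow> real" and n :: "nat \<Rightarrow> nat" and mm :: "real \<Rightarrow> nat"
  defines "C1 \<equiv> 2 + (2 * K0 + 1) * sqrt (2 * p)"
  assumes h: "h \<in> space \<Omega>" and K0: "K0 \<ge> 0" 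
    and op: "\<And>w. L2_set (sym_row N h w) {..<N} \<le> K0 * L2_set w {..<N}"
    and l: "l + 1 < 2 * p"
    and \<tau>: "\<And>k. \<tau> k > 0" "\<And>k. \<tau> k = n k * \<tau> (Suc k)" and n: "\<And>k. n k \<ge> 1"
    and mm: "\<And>s. s > 0 \<Longrightarrow> real (mm s) \<ge> (K0 + 1) / s"
    and \<tau>0: "\<tau> 0 * sqrt (2 * p) \<le> 1 / 4"
    and \<epsilon>: "4 * \<beta> \<le> \<epsilon>" and \<beta>: "0 < \<beta>" "\<beta> \<le> 1 / 16" and L: "L = 1 / sqrt (2 * \<beta>)"
    and \<mu>: "0 < \<mu>" "\<mu> \<le> 1 / 4" "\<mu> \<le> sqrt \<beta> * \<tau> (16 * p)"
    and notsparse: "h \<notin> net_event (l * W) (\<tau> 0) (C1 * \<tau> 0) (mm (\<tau> 0)) (sparse_net l (\<tau> 0) \<epsilon>)"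
    and notspread: "\<And>k. k < 16 * p \<Longrightarrow> h \<notin> net_event (l * W) (\<tau> (Suc k)) (C1 * \<tau> (Suc k)) (mm (\<tau> (Suc k)))
       (spread_net l (\<tau> (Suc k)) (n k) L \<beta>)"
    and u1: "L2_set u {..<N} = 1" and ua: "\<And>j. j < l * W \<Longrightarrow> u j = 0"
    and first: "(\<Sum>j\<in>{l * W..<(l + 1) * W}. (u j)\<^sup>2) \<le> \<mu>\<^sup>2"
    and res: "L2_set (\<lambda>i. sym_row N h u i - e * u i) {l * W..<N} \<le> \<mu>"
  shows False
proof -
  have anti: "\<tau> (k + i) \<le> \<tau> k" for k i
  proof (induction i)
    case (Suc i)
    have "1 * \<tau> (k + Suc i) \<le> n (k + i) * \<tau> (Suc (k + i))"
      using n[of "k + i"] \<tau>(1)[of "Suc (k + i)"] by (intro mult_mono) auto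
    then show ?case using Suc \<tau>(2)[of "k + i"] by simp
  qed simp
  have last: "\<tau> (16 * p) \<le> \<tau> k" if "k \<le> 16 * p" for k using anti[of k "16 * p - k"] that by simp
  have sb: "sqrt \<beta> \<le> 1" using \<beta> by simp
  have \<mu>\<tau>: "\<mu> \<le> \<tau> k" "\<mu>\<^sup>2 \<le> \<beta> * (\<tau> k)\<^sup>2" if "k \<le> 16 * p" for k
  proof -
    have "sqrt \<beta> * \<tau> (16 * p) \<le> sqrt \<beta> * \<tau> k" using \<beta> last[OF that] by (intro mult_left_mono) auto
    then have *: "\<mu> \<le> sqrt \<beta> * \<tau> k" using \<mu>(3) by linarith
    also have "\<dots> \<le> 1 * \<tau> k" using sb \<tau>(1)[of k] by (intro mult_right_mono) auto
    finally show "\<mu> \<le> \<tau> k" by simp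
    have "\<mu>\<^sup>2 \<le> (sqrt \<beta> * \<tau> k)\<^sup>2" using * \<mu>(1) by (intro power_mono) auto
    then show "\<mu>\<^sup>2 \<le> \<beta> * (\<tau> k)\<^sup>2" using \<beta> by (simp add: power_mult_distrib)
  qed
  have kernel: "\<exists>k'\<in>{- int (mm (\<tau> k))..int (mm (\<tau> k))}. h \<in> near_kernel (l * W) (grid W (\<tau> k) (grid_coord N W (\<tau> k) u))
      (\<tau> k * real_of_int k') (C1 * \<tau> k)" if "k \<le> 16 * p" for k
    unfolding C1_def using \<mu>
    by (intro near_kernel_of_approx_eigenvector[OF h K0 op u1 ua res \<tau>(1) \<mu>\<tau>(1)[OF that] _ mm[OF \<tau>(1)]]) auto
  define G where "G k = {j \<in> {..<N}. \<tau> (Suc k) \<le> sqrt (real W) * \<bar>u j\<bar> \<and> sqrt (real W) * \<bar>u j\<bar> < \<tau> k}" for k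
  have W0: "real W > 0" using W by simp
  show False
  proof (cases "real (card {j \<in> {..<N}. \<tau> 0 \<le> sqrt (real W) * \<bar>u j\<bar>}) \<le> \<epsilon> * W")
    case True
    have "\<mu>\<^sup>2 \<le> (1 / 4)\<^sup>2" using \<mu> by (intro power_mono) auto
    then have "\<mu>\<^sup>2 \<le> 1 / 16" by (simp add: power2_eq_square)
    then have "grid_coord N W (\<tau> 0) u \<in> sparse_net l (\<tau> 0) \<epsilon>"
      using first by (intro grid_coord_sparse[OF u1 ua _ l \<tau>(1) \<tau>0 True]) auto
    then show False using kernel[of 0] notsparse unfolding net_event_def by blast
  next
    case False
    \<comment> \<open>The \<open>16 * p\<close> sets \<open>G k\<close> are disjoint and share
      \<open>2 * p * W\<close> coordinates.\<close>
    have "\<exists>k<16 * p. real (card (G k)) \<le> real W / 8"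
    proof (rule ccontr)
      assume neg: "\<not> ?thesis"
      have disj: "G i \<inter> G j = {}" if "i < j" for i j
      proof -
        have "\<tau> j \<le> \<tau> (Suc i)" using anti[of "Suc i" "j - Suc i"] that by simp
        then show ?thesis by (auto simp: G_def)
      qed
      have "real (2 * p * W) = (\<Sum>k<16 * p. real W / 8)" by simp
      also have "\<dots> < (\<Sum>k<16 * p. real (card (G k)))" using neg p by (intro sum_strict_mono) (auto simp: not_le lessThan_empty_iff)
      also have "\<dots> = real (card (\<Union>k<16 * p. G k))"
      proof -
        have "\<forall>i\<in>{..<16 * p}. \<forall>j\<in>{..<16 * p}. i \<noteq> j \<longrightarrow> G i \<inter> G j = {}"
          using disj by (metis Int_commute linorder_neqE_nat)
        moreover have "\<forall>i\<in>{..<16 * p}. finite (G i)" by (simp add: G_def)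
        ultimately show ?thesis by (simp add: card_UN_disjoint)
      qed
      also have "\<dots> \<le> real (card {..<N})" by (intro of_nat_mono card_mono) (auto simp: G_def)
      finally show False by (simp add: N_eq)
    qed
    then obtain k where k: "k < 16 * p" "real (card (G k)) \<le> real W / 8" by blast
    have "grid_coord N W (\<tau> (Suc k)) u \<in> spread_net l (\<tau> (Suc k)) (n k) L \<beta>"
    proof (rule grid_coord_spread[OF u1 ua _ \<tau>(1) n \<beta> _ _ L])
      show "(\<Sum>j\<in>{l * W..<(l + 1) * W}. (u j)\<^sup>2) \<le> \<beta> * (n k * \<tau> (Suc k))\<^sup>2"
        using first \<mu>\<tau>(2)[of k] k unfolding \<tau>(2)[symmetric] by linarith
      show "real (card {j \<in> {..<N}. \<tau> (Suc k) \<le> sqrt (real W) * \<bar>u j\<bar> \<and> sqrt (real W) * \<bar>u j\<bar> < n k * \<tau> (Suc k)}) \<le> real W / 8"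
        using k(2) unfolding \<tau>(2)[symmetric] G_def .
      \<comment> \<open>Many coordinates above \<open>\<tau> 0\<close> means at least as many above
        the lower threshold \<open>\<tau> k\<close>.\<close>
      have "4 * \<beta> * W \<le> \<epsilon> * W" using \<epsilon> by (intro mult_right_mono) auto
      also have "\<dots> \<le> real (card {j \<in> {..<N}. \<tau> 0 \<le> sqrt (real W) * \<bar>u j\<bar>})" using False by simp
      also have "\<dots> \<le> real (card {j \<in> {..<N}. n k * \<tau> (Suc k) \<le> sqrt (real W) * \<bar>u j\<bar>})"
        using anti[of 0 k] unfolding \<tau>(2)[symmetric] by (intro of_nat_mono card_mono) auto
      finally show "4 * \<beta> * W \<le> real (card {j \<in> {..<N}. n k * \<tau> (Suc k) \<le> sqrt (real W) * \<bar>u j\<bar>})" .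
    qed
    then show False using kernel[of "Suc k"] notspread[OF k(1)] k(1) unfolding net_event_def by fastforce
  qed
qed

end

text \<open>The operator norm bound is kept because the second event needs it once more, for
  \<open>B u\<close>.\<close>

definition good_sample :: "nat \<Rightarrow> nat \<Rightarrow> nat \<Rightarrow> real \<Rightarrow> real \<Rightarrow> (nat \<times> nat \<Rightarrow> real) \<Rightarrow> bool" where
  "good_sample N W l K0 \<mu> h \<longleftrightarrow>
    (\<forall>w. L2_set (sym_row N h w) {..<N} \<le> K0 * L2_set w {..<N}) \<and>
    (\<forall>u e. L2_set u {..<N} = 1 \<longrightarrow> (\<forall>j<l * W. u j = 0) \<longrightarrow> (\<Sum>j\<in>{l * W..<(l + 1) * W}. (u j)\<^sup>2) \<le> \<mu>\<^sup>2 \<longrightarrow>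
      L2_set (\<lambda>i. sym_row N h u i - e * u i) {l * W..<N} > \<mu>)"

text \<open>All constants precede \<open>W\<close>, \<open>P\<close> and \<open>l\<close>. In the
  order \<open>\<eta>\<close>, \<open>\<kappa>\<close>, \<open>x\<close>, \<open>\<epsilon>\<close>,
  each chosen in terms of its predecessors, they bring one factor of \<open>bA\<close> below
  \<open>\<rho>\<close>; these are four factors, hence \<open>\<rho> ^ 4 * q < 1\<close>. Then
  \<open>\<epsilon>\<close> determines \<open>\<beta>\<close>, \<open>\<alpha>\<close> and
  \<open>L\<close>, these determine the scales, and the last scale determines
  \<open>\<mu>\<close>.\<close>

lemma band_law_good_sample:
  fixes \<delta> C :: real and p :: nat
  assumes \<delta>: "\<delta> > 0" and C: "C > 0" and p: "p \<ge> 1"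
  shows "\<exists>K0>0. \<exists>\<mu>>0. \<exists>D\<ge>0. \<exists>r. 0 < r \<and> r < 1 \<and> (\<exists>W0. \<forall>W P l. W \<ge> W0 \<longrightarrow> band_law \<delta> C p W P \<longrightarrow> l + 1 < 2 * p \<longrightarrow>
    (\<exists>Bad\<in>sets (PiM (upper_rows (2 * p * W) (2 * p * W)) P).
      emeasure (PiM (upper_rows (2 * p * W) (2 * p * W)) P) Bad \<le> ennreal (D * r ^ W) \<and>
      (\<forall>h\<in>space (PiM (upper_rows (2 * p * W) (2 * p * W)) P) - Bad. good_sample (2 * p * W) W l K0 \<mu> h)))"
proof -
  define K0 where "K0 = 2 * (2 * (1 + C) / \<delta> + 24 * p + 1)"
  have K0: "K0 > 0" using \<delta> C by (simp add: K0_def add_pos_nonneg)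
  define C1 where "C1 = 2 + (2 * K0 + 1) * sqrt (2 * p)"
  define c0 where "c0 = min 1 (\<delta> * sqrt \<delta> / (8 * C))"
  have c0: "c0 > 0" using \<delta> C by (simp add: c0_def)
  have sp: "sqrt (2 * p) > 0" using p by simp
  define q where "q = (1 + cut_gauss c0 (1 / (128 * p))) / 2"
  have q: "0 < q" "q < 1" "cut_gauss c0 (1 / (128 * p)) \<le> q"
    using cut_gauss_less_1[OF c0, of "1 / (128 * p)"] p by (auto simp: q_def)
  obtain \<rho> where \<rho>: "\<rho> > 1" "\<rho> ^ 4 * q < 1"
  proof -
    have "\<exists>x. 0 < x \<and> x \<le> 1 \<and> (1 + x) ^ 4 * q < 1"
      by (rule exists_small_parameter) (use q in \<open>auto intro!: continuous_intros\<close>)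
    then show ?thesis using that by (metis less_add_same_cancel1)
  qed
  obtain \<eta> where \<eta>: "\<eta> > 0" "\<eta> \<le> 1 / (4 * sqrt (2 * p))" "exp ((C1 * \<eta>)\<^sup>2 / 2) < \<rho>"
    using exists_small_parameter[of "\<lambda>\<eta>. exp ((C1 * \<eta>)\<^sup>2 / 2)" \<rho> "1 / (4 * sqrt (2 * p))"] \<rho> sp
    by (force intro!: continuous_intros)
  have \<eta>4: "\<eta> * sqrt (2 * p) \<le> 1 / 4" using \<eta>(2) sp by (simp add: field_simps)
  obtain \<kappa> where \<kappa>: "\<kappa> > 0" "exp (\<kappa> * sqrt (2 * p) / \<eta>) < \<rho>"
    using exists_small_parameter[of "\<lambda>\<kappa>. exp (\<kappa> * sqrt (2 * p) / \<eta>)" \<rho> 1] \<rho> \<eta>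
    by (force intro!: continuous_intros)
  obtain x where x: "x > 0" "x \<le> 1" "(1 + 2 * x / \<kappa>) ^ (2 * p) < \<rho>"
    using exists_small_parameter[of "\<lambda>x. (1 + 2 * x / \<kappa>) ^ (2 * p)" \<rho> 1] \<rho> \<kappa>
    by (force intro!: continuous_intros)
  obtain \<epsilon> where \<epsilon>: "\<epsilon> > 0" "x powr (- \<epsilon>) < \<rho>"
    using exists_small_parameter[of "\<lambda>\<epsilon>. x powr (- \<epsilon>)" \<rho> 1] \<rho> x
    by (force intro!: continuous_intros)
  define bA where "bA = exp ((C1 * \<eta>)\<^sup>2 / 2) * q * x powr (- \<epsilon>) * (exp (\<kappa> * sqrt (2 * p) / \<eta>) * (1 + 2 * x / \<kappa>) ^ (2 * p))"
  have bA0: "bA \<ge> 0" using q x \<kappa> by (simp add: bA_def)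
  have bA: "bA < 1"
  proof -
    have "bA \<le> \<rho> * q * \<rho> * (\<rho> * \<rho>)"
      unfolding bA_def using \<eta> \<kappa> x \<epsilon> q \<rho> by (intro mult_mono) auto
    also have "\<dots> = \<rho> ^ 4 * q" by (simp add: power4_eq_xxxx)
    finally show ?thesis using \<rho> by simp
  qed
  define \<beta> where "\<beta> = min (1 / 16) (\<epsilon> / 4)"
  have \<beta>: "0 < \<beta>" "\<beta> \<le> 1 / 16" "\<beta> \<le> 1 / 8" "4 * \<beta> \<le> \<epsilon>" using \<epsilon> by (auto simp: \<beta>_def)
  define \<alpha> where "\<alpha> = \<beta> / (2 * p)"
  have \<alpha>: "\<alpha> > 0" using \<beta> p by (simp add: \<alpha>_def)
  define L where "L = 1 / sqrt (2 * \<beta>)"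
  have L: "L > 0" using \<beta> by (simp add: L_def)
  let ?q = "\<lambda>n::nat. 4 / (real n * sqrt \<alpha>)"
  \<comment> \<open>A choice function, because the next ratio depends on the scale already reached;
    iterating it defines all scales.\<close>
  define nn where "nn \<tau> = (SOME n. n \<ge> 1 \<and> ?q n \<le> 1 \<and>
    exp (C1\<^sup>2 / 2) * ?q n powr (1 / 4) * (exp (sqrt (2 * p)) * (1 + 2 * ?q n / (\<tau> / real n)) ^ (2 * p)) \<le> 1 / 2)" for \<tau> :: real
  have nn: "nn \<tau> \<ge> 1 \<and> ?q (nn \<tau>) \<le> 1 \<and>
    exp (C1\<^sup>2 / 2) * ?q (nn \<tau>) powr (1 / 4) * (exp (sqrt (2 * p)) * (1 + 2 * ?q (nn \<tau>) / (\<tau> / real (nn \<tau>))) ^ (2 * p)) \<le> 1 / 2"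
    if "\<tau> > 0" for \<tau>
    using exists_spread_scale[OF \<alpha> that] unfolding nn_def by (rule someI_ex)
  define \<tau> where "\<tau> k = ((\<lambda>t. t / real (nn t)) ^^ k) \<eta>" for k
  define n where "n k = nn (\<tau> k)" for k
  have \<tau>S: "\<tau> (Suc k) = \<tau> k / real (n k)" for k by (simp add: \<tau>_def n_def)
  have \<tau>0: "\<tau> 0 = \<eta>" by (simp add: \<tau>_def)
  have \<tau>: "\<tau> k > 0" for k
  proof (induction k)
    case (Suc k)
    then show ?case using nn[of "\<tau> k"] unfolding \<tau>S n_def by (intro divide_pos_pos) auto
  qed (simp add: \<tau>0 \<eta>)
  have n: "n k \<ge> 1" for k using nn[OF \<tau>] by (simp add: n_def)
  have \<tau>n: "\<tau> k = n k * \<tau> (Suc k)" for k using n[of k] by (simp add: \<tau>S)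
  define mm where "mm s = nat \<lceil>(K0 + 1) / s\<rceil>" for s :: real
  have mm: "real (mm s) \<ge> (K0 + 1) / s" for s unfolding mm_def by (rule real_nat_ceiling_ge)
  define \<mu> where "\<mu> = min (1 / 4) (sqrt \<beta> * \<tau> (16 * p))"
  have \<mu>: "0 < \<mu>" "\<mu> \<le> 1 / 4" "\<mu> \<le> sqrt \<beta> * \<tau> (16 * p)" using \<beta> \<tau> by (auto simp: \<mu>_def)
  define D where "D = 1 + ((2 * real (mm (\<tau> 0)) + 1) + (\<Sum>k<16 * p. 2 * real (mm (\<tau> (Suc k))) + 1))"
  define r where "r = max (exp (- 1)) (max bA (1 / 2))"
  have r: "0 < r" "r < 1" "exp (- 1) \<le> r" "bA \<le> r" "1 / 2 \<le> r" using bA by (auto simp: r_def less_max_iff_disj)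
  \<comment> \<open>The size of \<open>W\<close> demanded by \<open>spread_net_prob\<close> at scale
    \<open>k\<close>; the sum over \<open>k\<close> dominates all of these at once.\<close>
  define w where "w k = L\<^sup>2 * (n k * sqrt \<alpha>) / (c0\<^sup>2 * (\<tau> (Suc k))\<^sup>2)" for k
  have w0: "w k \<ge> 0" for k using \<alpha> by (simp add: w_def)
  define W0 where "W0 = nat \<lceil>\<Sum>k<16 * p. w k\<rceil>"
  have main: "\<exists>Bad\<in>sets (PiM (upper_rows (2 * p * W) (2 * p * W)) P).
      emeasure (PiM (upper_rows (2 * p * W) (2 * p * W)) P) Bad \<le> ennreal (D * r ^ W) \<and>
      (\<forall>h\<in>space (PiM (upper_rows (2 * p * W) (2 * p * W)) P) - Bad. good_sample (2 * p * W) W l K0 \<mu> h)"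
    if W: "W \<ge> W0" and law: "band_law \<delta> C p W P" and l: "l + 1 < 2 * p" for W P l
  proof -
    interpret B: band_law \<delta> C p W P "2 * p * W" by (rule law)
    let ?\<Omega> = "PiM (upper_rows (2 * p * W) (2 * p * W)) P"
    have \<Omega>: "B.\<Omega> = ?\<Omega>" by (simp add: B.\<Omega>_def)
    have c0B: "B.c0 = c0" by (simp add: B.c0_def c0_def)
    obtain Bad0 where Bad0: "Bad0 \<in> sets ?\<Omega>" "emeasure ?\<Omega> Bad0 \<le> ennreal (exp (- real W))"
      "\<And>h w. h \<in> space ?\<Omega> - Bad0 \<Longrightarrow> L2_set (sym_row (2 * p * W) h w) {..<2 * p * W} \<le> K0 * L2_set w {..<2 * p * W}"
      using B.opnorm_event unfolding \<Omega> K0_def by blast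
    define Bad1 where "Bad1 = B.net_event (l * W) (\<tau> 0) (C1 * \<tau> 0) (mm (\<tau> 0)) (B.sparse_net l (\<tau> 0) \<epsilon>)"
    define Bad2 where "Bad2 k = B.net_event (l * W) (\<tau> (Suc k)) (C1 * \<tau> (Suc k)) (mm (\<tau> (Suc k))) (B.spread_net l (\<tau> (Suc k)) (n k) L \<beta>)" for k
    have rW: "a ^ W \<le> r ^ W" if "a \<le> r" "0 \<le> a" for a using that by (intro power_mono)
    have e0: "emeasure ?\<Omega> Bad0 \<le> ennreal (r ^ W)"
    proof -
      have "exp (- real W) = exp (- 1) ^ W" by (simp add: exp_of_nat_mult[symmetric])
      then show ?thesis using Bad0(2) rW[OF r(3)] by (metis ennreal_leI exp_ge_zero order_trans)
    qed
    have e1: "Bad1 \<in> sets ?\<Omega>" "emeasure ?\<Omega> Bad1 \<le> ennreal ((2 * real (mm (\<tau> 0)) + 1) * r ^ W)"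
    proof -
      have *: "Bad1 \<in> sets ?\<Omega>" "emeasure ?\<Omega> Bad1 \<le> ennreal ((2 * real (mm (\<tau> 0)) + 1) * bA ^ W)"
        unfolding Bad1_def bA_def \<tau>0 using \<epsilon> B.sparse_net_prob[OF \<eta>(1) _ x(1,2) \<kappa>(1), unfolded c0B, OF _ q(3,1)]
        by (auto simp: \<Omega>)
      show "Bad1 \<in> sets ?\<Omega>" by fact
      show "emeasure ?\<Omega> Bad1 \<le> ennreal ((2 * real (mm (\<tau> 0)) + 1) * r ^ W)"
        by (rule order_trans[OF *(2)]) (intro ennreal_leI mult_left_mono rW r(4) bA0, simp)
    qed
    have e2: "Bad2 k \<in> sets ?\<Omega> \<and> emeasure ?\<Omega> (Bad2 k) \<le> ennreal ((2 * real (mm (\<tau> (Suc k))) + 1) * r ^ W)" if k: "k < 16 * p" for k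
    proof -
      define b where "b = exp (C1\<^sup>2 / 2) * ?q (n k) powr (1 / 4) * (exp (sqrt (2 * p)) * (1 + 2 * ?q (n k) / \<tau> (Suc k)) ^ (2 * p))"
      have b: "b \<le> r" "b \<ge> 0"
        using nn[OF \<tau>[of k]] r(5) \<alpha> \<tau>[of "Suc k"] by (auto simp: b_def \<tau>S n_def)
      have "w k \<le> (\<Sum>k<16 * p. w k)" using k w0 by (intro member_le_sum) auto
      also have "\<dots> \<le> W" using W unfolding W0_def by linarith
      finally have wk: "L\<^sup>2 * (n k * sqrt \<alpha>) / (B.c0\<^sup>2 * (\<tau> (Suc k))\<^sup>2) \<le> W" unfolding w_def c0B .
      have l': "l < 2 * p" using l by simp
      have qk: "?q (n k) \<le> 1" using nn[OF \<tau>[of k]] by (simp add: n_def)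
      note sp = B.spread_net_prob[OF \<tau> l' \<beta>(1,3) n L \<alpha>_def refl qk wk refl, of C1 "mm (\<tau> (Suc k))"]
      have "Bad2 k \<in> sets ?\<Omega>" using sp(1) unfolding Bad2_def \<Omega> .
      moreover have "emeasure ?\<Omega> (Bad2 k) \<le> ennreal ((2 * real (mm (\<tau> (Suc k))) + 1) * b ^ W)"
        using sp(2) unfolding Bad2_def \<Omega> b_def .
      then have "emeasure ?\<Omega> (Bad2 k) \<le> ennreal ((2 * real (mm (\<tau> (Suc k))) + 1) * r ^ W)"
        by (rule order_trans) (intro ennreal_leI mult_left_mono rW b, simp)
      ultimately show ?thesis by blast
    qed
    let ?Bad = "Bad0 \<union> (Bad1 \<union> (\<Union>k<16 * p. Bad2 k))"
    have "emeasure ?\<Omega> ?Bad \<le> emeasure ?\<Omega> Bad0 + (emeasure ?\<Omega> Bad1 + (\<Sum>k<16 * p. emeasure ?\<Omega> (Bad2 k)))"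
      using Bad0 e1 e2
      by (intro order_trans[OF emeasure_subadditive] add_left_mono order_refl emeasure_subadditive_finite sets.Un sets.finite_UN)
        auto
    also have "\<dots> \<le> ennreal (r ^ W) + (ennreal ((2 * real (mm (\<tau> 0)) + 1) * r ^ W) +
       (\<Sum>k<16 * p. ennreal ((2 * real (mm (\<tau> (Suc k))) + 1) * r ^ W)))"
      using e0 e1 e2 by (intro add_mono sum_mono) auto
    also have "\<dots> = ennreal (r ^ W + ((2 * real (mm (\<tau> 0)) + 1) * r ^ W + (\<Sum>k<16 * p. (2 * real (mm (\<tau> (Suc k))) + 1) * r ^ W)))"
    proof -
      have nn0: "0 \<le> (2 * real m + 1) * r ^ W" for m using r by simp
      have "(\<Sum>k<16 * p. ennreal ((2 * real (mm (\<tau> (Suc k))) + 1) * r ^ W)) = ennreal (\<Sum>k<16 * p. (2 * real (mm (\<tau> (Suc k))) + 1) * r ^ W)"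
        by (rule sum_ennreal) (rule nn0)
      moreover have "0 \<le> r ^ W" "0 \<le> (\<Sum>k<16 * p. (2 * real (mm (\<tau> (Suc k))) + 1) * r ^ W)"
        using r by (auto intro!: sum_nonneg nn0)
      ultimately show ?thesis using nn0 by (simp only: ennreal_plus add_nonneg_nonneg)
    qed
    also have "r ^ W + ((2 * real (mm (\<tau> 0)) + 1) * r ^ W + (\<Sum>k<16 * p. (2 * real (mm (\<tau> (Suc k))) + 1) * r ^ W)) = D * r ^ W"
      by (simp only: D_def distrib_right[of _ _ "r ^ W"] sum_distrib_right mult_1)
    finally have "emeasure ?\<Omega> ?Bad \<le> ennreal (D * r ^ W)" .
    moreover have "?Bad \<in> sets ?\<Omega>"
      by (intro sets.Un sets.finite_UN Bad0 e1) (use e2 in auto)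
    moreover have "good_sample (2 * p * W) W l K0 \<mu> h" if h: "h \<in> space ?\<Omega> - ?Bad" for h
      unfolding good_sample_def
    proof (intro conjI allI impI)
      show op: "L2_set (sym_row (2 * p * W) h w) {..<2 * p * W} \<le> K0 * L2_set w {..<2 * p * W}" for w
        using Bad0(3) h by blast
      fix u e
      assume u: "L2_set u {..<2 * p * W} = 1" "\<forall>j<l * W. u j = 0" "(\<Sum>j\<in>{l * W..<(l + 1) * W}. (u j)\<^sup>2) \<le> \<mu>\<^sup>2"
      show "L2_set (\<lambda>i. sym_row (2 * p * W) h u i - e * u i) {l * W..<2 * p * W} > \<mu>"
      proof (rule ccontr)
        assume neg: "\<not> ?thesis"
        show False
        proof (rule B.no_approx_eigenvector[OF _ _ op l \<tau> \<tau>n n mm _ \<beta>(4,1,2) L_def \<mu> _ _ u(1) _ u(3)])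
          show "h \<in> space B.\<Omega>" using h by (simp add: \<Omega>)
          show "h \<notin> B.net_event (l * W) (\<tau> 0) ((2 + (2 * K0 + 1) * sqrt (real (2 * p))) * \<tau> 0) (mm (\<tau> 0)) (B.sparse_net l (\<tau> 0) \<epsilon>)"
            using h by (simp add: Bad1_def C1_def)
          show "h \<notin> B.net_event (l * W) (\<tau> (Suc k)) ((2 + (2 * K0 + 1) * sqrt (real (2 * p))) * \<tau> (Suc k)) (mm (\<tau> (Suc k))) (B.spread_net l (\<tau> (Suc k)) (n k) L \<beta>)"
            if "k < 16 * p" for k
            using h that by (simp add: Bad2_def C1_def)
          show "L2_set (\<lambda>i. sym_row (2 * p * W) h u i - e * u i) {l * W..<2 * p * W} \<le> \<mu>" using neg by simp
        qed (use K0 \<eta>4 \<tau>0 u(2) in auto)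
      qed
    qed
    ultimately show ?thesis by blast
  qed
  have "D \<ge> 0" unfolding D_def by (intro add_nonneg_nonneg sum_nonneg) auto
  then show ?thesis using main K0 \<mu>(1) r(1,2) by blast
qed

subsection \<open>Blocks and resolvents\<close>

lemma l2_norm_power2: "(l2_norm v)\<^sup>2 = v \<bullet> v"
  by (simp add: l2_norm_def L2_set_def scalar_prod_def sum_nonneg power2_eq_square lessThan_atLeast0)

lemma scalar_prod_transpose_mult_vec:
  fixes A :: "real mat"
  assumes A: "A \<in> carrier_mat m n" and u: "u \<in> carrier_vec n" and x: "x \<in> carrier_vec m"
  shows "u \<bullet> (A\<^sup>T *\<^sub>v x) = (A *\<^sub>v u) \<bullet> x"
proof -
  have "u \<bullet> (A\<^sup>T *\<^sub>v x) = (\<Sum>j<n. \<Sum>i<m. A $$ (i, j) * u $ j * x $ i)"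
    using A u x by (auto simp: scalar_prod_def lessThan_atLeast0 sum_distrib_left intro!: sum.cong)
  also have "\<dots> = (\<Sum>i<m. \<Sum>j<n. A $$ (i, j) * u $ j * x $ i)" by (rule sum.swap)
  also have "\<dots> = (A *\<^sub>v u) \<bullet> x"
    using A u x by (auto simp: scalar_prod_def lessThan_atLeast0 sum_distrib_right intro!: sum.cong)
  finally show ?thesis .
qed

lemma smult_mat_mult_vec:
  fixes A :: "real mat"
  assumes "A \<in> carrier_mat m n" "v \<in> carrier_vec n"
  shows "(c \<cdot>\<^sub>m A) *\<^sub>v v = c \<cdot>\<^sub>v (A *\<^sub>v v)"
  using assms by (intro eq_vecI) auto

text \<open>A singular \<open>D - e\<close> would have a kernel vector, that is, an eigenvector; so
  \<open>mat_inverse\<close> does not return \<open>None\<close> here.\<close>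

lemma resolvent_inverse:
  fixes D :: "real mat"
  assumes D: "D \<in> carrier_mat n n" and e: "e \<notin> spectrum D"
  shows "resolvent D e \<in> carrier_mat n n" "(D - e \<cdot>\<^sub>m 1\<^sub>m n) * resolvent D e = 1\<^sub>m n"
    "resolvent D e * (D - e \<cdot>\<^sub>m 1\<^sub>m n) = 1\<^sub>m n"
proof -
  let ?A = "D - e \<cdot>\<^sub>m 1\<^sub>m n"
  have A: "?A \<in> carrier_mat n n" using D by auto
  have "det ?A \<noteq> 0"
  proof
    assume "det ?A = 0"
    then obtain v where v: "v \<in> carrier_vec n" "v \<noteq> 0\<^sub>v n" "?A *\<^sub>v v = 0\<^sub>v n"
      using det_0_iff_vec_prod_zero[OF A] by blast
    have "?A *\<^sub>v v = D *\<^sub>v v - e \<cdot>\<^sub>v v"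
      using D v(1) by (subst minus_mult_distrib_mat_vec) (auto simp: smult_mat_mult_vec[of _ n n])
    then have eq: "D *\<^sub>v v - e \<cdot>\<^sub>v v = 0\<^sub>v n" using v(3) by simp
    have "D *\<^sub>v v = e \<cdot>\<^sub>v v"
    proof (rule eq_vecI)
      fix i assume "i < dim_vec (e \<cdot>\<^sub>v v)"
      then have i: "i < n" using v(1) by simp
      then have "(D *\<^sub>v v - e \<cdot>\<^sub>v v) $ i = 0" using eq by simp
      then show "(D *\<^sub>v v) $ i = (e \<cdot>\<^sub>v v) $ i" using i D v(1) by simp
    qed (use D v(1) in auto)
    then have "eigenvector D v e" using D v by (auto simp: eigenvector_def)
    then show False using e by (auto simp: spectrum_def eigenvalue_def)
  qed
  from det_non_zero_imp_unit[OF A this, of "()"] have "mat_inverse ?A \<noteq> None" using mat_inverse(1)[OF A, of "()"] by blast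
  then obtain R where R: "mat_inverse ?A = Some R" by blast
  have "resolvent D e = R" unfolding resolvent_def using D R by simp
  then show "resolvent D e \<in> carrier_mat n n" "?A * resolvent D e = 1\<^sub>m n" "resolvent D e * ?A = 1\<^sub>m n"
    using mat_inverse(2)[OF A R] by auto
qed

lemma transpose_inverse_symmetric:
  fixes A R :: "real mat"
  assumes A: "A \<in> carrier_mat n n" "A\<^sup>T = A" and R: "R \<in> carrier_mat n n" and inv: "A * R = 1\<^sub>m n" "R * A = 1\<^sub>m n"
  shows "R\<^sup>T = R"
proof -
  have "R\<^sup>T * A = 1\<^sub>m n" using transpose_mult[OF A(1) R] A(2) inv(1) by simp
  then have "R\<^sup>T = R\<^sup>T * (A * R)" using R inv by simp
  also have "\<dots> = (R\<^sup>T * A) * R" using A R by (intro assoc_mult_mat[symmetric]) auto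
  also have "\<dots> = R" using \<open>R\<^sup>T * A = 1\<^sub>m n\<close> R by simp
  finally show ?thesis .
qed

text \<open>With \<open>w = R *\<^sub>v (B *\<^sub>v u)\<close>, symmetry of \<open>R\<close> and of
  \<open>B\<^sup>T * R * B\<close> turns both quadratic forms into squared norms. No inverse is left
  in the conclusion.\<close>

lemma resolvent_inequality_witness:
  fixes D B :: "real mat" and \<mu> e :: real
  defines "R \<equiv> resolvent D e"
  assumes D: "D \<in> carrier_mat n n" "D\<^sup>T = D" and B: "B \<in> carrier_mat n m" and e: "e \<notin> spectrum D"
    and u: "u \<in> carrier_vec m" "l2_norm u = 1"
    and ineq: "u \<bullet> ((B\<^sup>T * (\<mu>\<^sup>2 \<cdot>\<^sub>m (R ^\<^sub>m 2)) * B) *\<^sub>v u) \<ge> u \<bullet> (((B\<^sup>T * R * B) ^\<^sub>m 2 + 1\<^sub>m m) *\<^sub>v u)"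
  shows "\<exists>w\<in>carrier_vec n. (D - e \<cdot>\<^sub>m 1\<^sub>m n) *\<^sub>v w = B *\<^sub>v u \<and> \<mu>\<^sup>2 * (l2_norm w)\<^sup>2 \<ge> (l2_norm (B\<^sup>T *\<^sub>v w))\<^sup>2 + 1"
proof -
  let ?A = "D - e \<cdot>\<^sub>m 1\<^sub>m n"
  have A: "?A \<in> carrier_mat n n" "?A\<^sup>T = ?A"
  proof -
    have idx: "D $$ (j, i) = D $$ (i, j)" if "i < n" "j < n" for i j
      using that D by (metis carrier_matD index_transpose_mat(1))
    show "?A\<^sup>T = ?A" using D(1) idx by (intro eq_matI) auto
  qed (use D in auto)
  note Rinv = resolvent_inverse[OF D(1) e, folded R_def]
  have R: "R \<in> carrier_mat n n" by (rule Rinv)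
  have RT: "R\<^sup>T = R" by (rule transpose_inverse_symmetric[OF A R Rinv(2,3)])
  define w where "w = R *\<^sub>v (B *\<^sub>v u)"
  have Bu: "B *\<^sub>v u \<in> carrier_vec n" using B u by auto
  have w: "w \<in> carrier_vec n" unfolding w_def using R Bu by (rule mult_mat_vec_carrier)
  have BT: "B\<^sup>T \<in> carrier_mat m n" using B by auto
  have R2: "R ^\<^sub>m 2 = R * R" using R by (simp add: numeral_2_eq_2)
  have 1: "u \<bullet> ((B\<^sup>T * (\<mu>\<^sup>2 \<cdot>\<^sub>m (R ^\<^sub>m 2)) * B) *\<^sub>v u) = \<mu>\<^sup>2 * (l2_norm w)\<^sup>2"
  proof -
    have "(B\<^sup>T * (\<mu>\<^sup>2 \<cdot>\<^sub>m (R ^\<^sub>m 2)) * B) *\<^sub>v u = B\<^sup>T *\<^sub>v (\<mu>\<^sup>2 \<cdot>\<^sub>v (R *\<^sub>v w))"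
    proof -
      have "(B\<^sup>T * (\<mu>\<^sup>2 \<cdot>\<^sub>m (R * R)) * B) *\<^sub>v u = (B\<^sup>T * (\<mu>\<^sup>2 \<cdot>\<^sub>m (R * R))) *\<^sub>v (B *\<^sub>v u)"
        using BT R B u by (intro assoc_mult_mat_vec[of _ m n _ m]) auto
      also have "\<dots> = B\<^sup>T *\<^sub>v ((\<mu>\<^sup>2 \<cdot>\<^sub>m (R * R)) *\<^sub>v (B *\<^sub>v u))"
        using BT R Bu by (intro assoc_mult_mat_vec[of _ m n _ n]) auto
      also have "(\<mu>\<^sup>2 \<cdot>\<^sub>m (R * R)) *\<^sub>v (B *\<^sub>v u) = \<mu>\<^sup>2 \<cdot>\<^sub>v ((R * R) *\<^sub>v (B *\<^sub>v u))"
        using R Bu by (intro smult_mat_mult_vec[of _ n n]) auto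
      also have "(R * R) *\<^sub>v (B *\<^sub>v u) = R *\<^sub>v w"
        unfolding w_def using R Bu by (intro assoc_mult_mat_vec[of _ n n _ n]) auto
      finally show ?thesis unfolding R2 .
    qed
    then have "u \<bullet> ((B\<^sup>T * (\<mu>\<^sup>2 \<cdot>\<^sub>m (R ^\<^sub>m 2)) * B) *\<^sub>v u) = (B *\<^sub>v u) \<bullet> (\<mu>\<^sup>2 \<cdot>\<^sub>v (R *\<^sub>v w))"
      using scalar_prod_transpose_mult_vec[OF B u(1)] R w by simp
    also have "\<dots> = \<mu>\<^sup>2 * ((B *\<^sub>v u) \<bullet> (R\<^sup>T *\<^sub>v w))"
      unfolding RT using R w Bu by (intro scalar_prod_smult_distrib[of _ n]) auto
    also have "(B *\<^sub>v u) \<bullet> (R\<^sup>T *\<^sub>v w) = w \<bullet> w"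
      using scalar_prod_transpose_mult_vec[OF R Bu w] by (simp add: w_def)
    finally show ?thesis by (simp add: l2_norm_power2)
  qed
  let ?G = "B\<^sup>T * R * B"
  have G: "?G \<in> carrier_mat m m" using B R BT by auto
  have GT: "?G\<^sup>T = ?G"
  proof -
    have "?G\<^sup>T = B\<^sup>T * (B\<^sup>T * R)\<^sup>T" using B R BT by (intro transpose_mult[of _ m n _ m]) auto
    also have "(B\<^sup>T * R)\<^sup>T = R\<^sup>T * B\<^sup>T\<^sup>T" using BT R by (intro transpose_mult[of _ m n _ n]) auto
    also have "B\<^sup>T * (R\<^sup>T * B\<^sup>T\<^sup>T) = ?G" unfolding RT transpose_transpose using B R BT by (intro assoc_mult_mat[symmetric]) auto
    finally show ?thesis .
  qed
  have Gu: "?G *\<^sub>v u = B\<^sup>T *\<^sub>v w"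
  proof -
    have "?G *\<^sub>v u = (B\<^sup>T * R) *\<^sub>v (B *\<^sub>v u)" using BT R B u by (intro assoc_mult_mat_vec[of _ m n _ m]) auto
    also have "\<dots> = B\<^sup>T *\<^sub>v w" unfolding w_def using BT R Bu by (intro assoc_mult_mat_vec[of _ m n _ n]) auto
    finally show ?thesis .
  qed
  have 2: "u \<bullet> ((?G ^\<^sub>m 2 + 1\<^sub>m m) *\<^sub>v u) = (l2_norm (B\<^sup>T *\<^sub>v w))\<^sup>2 + 1"
  proof -
    have "?G ^\<^sub>m 2 = ?G * ?G" using G by (simp add: numeral_2_eq_2)
    then have "(?G ^\<^sub>m 2 + 1\<^sub>m m) *\<^sub>v u = ?G\<^sup>T *\<^sub>v (?G *\<^sub>v u) + u"
      unfolding GT using G u(1) by (simp add: add_mult_distrib_mat_vec[of _ m m] assoc_mult_mat_vec[of _ m m _ m])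
    then have "u \<bullet> ((?G ^\<^sub>m 2 + 1\<^sub>m m) *\<^sub>v u) = u \<bullet> (?G\<^sup>T *\<^sub>v (?G *\<^sub>v u)) + u \<bullet> u"
      using u(1) G by (simp add: scalar_prod_add_distrib[of _ m])
    also have "u \<bullet> (?G\<^sup>T *\<^sub>v (?G *\<^sub>v u)) = (?G *\<^sub>v u) \<bullet> (?G *\<^sub>v u)"
      by (rule scalar_prod_transpose_mult_vec[OF G u(1)]) (use G u in auto)
    finally show ?thesis using u(2) by (simp add: Gu l2_norm_power2[symmetric])
  qed
  have "?A *\<^sub>v w = (?A * R) *\<^sub>v (B *\<^sub>v u)" unfolding w_def using A R Bu by (intro assoc_mult_mat_vec[symmetric]) auto
  then have "?A *\<^sub>v w = B *\<^sub>v u" using Rinv Bu by simp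
  then show ?thesis using w ineq unfolding 1 2 by blast
qed

lemma shifted_blocks:
  fixes X :: "real mat"
  assumes X: "X \<in> carrier_mat N N" and g: "g \<in> carrier_vec N"
  shows "D_block W (shifted X g) \<in> carrier_mat (N - W) (N - W)"
    and "B_block W (shifted X g) \<in> carrier_mat (N - W) W"
    and "i < N - W \<Longrightarrow> j < N - W \<Longrightarrow> D_block W (shifted X g) $$ (i, j) = X $$ (i + W, j + W) - (if i = j then g $ (i + W) else 0)"
    and "i < N - W \<Longrightarrow> j < W \<Longrightarrow> B_block W (shifted X g) $$ (i, j) = X $$ (i + W, j)"
  using X g by (auto simp: D_block_def B_block_def shifted_def split_block_def Let_def mat_diag_def)

definition pad :: "nat \<Rightarrow> nat \<Rightarrow> real vec \<Rightarrow> nat \<Rightarrow> real" where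
  "pad W N u j = (if W \<le> j \<and> j < N then u $ (j - W) else 0)"

lemma sum_shift_pad:
  assumes "W \<le> (N :: nat)"
  shows "(\<Sum>j\<in>{W..<N}. f j) = (\<Sum>j<N - W. f (j + W) :: real)"
  using sum.shift_bounds_nat_ivl[of f 0 W "N - W"] assms by (simp add: lessThan_atLeast0)

lemma pad_sum:
  fixes N W :: nat and f :: "nat \<Rightarrow> real"
  assumes "W \<le> N" "\<And>j. j < N \<Longrightarrow> j < W \<Longrightarrow> f j = 0"
  shows "(\<Sum>j<N. f j) = (\<Sum>j<N - W. f (j + W))"
proof -
  have "(\<Sum>j<N. f j) = (\<Sum>j\<in>{W..<N}. f j)"
    by (rule sum.mono_neutral_right) (use assms in auto)
  then show ?thesis using sum_shift_pad[OF assms(1)] by simp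
qed

lemma L2_set_pad:
  assumes "W \<le> N" "u \<in> carrier_vec (N - W)"
  shows "L2_set (pad W N u) {..<N} = l2_norm u"
proof -
  have "(\<Sum>j<N. (pad W N u j)\<^sup>2) = (\<Sum>j<N - W. (pad W N u (j + W))\<^sup>2)"
    by (rule pad_sum) (use assms in \<open>auto simp: pad_def\<close>)
  also have "\<dots> = (\<Sum>j<N - W. (u $ j)\<^sup>2)" by (rule sum.cong) (auto simp: pad_def)
  finally show ?thesis using assms(2) by (simp add: L2_set_def l2_norm_def)
qed

text \<open>The restriction makes this a point of the product space over
  \<open>upper_rows N N\<close>.\<close>

definition upper_entries :: "nat \<Rightarrow> real mat \<Rightarrow> nat \<times> nat \<Rightarrow> real" where
  "upper_entries N X = (\<lambda>z\<in>upper_rows N N. X $$ z)"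

lemma sym_row_upper_entries:
  assumes X: "X \<in> carrier_mat N N" "X\<^sup>T = X" and i: "i < N"
  shows "sym_row N (upper_entries N X) v i = (\<Sum>j<N. X $$ (i, j) * v j)"
  unfolding sym_row_def
proof (rule sum.cong)
  fix j assume "j \<in> {..<N}"
  then have j: "j < N" by simp
  then have "X $$ (j, i) = X $$ (i, j)" using X i by (metis carrier_matD index_transpose_mat(1))
  then show "upper_entries N X (min i j, max i j) * v j = X $$ (i, j) * v j"
    using i j by (cases "i \<le> j") (auto simp: upper_entries_def upper_rows_def)
qed simp

lemma linf_norm_ge: "j < dim_vec g \<Longrightarrow> \<bar>g $ j\<bar> \<le> linf_norm g"
  unfolding linf_norm_def by (rule Max_ge) auto

lemma D_block_row:
  assumes X: "X \<in> carrier_mat N N" "X\<^sup>T = X" and g: "g \<in> carrier_vec N" and WN: "W \<le> N"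
    and u: "u \<in> carrier_vec (N - W)" and i: "i < N - W"
  shows "sym_row N (upper_entries N X) (pad W N u) (i + W) - e * pad W N u (i + W)
    = ((D_block W (shifted X g) - e \<cdot>\<^sub>m 1\<^sub>m (N - W)) *\<^sub>v u) $ i + g $ (i + W) * u $ i"
proof -
  note D = shifted_blocks[OF X(1) g, where W = W]
  have "sym_row N (upper_entries N X) (pad W N u) (i + W) = (\<Sum>j<N. X $$ (i + W, j) * pad W N u j)"
    using i by (intro sym_row_upper_entries X) auto
  also have "\<dots> = (\<Sum>j<N - W. X $$ (i + W, j + W) * pad W N u (j + W))"
    by (rule pad_sum) (use WN in \<open>auto simp: pad_def\<close>)
  also have "\<dots> = (\<Sum>j<N - W. X $$ (i + W, j + W) * u $ j)" by (rule sum.cong) (auto simp: pad_def)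
  finally have 1: "sym_row N (upper_entries N X) (pad W N u) (i + W) = (\<Sum>j<N - W. X $$ (i + W, j + W) * u $ j)" .
  have "((D_block W (shifted X g) - e \<cdot>\<^sub>m 1\<^sub>m (N - W)) *\<^sub>v u) $ i
    = (\<Sum>j<N - W. (D_block W (shifted X g) $$ (i, j) - (if i = j then e else 0)) * u $ j)"
    using D(1) u i by (auto simp: scalar_prod_def lessThan_atLeast0 intro!: sum.cong)
  also have "\<dots> = (\<Sum>j<N - W. X $$ (i + W, j + W) * u $ j - (if i = j then (g $ (i + W) + e) * u $ j else 0))"
  proof (rule sum.cong)
    fix j assume "j \<in> {..<N - W}"
    then have eq: "D_block W (shifted X g) $$ (i, j) = X $$ (i + W, j + W) - (if i = j then g $ (i + W) else 0)"
      using D(3)[OF i] by simp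
    show "(D_block W (shifted X g) $$ (i, j) - (if i = j then e else 0)) * u $ j
      = X $$ (i + W, j + W) * u $ j - (if i = j then (g $ (i + W) + e) * u $ j else 0)"
      unfolding eq by (simp add: algebra_simps)
  qed simp
  also have "\<dots> = (\<Sum>j<N - W. X $$ (i + W, j + W) * u $ j) - (g $ (i + W) + e) * u $ i"
    using i by (simp add: sum_subtractf sum.delta)
  finally have 2: "((D_block W (shifted X g) - e \<cdot>\<^sub>m 1\<^sub>m (N - W)) *\<^sub>v u) $ i
    = (\<Sum>j<N - W. X $$ (i + W, j + W) * u $ j) - (g $ (i + W) + e) * u $ i" .
  have 3: "pad W N u (i + W) = u $ i" using i by (simp add: pad_def)
  show ?thesis unfolding 1 2 3 by (simp add: algebra_simps)
qed

lemma L2_set_split_le: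
  fixes f :: "nat \<Rightarrow> real"
  assumes "W \<le> N"
  shows "L2_set f {..<N} \<le> L2_set f {..<W} + L2_set f {W..<N}"
proof -
  have "(\<Sum>j<N. (f j)\<^sup>2) = (\<Sum>j<W. (f j)\<^sup>2) + (\<Sum>j\<in>{W..<N}. (f j)\<^sup>2)"
    unfolding lessThan_atLeast0 by (rule sum.atLeastLessThan_concat[symmetric]) (use assms in auto)
  then show ?thesis unfolding L2_set_def by (simp add: sqrt_add_le_add_sqrt sum_nonneg)
qed

text \<open>The perturbation is diagonal, so it changes the residual by at most its sup
  norm.\<close>

lemma residual_norm:
  assumes X: "X \<in> carrier_mat N N" "X\<^sup>T = X" and g: "g \<in> carrier_vec N" and WN: "W < N"
    and u: "u \<in> carrier_vec (N - W)"
  shows "L2_set (\<lambda>i. sym_row N (upper_entries N X) (pad W N u) i - e * pad W N u i) {W..<N}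
    \<le> l2_norm ((D_block W (shifted X g) - e \<cdot>\<^sub>m 1\<^sub>m (N - W)) *\<^sub>v u) + linf_norm g * l2_norm u"
proof -
  let ?y = "(D_block W (shifted X g) - e \<cdot>\<^sub>m 1\<^sub>m (N - W)) *\<^sub>v u"
  have dim: "dim_vec ?y = N - W" using shifted_blocks(1)[OF X(1) g, of W] by simp
  have lg: "linf_norm g \<ge> 0" using linf_norm_ge[of 0 g] g WN by auto
  have "L2_set (\<lambda>i. sym_row N (upper_entries N X) (pad W N u) i - e * pad W N u i) {W..<N}
    = L2_set (\<lambda>i. ?y $ i + g $ (i + W) * u $ i) {..<N - W}"
    unfolding L2_set_def using WN
    by (subst sum_shift_pad) (auto simp: D_block_row[OF X g _ u] intro!: sum.cong)
  also have "\<dots> \<le> L2_set (\<lambda>i. ?y $ i) {..<N - W} + L2_set (\<lambda>i. g $ (i + W) * u $ i) {..<N - W}"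
    by (rule L2_set_triangle_ineq)
  also have "L2_set (\<lambda>i. ?y $ i) {..<N - W} = l2_norm ?y" unfolding l2_norm_def dim ..
  also have "L2_set (\<lambda>i. g $ (i + W) * u $ i) {..<N - W} \<le> L2_set (\<lambda>i. linf_norm g * u $ i) {..<N - W}"
    unfolding L2_set_def
  proof (intro real_sqrt_le_mono sum_mono)
    fix i assume "i \<in> {..<N - W}"
    then have "\<bar>g $ (i + W)\<bar> \<le> linf_norm g" using g by (intro linf_norm_ge) auto
    then have "\<bar>g $ (i + W) * u $ i\<bar> \<le> \<bar>linf_norm g * u $ i\<bar>" using lg by (simp add: abs_mult mult_right_mono)
    then show "(g $ (i + W) * u $ i)\<^sup>2 \<le> (linf_norm g * u $ i)\<^sup>2" by (simp only: abs_le_square_iff)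
  qed
  also have "\<dots> = linf_norm g * l2_norm u"
    using lg u by (simp add: L2_set_right_distrib l2_norm_def)
  finally show ?thesis by simp
qed

section \<open>Exclusion of both events on good samples\<close>

text \<open>Padding puts zeros on block 0 and the first \<open>W\<close> coordinates of
  \<open>u\<close> on block 1. The residual takes one half of \<open>\<mu>\<close>, the perturbation
  the other.\<close>

lemma good_sample_excludes_first:
  assumes X: "X \<in> carrier_mat N N" "X\<^sup>T = X" and WN: "W < N"
    and good: "good_sample N W 1 K0 \<mu> (upper_entries N X)" and \<mu>': "\<mu>' \<le> \<mu> / 2" "0 < \<mu>'"
    and g: "g \<in> carrier_vec N" "linf_norm g \<le> \<mu> / 2"
    and u: "u \<in> carrier_vec (N - W)" "l2_norm u = 1" and WN2: "2 * W \<le> N"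
    and res: "l2_norm ((D_block W (shifted X g) - e \<cdot>\<^sub>m 1\<^sub>m (N - W)) *\<^sub>v u) \<le> \<mu>'"
    and first: "(\<Sum>i<W. \<bar>u $ i\<bar>\<^sup>2) \<le> \<mu>'\<^sup>2"
  shows False
proof -
  let ?v = "pad W N u"
  have "(\<Sum>j\<in>{1 * W..<(1 + 1) * W}. (?v j)\<^sup>2) = (\<Sum>i<W. (?v (i + W))\<^sup>2)"
    using sum_shift_pad[of W "2 * W" "\<lambda>j. (?v j)\<^sup>2"] by (simp add: mult_2)
  also have "\<dots> = (\<Sum>i<W. \<bar>u $ i\<bar>\<^sup>2)" using WN2 by (intro sum.cong) (auto simp: pad_def)
  also have "\<dots> \<le> \<mu>\<^sup>2" using first \<mu>' power_mono[of \<mu>' \<mu> 2] by linarith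
  finally have "(\<Sum>j\<in>{1 * W..<(1 + 1) * W}. (?v j)\<^sup>2) \<le> \<mu>\<^sup>2" .
  moreover have "L2_set ?v {..<N} = 1" using L2_set_pad[of W N u] WN u by simp
  moreover have "\<forall>j<1 * W. ?v j = 0" by (simp add: pad_def)
  ultimately have "\<mu> < L2_set (\<lambda>i. sym_row N (upper_entries N X) ?v i - e * ?v i) {1 * W..<N}"
    using good unfolding good_sample_def by blast
  then show False using residual_norm[OF X g(1) WN u(1), of e] res g(2) u(2) \<mu>' by simp
qed

text \<open>For the witness \<open>w\<close> of norm \<open>n\<close>, the inequality says both
  \<open>\<mu>' * n \<ge> 1\<close> and that \<open>?B\<^sup>T *\<^sub>v w\<close> has norm at most
  \<open>\<mu>' * n\<close>. After division by \<open>n\<close>, the upper rows of the residual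
  contribute at most \<open>\<mu>'\<close>, the lower rows, equal to \<open>B u / n\<close> up to
  \<open>g\<close>, at most \<open>K0 * \<mu>' + \<mu> / 2\<close>. The padded vector has no mass on
  block 0, so the case \<open>l = 0\<close> is contradicted.\<close>

lemma good_sample_excludes_second:
  assumes X: "X \<in> carrier_mat N N" "X\<^sup>T = X" and WN: "W < N"
    and good: "good_sample N W 0 K0 \<mu> (upper_entries N X)" and K0: "K0 > 0"
    and \<mu>': "\<mu>' * (K0 + 1) \<le> \<mu> / 2" "0 < \<mu>'"
    and g: "g \<in> carrier_vec N" "linf_norm g \<le> \<mu> / 2"
    and u: "u \<in> carrier_vec W" "l2_norm u = 1"
    and e: "e \<notin> spectrum (D_block W (shifted X g))"
    and ineq: "let B = B_block W (shifted X g);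
               R = resolvent (D_block W (shifted X g)) e
           in u \<bullet> ((B\<^sup>T * (\<mu>'\<^sup>2 \<cdot>\<^sub>m (R ^\<^sub>m 2)) * B) *\<^sub>v u)
              \<ge> u \<bullet> (((B\<^sup>T * R * B) ^\<^sub>m 2 + 1\<^sub>m W) *\<^sub>v u)"
  shows False
proof -
  let ?D = "D_block W (shifted X g)" and ?B = "B_block W (shifted X g)" and ?h = "upper_entries N X"
  note blocks = shifted_blocks[OF X(1) g(1), where W = W]
  have sym: "X $$ (j, i) = X $$ (i, j)" if "i < N" "j < N" for i j
    using that X by (metis carrier_matD index_transpose_mat(1))
  have DT: "?D\<^sup>T = ?D"
    using blocks(1) blocks(3) sym by (intro eq_matI) auto
  obtain w where w: "w \<in> carrier_vec (N - W)" "(?D - e \<cdot>\<^sub>m 1\<^sub>m (N - W)) *\<^sub>v w = ?B *\<^sub>v u"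
    "\<mu>'\<^sup>2 * (l2_norm w)\<^sup>2 \<ge> (l2_norm (?B\<^sup>T *\<^sub>v w))\<^sup>2 + 1"
    using resolvent_inequality_witness[OF blocks(1) DT blocks(2) e u] ineq unfolding Let_def by blast
  define n where "n = l2_norm w"
  have n0: "n \<ge> 0" by (simp add: n_def l2_norm_def)
  have "(\<mu>' * n)\<^sup>2 \<ge> 1\<^sup>2"
    using w(3) by (simp add: n_def power_mult_distrib) (smt (verit) zero_le_power2)
  then have n1: "\<mu>' * n \<ge> 1" using n0 \<mu>' by (meson mult_nonneg_nonneg less_imp_le power2_le_imp_le)
  then have n: "n > 0" using n0 by (cases "n = 0") auto
  have nB: "l2_norm (?B\<^sup>T *\<^sub>v w) \<le> \<mu>' * n"
  proof (rule power2_le_imp_le)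
    show "(l2_norm (?B\<^sup>T *\<^sub>v w))\<^sup>2 \<le> (\<mu>' * n)\<^sup>2" using w(3) by (simp add: n_def power_mult_distrib)
  qed (use n \<mu>' in simp)
  have op: "L2_set (sym_row N ?h x) {..<N} \<le> K0 * L2_set x {..<N}" for x
    using good unfolding good_sample_def by blast
  have Bu: "l2_norm (?B *\<^sub>v u) \<le> K0"
  proof -
    let ?x = "\<lambda>j. if j < W then u $ j else 0"
    have "L2_set ?x {..<N} = l2_norm u"
    proof -
      have "(\<Sum>j<N. (?x j)\<^sup>2) = (\<Sum>j<W. (u $ j)\<^sup>2)"
        by (rule sum.mono_neutral_cong_right) (use WN in auto)
      then show ?thesis using u(1) by (simp add: L2_set_def l2_norm_def)
    qed
    then have "L2_set (sym_row N ?h ?x) {..<N} \<le> K0" using op[of ?x] u(2) by simp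
    moreover have "L2_set (sym_row N ?h ?x) {W..<N} \<le> L2_set (sym_row N ?h ?x) {..<N}"
      unfolding L2_set_def by (intro real_sqrt_le_mono sum_mono2) auto
    moreover have "L2_set (sym_row N ?h ?x) {W..<N} = l2_norm (?B *\<^sub>v u)"
    proof -
      have row: "sym_row N ?h ?x (i + W) = (?B *\<^sub>v u) $ i" if i: "i < N - W" for i
      proof -
        have "sym_row N ?h ?x (i + W) = (\<Sum>j<N. X $$ (i + W, j) * ?x j)"
          using i by (intro sym_row_upper_entries X) auto
        also have "\<dots> = (\<Sum>j<W. X $$ (i + W, j) * u $ j)"
          by (rule sum.mono_neutral_cong_right) (use WN in auto)
        also have "\<dots> = (?B *\<^sub>v u) $ i"
          using i blocks(2) blocks(4)[of i] u(1) by (auto simp: scalar_prod_def lessThan_atLeast0 intro!: sum.cong)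
        finally show ?thesis .
      qed
      have dim: "dim_vec (?B *\<^sub>v u) = N - W" using blocks(2) by simp
      have "(\<Sum>i\<in>{W..<N}. (sym_row N ?h ?x i)\<^sup>2) = (\<Sum>i<N - W. (sym_row N ?h ?x (i + W))\<^sup>2)"
        using WN by (intro sum_shift_pad) auto
      also have "\<dots> = (\<Sum>i<N - W. ((?B *\<^sub>v u) $ i)\<^sup>2)" by (intro sum.cong refl) (simp add: row)
      finally show ?thesis unfolding L2_set_def l2_norm_def dim by simp
    qed
    ultimately show ?thesis by linarith
  qed
  define v where "v = (1 / n) \<cdot>\<^sub>v w"
  have v: "v \<in> carrier_vec (N - W)" using w by (simp add: v_def)
  have scale: "l2_norm ((1 / n) \<cdot>\<^sub>v y) = l2_norm y / n" for y
  proof -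
    have "l2_norm ((1 / n) \<cdot>\<^sub>v y) = L2_set (\<lambda>i. (1 / n) * y $ i) {..<dim_vec y}"
      by (simp add: l2_norm_def L2_set_def)
    also have "\<dots> = (1 / n) * l2_norm y" using n by (simp only: L2_set_right_distrib l2_norm_def less_imp_le zero_le_divide_1_iff)
    finally show ?thesis by simp
  qed
  have v1: "l2_norm v = 1" using n unfolding v_def scale by (simp add: n_def)
  have Av: "(?D - e \<cdot>\<^sub>m 1\<^sub>m (N - W)) *\<^sub>v v = (1 / n) \<cdot>\<^sub>v (?B *\<^sub>v u)"
    unfolding v_def using w blocks(1) by (subst mult_mat_vec) (auto simp: w(2))
  let ?p = "pad W N v"
  let ?f = "\<lambda>i. sym_row N ?h ?p i - e * ?p i"
  have low: "L2_set ?f {W..<N} \<le> K0 * \<mu>' + \<mu> / 2"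
  proof -
    have "L2_set ?f {W..<N} \<le> l2_norm (?B *\<^sub>v u) / n + linf_norm g"
      using residual_norm[OF X g(1) WN v, of e] unfolding Av scale v1 by simp
    also have "l2_norm (?B *\<^sub>v u) / n \<le> K0 * \<mu>'"
    proof -
      have "l2_norm (?B *\<^sub>v u) \<le> K0 * 1" using Bu by simp
      also have "\<dots> \<le> K0 * (\<mu>' * n)" using n1 K0 by (intro mult_left_mono) auto
      finally show ?thesis using n by (simp add: pos_divide_le_eq mult.assoc)
    qed
    finally show ?thesis using g(2) by simp
  qed
  have top: "L2_set ?f {..<W} \<le> \<mu>'"
  proof -
    have row: "?f i = ((1 / n) \<cdot>\<^sub>v (?B\<^sup>T *\<^sub>v w)) $ i" if i: "i < W" for i
    proof -
      have "?f i = (\<Sum>j<N. X $$ (i, j) * ?p j)"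
        using i WN sym_row_upper_entries[OF X, of i ?p] by (simp add: pad_def)
      also have "\<dots> = (\<Sum>j<N - W. X $$ (i, j + W) * ?p (j + W))"
        by (rule pad_sum) (use WN in \<open>auto simp: pad_def\<close>)
      also have "\<dots> = (\<Sum>j<N - W. (1 / n) * (?B $$ (j, i) * w $ j))"
        using i WN w(1) blocks(4)[of _ i] sym by (intro sum.cong) (auto simp: pad_def v_def)
      also have "\<dots> = ((1 / n) \<cdot>\<^sub>v (?B\<^sup>T *\<^sub>v w)) $ i"
        using i blocks(2) w(1) by (simp add: scalar_prod_def lessThan_atLeast0 sum_distrib_left)
      finally show ?thesis .
    qed
    have "L2_set ?f {..<W} = l2_norm ((1 / n) \<cdot>\<^sub>v (?B\<^sup>T *\<^sub>v w))"
      unfolding l2_norm_def using blocks(2) by (intro L2_set_cong) (auto simp: row)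
    also have "\<dots> \<le> \<mu>'" unfolding scale using nB n by (simp add: pos_divide_le_eq)
    finally show ?thesis .
  qed
  have "L2_set ?f {..<N} \<le> \<mu>"
    using L2_set_split_le[of W N ?f] WN top low \<mu>'(1) by (simp add: algebra_simps)
  moreover have "(\<Sum>j\<in>{0 * W..<(0 + 1) * W}. (?p j)\<^sup>2) = 0" by (simp add: pad_def)
  then have "(\<Sum>j\<in>{0 * W..<(0 + 1) * W}. (?p j)\<^sup>2) \<le> \<mu>\<^sup>2" by simp
  moreover have "L2_set ?p {..<N} = 1" using L2_set_pad[of W N v] WN v v1 by simp
  moreover have "\<forall>j<0 * W. ?p j = 0" by simp
  ultimately have "\<mu> < L2_set ?f {0 * W..<N}" using good unfolding good_sample_def by blast
  then show False using \<open>L2_set ?f {..<N} \<le> \<mu>\<close> by (simp add: lessThan_atLeast0)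
qed

section \<open>From the random matrix to the product law, and conclusion\<close>

lemma eventually_geometric_le_powr:
  fixes D r b K :: real
  assumes "0 < r" "r < 1" "b > 0"
  shows "\<forall>\<^sub>F W in sequentially. D * r ^ W \<le> (b * real W) powr (- K)"
proof -
  define a where "a = - ln r"
  have a: "a > 0" using assms by (simp add: a_def)
  have "(\<lambda>W. \<bar>D\<bar> * exp (- a * real W) * (b * real W) powr K) \<longlonglongrightarrow> 0"
    using a assms(3) by real_asymp
  then have "\<forall>\<^sub>F W in sequentially. \<bar>D\<bar> * exp (- a * real W) * (b * real W) powr K < 1"
    by (rule order_tendstoD) simp
  then show ?thesis using eventually_gt_at_top[of 0]
  proof eventually_elim
    case (elim W)
    have rW: "r ^ W = exp (- a * real W)" using assms by (simp add: a_def exp_of_nat_mult mult.commute[of _ "real W"])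
    have pos: "(b * real W) powr K > 0" using elim assms by simp
    have "D * r ^ W \<le> \<bar>D\<bar> * r ^ W" using assms by (intro mult_right_mono) auto
    also have "\<dots> \<le> 1 / (b * real W) powr K" using elim(1) pos unfolding rW by (simp add: pos_le_divide_eq)
    also have "\<dots> = (b * real W) powr (- K)" by (simp add: powr_minus_divide)
    finally show ?case .
  qed
qed

lemma subgaussian_entries_bound:
  assumes "subgaussian_entries p M H"
  obtains \<delta> C where "\<delta> > 0" "C \<ge> 1"
    "\<And>W i j. W \<ge> 1 \<Longrightarrow> i < 2 * p * W \<Longrightarrow> j < 2 * p * W \<Longrightarrow>
      (\<integral>\<^sup>+\<omega>. ennreal (exp (\<delta> * real W * (H W \<omega> $$ (i, j))\<^sup>2)) \<partial>M W) \<le> ennreal C"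
proof -
  obtain \<delta> where \<delta>: "\<delta> > 0" "(SUP W\<in>{1..}. SUP i\<in>{..<2 * p * W}. SUP j\<in>{..<2 * p * W}.
        (\<integral>\<^sup>+ \<omega>. ennreal (exp (\<delta> * real W * (H W \<omega> $$ (i, j))\<^sup>2)) \<partial>M W)) < \<infinity>" (is "?S < \<infinity>")
    using assms unfolding subgaussian_entries_def by blast
  \<comment> \<open>At least 1, the exponential moment of the point mass at 0 that serves as a
    default entry law.\<close>
  define C where "C = max 1 (enn2real ?S)"
  have "?S = ennreal (enn2real ?S)" using \<delta>(2) by (simp add: ennreal_enn2real less_top)
  also have "\<dots> \<le> ennreal C" by (intro ennreal_leI) (simp add: C_def)
  finally have S: "?S \<le> ennreal C" .
  show ?thesis
  proof (rule that[OF \<delta>(1)])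
    show "C \<ge> 1" by (simp add: C_def)
    fix W i j assume "W \<ge> 1" "i < 2 * p * W" "j < 2 * p * W"
    then have "(\<integral>\<^sup>+ \<omega>. ennreal (exp (\<delta> * real W * (H W \<omega> $$ (i, j))\<^sup>2)) \<partial>M W) \<le> ?S"
      by (intro SUP_upper2[of W] SUP_upper2[of i] SUP_upper2[of j]) auto
    then show "(\<integral>\<^sup>+ \<omega>. ennreal (exp (\<delta> * real W * (H W \<omega> $$ (i, j))\<^sup>2)) \<partial>M W) \<le> ennreal C"
      using S by (rule order_trans)
  qed
qed

text \<open>Independence on and above the diagonal means that the joint law of these entries is a
  product, which is where all probabilities were estimated.\<close>

lemma random_band_matrix_law:
  fixes p W :: nat and M :: "'w measure" and H :: "'w \<Rightarrow> real mat" and \<delta> C :: real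
  defines "N \<equiv> 2 * p * W"
  assumes H: "random_band_matrix N W M H" and \<delta>: "\<delta> > 0" and C: "C \<ge> 1" and W: "W \<ge> 1" and p: "p \<ge> 1"
    and exp_bound: "\<And>i j. i < N \<Longrightarrow> j < N \<Longrightarrow>
      (\<integral>\<^sup>+\<omega>. ennreal (exp (\<delta> * real W * (H \<omega> $$ (i, j))\<^sup>2)) \<partial>M) \<le> ennreal C"
  obtains P where "band_law \<delta> C p W P"
    "(\<lambda>\<omega>. upper_entries N (H \<omega>)) \<in> measurable M (PiM (upper_rows N N) P)"
    "distr M (PiM (upper_rows N N) P) (\<lambda>\<omega>. upper_entries N (H \<omega>)) = PiM (upper_rows N N) P"
proof -
  interpret prob_space M using H by (simp add: random_band_matrix_def)
  let ?U = "upper_rows N N"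
  have U: "{(i, j). i \<le> j \<and> j < N} = ?U" by (auto simp: upper_rows_def)
  have ind: "indep_vars (\<lambda>_. borel) (\<lambda>ij \<omega>. H \<omega> $$ ij) ?U"
    using H unfolding random_band_matrix_def U by blast
  have meas: "(\<lambda>\<omega>. H \<omega> $$ z) \<in> borel_measurable M" if "z \<in> ?U" for z
    using ind that unfolding indep_vars_def by auto
  \<comment> \<open>outside \<open>?U\<close> the law is irrelevant for the product measure but must be an entry law\<close>
  define P where "P z = (if z \<in> ?U then distr M borel (\<lambda>\<omega>. H \<omega> $$ z) else return borel 0)" for z
  have N0: "N > 0" using W p by (simp add: N_def)
  have "(0, 0) \<in> ?U" using N0 by (simp add: upper_rows_def)
  then have ne: "?U \<noteq> {}" by blast
  have PiM_eq: "PiM ?U (\<lambda>z. distr M borel (\<lambda>\<omega>. H \<omega> $$ z)) = PiM ?U P"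
    by (intro PiM_cong) (auto simp: P_def)
  have sets_PiM_eq: "sets (PiM ?U P) = sets (PiM ?U (\<lambda>_. borel :: real measure))"
    by (intro sets_PiM_cong) (auto simp: P_def)
  have joint: "distr M (PiM ?U (\<lambda>_. borel)) (\<lambda>\<omega>. \<lambda>z\<in>?U. H \<omega> $$ z) = PiM ?U P"
    using indep_vars_iff_distr_eq_PiM'[OF ne, where M' = "\<lambda>_. borel" and X = "\<lambda>z \<omega>. H \<omega> $$ z"] meas ind
    unfolding PiM_eq by blast
  have "band_law \<delta> C p W P"
  proof
    fix z
    show "entry_law \<delta> C (real W) (P z)"
    proof (cases "z \<in> ?U")
      case True
      then obtain i j where z: "z = (i, j)" "i < N" "j < N" by (auto simp: upper_rows_def)
      note [measurable] = meas[OF True]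
      have "integrable M (\<lambda>\<omega>. H \<omega> $$ z)" "expectation (\<lambda>\<omega>. H \<omega> $$ z) = 0"
        using H z unfolding random_band_matrix_def by auto
      moreover have "real_distribution (distr M borel (\<lambda>\<omega>. H \<omega> $$ z))"
        by (rule real_distribution_distr) measurable
      ultimately show ?thesis using True exp_bound[OF z(2,3)]
        by (simp add: entry_law_def P_def integrable_distr_eq integral_distr nn_integral_distr z(1))
    next
      case False
      have "real_distribution (return borel (0::real))"
        by (intro real_distribution.intro prob_space_return) (auto simp: real_distribution_axioms_def)
      moreover have "integrable (return borel (0::real)) (\<lambda>x. x)"
        by (rule integrableI_bounded) (auto simp: nn_integral_return)
      moreover have "(\<integral>x. x \<partial>return borel (0::real)) = 0" by (subst integral_return) auto
      moreover have "(\<integral>\<^sup>+x. ennreal (exp (\<delta> * real W * x\<^sup>2)) \<partial>return borel 0) \<le> ennreal C"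
        using C by (subst nn_integral_return) auto
      ultimately show ?thesis using False by (simp add: entry_law_def P_def)
    qed
  next
    fix i j assume ij: "i \<le> j" "j < 2 * p * W" "j < i + 2 * W"
    then have U: "(i, j) \<in> ?U" and iN: "i < N" "j < N" by (auto simp: upper_rows_def N_def)
    have "periodic_dist N i j < 2 * W" using ij by (simp add: periodic_dist_def Let_def nat_less_iff)
    then have "integrable M (\<lambda>\<omega>. (H \<omega> $$ (i, j))\<^sup>2)" "expectation (\<lambda>\<omega>. (H \<omega> $$ (i, j))\<^sup>2) = 1 / (4 * real W - 1)"
      using H iN unfolding random_band_matrix_def by auto
    then show "integrable (P (i, j)) (\<lambda>x. x\<^sup>2) \<and> (\<integral>x. x\<^sup>2 \<partial>P (i, j)) = 1 / (4 * real W - 1)"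
      using U meas[OF U] by (simp add: P_def integrable_distr_eq integral_distr)
  qed (use \<delta> C W p in auto)
  moreover have m: "(\<lambda>\<omega>. upper_entries N (H \<omega>)) \<in> measurable M (PiM ?U (\<lambda>_. borel))"
    unfolding upper_entries_def by (rule measurable_restrict) (rule meas)
  then have "(\<lambda>\<omega>. upper_entries N (H \<omega>)) \<in> measurable M (PiM ?U P)"
    by (simp cong: measurable_cong_sets add: sets_PiM_eq)
  moreover have "distr M (PiM ?U P) (\<lambda>\<omega>. upper_entries N (H \<omega>)) = PiM ?U P"
    using joint unfolding upper_entries_def by (subst distr_cong[OF refl sets_PiM_eq refl]) auto
  ultimately show ?thesis by (rule that)
qed

text \<open>The events quantify over uncountably many parameters, so their measurability is never
  claimed; they are covered by the measurable preimage of a bad set.\<close>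

lemma outer_measure_le_bad:
  assumes X: "X \<in> measurable M L" and law: "distr M L X = L" and Bad: "Bad \<in> sets L"
    and sub: "\<And>\<omega>. \<omega> \<in> A \<Longrightarrow> \<omega> \<in> space M \<and> X \<omega> \<in> Bad"
  shows "outer_measure_of M A \<le> emeasure L Bad"
proof -
  have "outer_measure_of M A \<le> outer_measure_of M (X -` Bad \<inter> space M)"
    by (rule outer_measure_of_mono) (use sub in auto)
  also have "\<dots> = emeasure M (X -` Bad \<inter> space M)" using X Bad by (simp add: measurable_sets)
  also have "\<dots> = emeasure L Bad" using emeasure_distr[OF X Bad] unfolding law by simp
  finally show ?thesis .
qed

theorem proposition3p1:
  fixes p :: nat
    and M :: "nat \<Rightarrow> 'w measure"
    and H :: "nat \<Rightarrow> 'w \<Rightarrow> real mat"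
  assumes "p \<ge> 2"
    and "\<And>W. W \<ge> 1 \<Longrightarrow> random_band_matrix (2 * p * W) W (M W) (H W)"
    and "subgaussian_entries p M H"
  shows "\<exists>\<mu>>0. \<forall>c>0. \<forall>K>0. \<forall>\<^sub>F W in sequentially. \<forall>N. N = 2 * p * W \<longrightarrow>
     outer_measure_of (M W)
       {\<omega> \<in> space (M W). \<exists>e :: real. \<exists>u \<in> carrier_vec (N - W). \<exists>g \<in> carrier_vec N.
          linf_norm g \<le> real N powr (- c) \<and>
          l2_norm u = 1 \<and>
          l2_norm ((D_block W (shifted (H W \<omega>) g) - e \<cdot>\<^sub>m 1\<^sub>m (N - W)) *\<^sub>v u) \<le> \<mu> \<and>
          (\<Sum>i<W. \<bar>u $ i\<bar>\<^sup>2) \<le> \<mu>\<^sup>2}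
       \<le> ennreal (real N powr (- K)) \<and>
     outer_measure_of (M W)
       {\<omega> \<in> space (M W). \<exists>g \<in> carrier_vec N. \<exists>e :: real. \<exists>u \<in> carrier_vec W.
          linf_norm g \<le> real N powr (- c) \<and>
          e \<notin> spectrum (D_block W (shifted (H W \<omega>) g)) \<and>
          l2_norm u = 1 \<and>
          (let B = B_block W (shifted (H W \<omega>) g);
               R = resolvent (D_block W (shifted (H W \<omega>) g)) e
           in u \<bullet> ((B\<^sup>T * (\<mu>\<^sup>2 \<cdot>\<^sub>m (R ^\<^sub>m 2)) * B) *\<^sub>v u)
              \<ge> u \<bullet> (((B\<^sup>T * R * B) ^\<^sub>m 2 + 1\<^sub>m W) *\<^sub>v u))}
       \<le> ennreal (real N powr (- K))"
proof -
  have p: "p \<ge> 1" using assms(1) by simp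
  obtain \<delta> C where \<delta>: "\<delta> > 0" and C: "C \<ge> 1"
    and bound: "\<And>W i j. W \<ge> 1 \<Longrightarrow> i < 2 * p * W \<Longrightarrow> j < 2 * p * W \<Longrightarrow>
      (\<integral>\<^sup>+\<omega>. ennreal (exp (\<delta> * real W * (H W \<omega> $$ (i, j))\<^sup>2)) \<partial>M W) \<le> ennreal C"
    using subgaussian_entries_bound[OF assms(3)] by blast
  obtain K0 \<mu> D r W0 where K0: "K0 > 0" and \<mu>: "\<mu> > 0" and r: "0 < r" "r < 1"
    and good: "\<forall>W P l. W \<ge> W0 \<longrightarrow> band_law \<delta> C p W P \<longrightarrow> l + 1 < 2 * p \<longrightarrow>
    (\<exists>Bad\<in>sets (PiM (upper_rows (2 * p * W) (2 * p * W)) P).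
      emeasure (PiM (upper_rows (2 * p * W) (2 * p * W)) P) Bad \<le> ennreal (D * r ^ W) \<and>
      (\<forall>h\<in>space (PiM (upper_rows (2 * p * W) (2 * p * W)) P) - Bad. good_sample (2 * p * W) W l K0 \<mu> h))"
  proof -
    have "C > 0" using C by simp
    from band_law_good_sample[OF \<delta> this p] show ?thesis by (elim exE conjE) (rule that)
  qed
  \<comment> \<open>One half of \<open>\<mu>\<close> is reserved for \<open>g\<close>; the other is
    divided between the lower rows (\<open>K0 * \<mu>'\<close>) and the upper rows
    (\<open>\<mu>'\<close>) in the second event.\<close>
  define \<mu>' where "\<mu>' = \<mu> / (2 * (K0 + 1))"
  have \<mu>': "0 < \<mu>'" "\<mu>' * (K0 + 1) \<le> \<mu> / 2" "\<mu>' \<le> \<mu> / 2"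
    using \<mu> K0 by (auto simp: \<mu>'_def field_simps)
  show ?thesis
  proof (intro exI[of _ \<mu>'] conjI \<mu>'(1) allI impI)
    fix c K :: real assume c: "c > 0" and K: "K > 0"
    have p0: "real (2 * p) > 0" using p by simp
    \<comment> \<open>The exponent \<open>c\<close> matters only for how soon \<open>g\<close> drops
      below \<open>\<mu> / 2\<close>, so \<open>\<mu>'\<close> can be fixed before
      \<open>c\<close>.\<close>
    have "((\<lambda>W. (real (2 * p) * real W) powr (- c)) \<longlongrightarrow> 0) sequentially"
      using p0 c filterlim_real_sequentially
      by (intro tendsto_neg_powr filterlim_tendsto_pos_mult_at_top[OF tendsto_const]) auto
    then have "\<forall>\<^sub>F W in sequentially. (real (2 * p) * real W) powr (- c) < \<mu> / 2"
      by (rule order_tendstoD) (use \<mu> in simp)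
    moreover have "\<forall>\<^sub>F W in sequentially. D * r ^ W \<le> (real (2 * p) * real W) powr (- K)"
      by (rule eventually_geometric_le_powr[OF r p0])
    ultimately show "\<forall>\<^sub>F W in sequentially. \<forall>N. N = 2 * p * W \<longrightarrow>
     outer_measure_of (M W)
       {\<omega> \<in> space (M W). \<exists>e :: real. \<exists>u \<in> carrier_vec (N - W). \<exists>g \<in> carrier_vec N.
          linf_norm g \<le> real N powr (- c) \<and>
          l2_norm u = 1 \<and>
          l2_norm ((D_block W (shifted (H W \<omega>) g) - e \<cdot>\<^sub>m 1\<^sub>m (N - W)) *\<^sub>v u) \<le> \<mu>' \<and>
          (\<Sum>i<W. \<bar>u $ i\<bar>\<^sup>2) \<le> \<mu>'\<^sup>2}
       \<le> ennreal (real N powr (- K)) \<and>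
     outer_measure_of (M W)
       {\<omega> \<in> space (M W). \<exists>g \<in> carrier_vec N. \<exists>e :: real. \<exists>u \<in> carrier_vec W.
          linf_norm g \<le> real N powr (- c) \<and>
          e \<notin> spectrum (D_block W (shifted (H W \<omega>) g)) \<and>
          l2_norm u = 1 \<and>
          (let B = B_block W (shifted (H W \<omega>) g);
               R = resolvent (D_block W (shifted (H W \<omega>) g)) e
           in u \<bullet> ((B\<^sup>T * (\<mu>'\<^sup>2 \<cdot>\<^sub>m (R ^\<^sub>m 2)) * B) *\<^sub>v u)
              \<ge> u \<bullet> (((B\<^sup>T * R * B) ^\<^sub>m 2 + 1\<^sub>m W) *\<^sub>v u))}
       \<le> ennreal (real N powr (- K))"
      using eventually_ge_at_top[of "max 1 W0"]
    proof eventually_elim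
      case (elim W)
      define N where "N = 2 * p * W"
      have W: "W \<ge> 1" "W \<ge> W0" using elim(3) by auto
      have small: "real N powr (- c) \<le> \<mu> / 2" using elim(1) by (simp add: N_def)
      have prob: "D * r ^ W \<le> real N powr (- K)" using elim(2) by (simp add: N_def)
      have WN: "2 * W \<le> N" unfolding N_def using p by simp
      have WN': "W < N" using WN W by simp
      note HW = assms(2)[OF W(1)]
      have X: "H W \<omega> \<in> carrier_mat N N" "(H W \<omega>)\<^sup>T = H W \<omega>" if "\<omega> \<in> space (M W)" for \<omega>
        using HW that unfolding random_band_matrix_def N_def by auto
      obtain P where P: "band_law \<delta> C p W P"
        "(\<lambda>\<omega>. upper_entries N (H W \<omega>)) \<in> measurable (M W) (PiM (upper_rows N N) P)"
        "distr (M W) (PiM (upper_rows N N) P) (\<lambda>\<omega>. upper_entries N (H W \<omega>)) = PiM (upper_rows N N) P"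
        using random_band_matrix_law[OF HW \<delta> C W(1) p bound[OF W(1)]] unfolding N_def by blast
      have outer: "outer_measure_of (M W) A \<le> ennreal (real N powr (- K))"
        if l: "l + 1 < 2 * p" and A: "\<And>\<omega>. \<omega> \<in> A \<Longrightarrow> \<omega> \<in> space (M W)"
          "\<And>\<omega>. \<omega> \<in> A \<Longrightarrow> good_sample N W l K0 \<mu> (upper_entries N (H W \<omega>)) \<Longrightarrow> False" for A l
      proof -
        obtain Bad where Bad: "Bad \<in> sets (PiM (upper_rows N N) P)"
          "emeasure (PiM (upper_rows N N) P) Bad \<le> ennreal (D * r ^ W)"
          "\<And>h. h \<in> space (PiM (upper_rows N N) P) - Bad \<Longrightarrow> good_sample N W l K0 \<mu> h"
          using good[rule_format, OF W(2) P(1) l] unfolding N_def by blast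
        have "outer_measure_of (M W) A \<le> emeasure (PiM (upper_rows N N) P) Bad"
        proof (rule outer_measure_le_bad[OF P(2,3) Bad(1)])
          fix \<omega> assume "\<omega> \<in> A"
          then show "\<omega> \<in> space (M W) \<and> upper_entries N (H W \<omega>) \<in> Bad"
            using A Bad(3) measurable_space[OF P(2)] by blast
        qed
        also have "\<dots> \<le> ennreal (real N powr (- K))"
          using Bad(2) prob by (meson ennreal_leI order_trans)
        finally show ?thesis .
      qed
      show ?case
        unfolding N_def[symmetric]
      proof (intro allI impI conjI, goal_cases)
        case (1 N')
        then have N': "N' = N" .
        show ?case unfolding N'
        proof (rule outer[of 1])
          show "1 + 1 < 2 * p" using assms(1) by simp
        next
          fix \<omega> assume \<omega>: "\<omega> \<in> {\<omega> \<in> space (M W). \<exists>e :: real. \<exists>u \<in> carrier_vec (N - W). \<exists>g \<in> carrier_vec N.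
            linf_norm g \<le> real N powr (- c) \<and> l2_norm u = 1 \<and>
            l2_norm ((D_block W (shifted (H W \<omega>) g) - e \<cdot>\<^sub>m 1\<^sub>m (N - W)) *\<^sub>v u) \<le> \<mu>' \<and>
            (\<Sum>i<W. \<bar>u $ i\<bar>\<^sup>2) \<le> \<mu>'\<^sup>2}"
          then show "\<omega> \<in> space (M W)" by blast
          assume g: "good_sample N W 1 K0 \<mu> (upper_entries N (H W \<omega>))"
          show False
            using \<omega> good_sample_excludes_first[OF X WN' g \<mu>'(3,1) _ order_trans[OF _ small] _ _ WN] by blast
        qed
      next
        case (2 N')
        then have N': "N' = N" .
        show ?case unfolding N'
        proof (rule outer[of 0])
          show "0 + 1 < 2 * p" using assms(1) by simp
        next
          fix \<omega> assume \<omega>: "\<omega> \<in> {\<omega> \<in> space (M W). \<exists>g \<in> carrier_vec N. \<exists>e :: real. \<exists>u \<in> carrier_vec W.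
            linf_norm g \<le> real N powr (- c) \<and>
            e \<notin> spectrum (D_block W (shifted (H W \<omega>) g)) \<and>
            l2_norm u = 1 \<and>
            (let B = B_block W (shifted (H W \<omega>) g);
                 R = resolvent (D_block W (shifted (H W \<omega>) g)) e
             in u \<bullet> ((B\<^sup>T * (\<mu>'\<^sup>2 \<cdot>\<^sub>m (R ^\<^sub>m 2)) * B) *\<^sub>v u)
                \<ge> u \<bullet> (((B\<^sup>T * R * B) ^\<^sub>m 2 + 1\<^sub>m W) *\<^sub>v u))}"
          then show "\<omega> \<in> space (M W)" by blast
          assume g: "good_sample N W 0 K0 \<mu> (upper_entries N (H W \<omega>))"
          show False
            using \<omega> good_sample_excludes_second[OF X WN' g K0 \<mu>'(2,1) _ order_trans[OF _ small]] by blast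
        qed
      qed
    qed
  qed
qed

end
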